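(* Let $\mathcal{M}$ be a complete connected Riemannian manifold and let $f:\mathcal{M}\to\mathbb{R}$ be continuously differentiable. Assume that $\operatorname{grad} f$ is $L$-Lipschitz continuous on $\mathcal{M}$ ($L>0$) and that there is $f_*\in\mathbb{R}$ with $f(x)\ge f_*$ for all $x\in\mathcal{M}$. Let $\{x_n\}$ (together with $\{w_n\},\{\alpha_n\},\{\tilde\mu_n\}$) be generated by the RIAG-R algorithm with parameters $\eta>0$, $\varepsilon>0$, $\mu\in(0,1)$ and initial points $x_0,x_1\in\mathcal{M}$. Put $$L'=\frac{L}{2}+\frac{2L\mu^2(1+\mu^2)}{(1-\mu^2)^2}$$ and suppose $\eta/\varepsilon\le 1/(2L')$. Then for any $N\ge1$, $$\sum_{n=1}^N\alpha_n\Bigl(1-\frac{L\alpha_n}{2}\Bigr)\lVert\operatorname{grad} f(w_n)\rVert^2\;\le\; f(x_1)-f_*+\frac{L}{2}\sum_{n=1}^N\tilde\mu_n^2\,d(x_n,x_{n-1})^2 .$$ Moreover, $\sum_{n=1}^\infty d(x_n,x_{n-1})^2<\infty$ and $\sum_{n=1}^\infty\alpha_n\lVert\operatorname{grad} f(w_n)\rVert^2<\infty$; hence $d(x_n,x_{n-1})\to0$. If, in addition, $\sum_n\alpha_n=\infty$, then $\liminf_{n\to\infty}\lVert\operatorname{grad} f(w_n)\rVert=0$; and if $\inf_n\alpha_n>0$, then $\lVert\operatorname{grad} f(w_n)\rVert\to0$.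
   Context: Notation: $\langle\cdot,\cdot\rangle$ and $\lVert\cdot\rVert$ are the Riemannian inner product and norm on the relevant tangent space, $d$ is the Riemannian distance, $\exp_x:T_x\mathcal{M}\to\mathcal{M}$ is the exponential map, and $\log_x(y)\in T_x\mathcal{M}$ denotes the logarithmic map, satisfying $\exp_x(\log_x(y))=y$ and $\lVert\log_x(y)\rVert=d(x,y)$. $\operatorname{grad} f$ is the Riemannian gradient. $L$-Lipschitz gradient: for any $x,y\in\mathcal{M}$ joined by a minimising geodesic $\gamma:[0,1]\to\mathcal{M}$ from $x$ to $y$, $\lVert \mathcal{P}_{\gamma,0,1}\operatorname{grad} f(x)-\operatorname{grad} f(y)\rVert\le L\,d(x,y)$, where $\mathcal{P}_{\gamma,0,1}:T_x\mathcal{M}\to T_y\mathcal{M}$ is parallel transport along $\gamma$. RIAG-R algorithm (parameters $\eta>0$, $\varepsilon>0$, $\mu\in(0,1)$; initial points $x_0,x_1\in\mathcal{M}$): set $G_0=0$, and for $n=1,2,3,\dots$: (1) $\bar\mu_n=\min\{\mu,\ \mu\, d(x_n,x_{n-1})\}$ if $x_n\ne x_{n-1}$, and $\bar\mu_n=\mu$ otherwise; (2) $d_n=-\log_{x_n}(x_{n-1})\in T_{x_n}\mathcal{M}$; (3) $\tilde\mu_n=0$ if $\langle\operatorname{grad} f(x_n),d_n\rangle>0$, and $\tilde\mu_n=\bar\mu_n$ otherwise; (4) $w_n=\exp_{x_n}(\tilde\mu_n d_n)$; (5) $G_n=G_{n-1}+\lVert\operatorname{grad} f(w_n)\rVert^2$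 and $\alpha_n=\eta/(\sqrt{G_n}+\varepsilon)$; (6) $x_{n+1}=\exp_{w_n}(-\alpha_n\operatorname{grad} f(w_n))$. The iteration is run indefinitely, producing infinite sequences. *)

theory Defs
  imports "HOL-Analysis.Analysis"
begin

section \<open>Smoothness in Euclidean space\<close>

text \<open>Class \<open>C\<^sup>k\<close> on an open set: all iterated directional derivatives up to order \<open>k\<close>
  exist and are continuous.\<close>

fun Ck_on :: "nat \<Rightarrow> 'e::euclidean_space set \<Rightarrow> ('e \<Rightarrow> 'b::real_normed_vector) \<Rightarrow> bool" where
  "Ck_on 0 S h \<longleftrightarrow> continuous_on S h"
| "Ck_on (Suc k) S h \<longleftrightarrow>
     (\<forall>p\<in>S. h differentiable (at p)) \<and>
     (\<forall>v. Ck_on k S (\<lambda>p. frechet_derivative h (at p) v))"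

definition smooth_on :: "'e::euclidean_space set \<Rightarrow> ('e \<Rightarrow> 'b::real_normed_vector) \<Rightarrow> bool" where
  "smooth_on S h \<longleftrightarrow> (\<forall>k. Ck_on k S h)"

section \<open>Smooth manifolds and tangent vectors\<close>

text \<open>A manifold is carried by a whole type \<open>'a\<close> with its topology; the model space is \<open>'e\<close>.
  A chart is its domain together with the coordinate map (whose values off the domain are
  irrelevant).  A tangent vector is the family of its coordinate vectors, one for each chart of
  the atlas around the base point, related by the derivatives of the coordinate changes; charts
  not around the base point carry the value \<open>0\<close>, so that equality of tangent vectors at a point
  is equality of functions, and \<open>u - v\<close>, \<open>- v\<close> are the (pointwise) operations on functions.\<close>

type_synonym ('a, 'e) chart = "'a set \<times> ('a \<Rightarrow> 'e)"
type_synonym ('a, 'e) tangent = "('a, 'e) chart \<Rightarrow> 'e"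

record ('a, 'e) riem =
  atlas :: "('a, 'e) chart set"
  riem_metric :: "'a \<Rightarrow> ('a, 'e) tangent \<Rightarrow> ('a, 'e) tangent \<Rightarrow> real"

definition param :: "('a, 'e) chart \<Rightarrow> 'e \<Rightarrow> 'a" where
  "param \<kappa> = inv_into (fst \<kappa>) (snd \<kappa>)"

definition is_chart :: "('a::topological_space, 'e::euclidean_space) chart \<Rightarrow> bool" where
  "is_chart \<kappa> \<longleftrightarrow> open (fst \<kappa>) \<and> open (snd \<kappa> ` fst \<kappa>) \<and>
     homeomorphism (fst \<kappa>) (snd \<kappa> ` fst \<kappa>) (snd \<kappa>) (param \<kappa>)"

definition smooth_atlas :: "('a::topological_space, 'e::euclidean_space) chart set \<Rightarrow> bool" where
  "smooth_atlas A \<longleftrightarrow>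
     (\<forall>\<kappa>\<in>A. is_chart \<kappa>) \<and> (\<Union>\<kappa>\<in>A. fst \<kappa>) = UNIV \<and>
     (\<forall>\<kappa>\<in>A. \<forall>\<kappa>'\<in>A. smooth_on (snd \<kappa> ` (fst \<kappa> \<inter> fst \<kappa>')) (snd \<kappa>' \<circ> param \<kappa>))"

definition charts_at :: "('a, 'e) riem \<Rightarrow> 'a \<Rightarrow> ('a, 'e) chart set" where
  "charts_at M x = {\<kappa> \<in> atlas M. x \<in> fst \<kappa>}"

definition coord_change ::
    "'a \<Rightarrow> ('a, 'e::euclidean_space) chart \<Rightarrow> ('a, 'e) chart \<Rightarrow> 'e \<Rightarrow> 'e" where
  "coord_change x \<kappa> \<kappa>' = frechet_derivative (snd \<kappa>' \<circ> param \<kappa>) (at (snd \<kappa> x))"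

definition tangent_space ::
    "('a, 'e::euclidean_space) riem \<Rightarrow> 'a \<Rightarrow> ('a, 'e) tangent set" where
  "tangent_space M x =
     {v. (\<forall>\<kappa>\<in>charts_at M x. \<forall>\<kappa>'\<in>charts_at M x. v \<kappa>' = coord_change x \<kappa> \<kappa>' (v \<kappa>)) \<and>
         (\<forall>\<kappa>. \<kappa> \<notin> charts_at M x \<longrightarrow> v \<kappa> = 0)}"

definition tscale :: "real \<Rightarrow> ('a, 'e::euclidean_space) tangent \<Rightarrow> ('a, 'e) tangent" where
  "tscale r v = (\<lambda>\<kappa>. r *\<^sub>R v \<kappa>)"

text \<open>The tangent vector at \<open>x\<close> with coordinate vector \<open>u\<close> in the chart \<open>\<kappa>\<close>.\<close>

definition tangent_of ::
    "('a, 'e::euclidean_space) riem \<Rightarrow> ('a, 'e) chart \<Rightarrow> 'a \<Rightarrow> 'e \<Rightarrow> ('a, 'e) tangent" where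
  "tangent_of M \<kappa> x u = (\<lambda>\<kappa>'. if \<kappa>' \<in> charts_at M x then coord_change x \<kappa> \<kappa>' u else 0)"

section \<open>Riemannian metrics\<close>

text \<open>The coordinate expression \<open>g\<^sub>p(u, v)\<close> of the metric in the chart \<open>\<kappa>\<close>.\<close>

definition local_metric ::
    "('a, 'e::euclidean_space) riem \<Rightarrow> ('a, 'e) chart \<Rightarrow> 'e \<Rightarrow> 'e \<Rightarrow> 'e \<Rightarrow> real" where
  "local_metric M \<kappa> p u v =
     riem_metric M (param \<kappa> p) (tangent_of M \<kappa> (param \<kappa> p) u) (tangent_of M \<kappa> (param \<kappa> p) v)"

definition riemannian_manifold ::
    "('a::{t2_space, second_countable_topology}, 'e::euclidean_space) riem \<Rightarrow> bool" where
  "riemannian_manifold M \<longleftrightarrow> smooth_atlas (atlas M) \<and>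
     (\<forall>\<kappa>\<in>atlas M.
        (\<forall>p\<in>snd \<kappa> ` fst \<kappa>.
           bilinear (local_metric M \<kappa> p) \<and>
           (\<forall>u v. local_metric M \<kappa> p u v = local_metric M \<kappa> p v u) \<and>
           (\<forall>u. u \<noteq> 0 \<longrightarrow> local_metric M \<kappa> p u u > 0)) \<and>
        (\<forall>u v. smooth_on (snd \<kappa> ` fst \<kappa>) (\<lambda>p. local_metric M \<kappa> p u v)))"

definition tnorm :: "('a, 'e) riem \<Rightarrow> 'a \<Rightarrow> ('a, 'e) tangent \<Rightarrow> real" where
  "tnorm M x v = sqrt (riem_metric M x v v)"

section \<open>Functions and gradients\<close>

definition C1_function ::
    "('a::topological_space, 'e::euclidean_space) riem \<Rightarrow> ('a \<Rightarrow> real) \<Rightarrow> bool" where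
  "C1_function M f \<longleftrightarrow> (\<forall>\<kappa>\<in>atlas M. Ck_on 1 (snd \<kappa> ` fst \<kappa>) (f \<circ> param \<kappa>))"

definition grad ::
    "('a, 'e::euclidean_space) riem \<Rightarrow> ('a \<Rightarrow> real) \<Rightarrow> 'a \<Rightarrow> ('a, 'e) tangent" where
  "grad M f x = (THE v. v \<in> tangent_space M x \<and>
     (\<forall>u\<in>tangent_space M x. \<forall>\<kappa>\<in>charts_at M x.
        riem_metric M x v u = frechet_derivative (f \<circ> param \<kappa>) (at (snd \<kappa> x)) (u \<kappa>)))"

section \<open>Curves, length and distance\<close>

text \<open>Curves are functions on \<open>\<real>\<close> considered on an interval \<open>I\<close>; derivatives are taken within
  \<open>I\<close>, hence one-sided at its end points.\<close>

definition differentiable_curve ::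
    "('a::topological_space, 'e::euclidean_space) riem \<Rightarrow> real set \<Rightarrow> (real \<Rightarrow> 'a) \<Rightarrow> bool" where
  "differentiable_curve M I c \<longleftrightarrow> continuous_on I c \<and>
     (\<forall>t\<in>I. \<forall>\<kappa>\<in>charts_at M (c t). (snd \<kappa> \<circ> c) differentiable (at t within I))"

definition velocity ::
    "('a, 'e::euclidean_space) riem \<Rightarrow> real set \<Rightarrow> (real \<Rightarrow> 'a) \<Rightarrow> real \<Rightarrow> ('a, 'e) tangent" where
  "velocity M I c t =
     (\<lambda>\<kappa>. if \<kappa> \<in> charts_at M (c t) then vector_derivative (snd \<kappa> \<circ> c) (at t within I) else 0)"

definition C1_curve ::
    "('a::topological_space, 'e::euclidean_space) riem \<Rightarrow> real \<Rightarrow> real \<Rightarrow> (real \<Rightarrow> 'a) \<Rightarrow> bool" where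
  "C1_curve M a b c \<longleftrightarrow> differentiable_curve M {a..b} c \<and>
     (\<forall>\<kappa>\<in>atlas M. continuous_on {t \<in> {a..b}. c t \<in> fst \<kappa>} (\<lambda>t. velocity M {a..b} c t \<kappa>))"

definition piecewise_C1_curve ::
    "('a::topological_space, 'e::euclidean_space) riem \<Rightarrow> real \<Rightarrow> real \<Rightarrow> (real \<Rightarrow> 'a) \<Rightarrow> bool" where
  "piecewise_C1_curve M a b c \<longleftrightarrow>
     (\<exists>m. \<exists>s :: nat \<Rightarrow> real. s 0 = a \<and> s m = b \<and>
        (\<forall>i<m. s i < s (Suc i) \<and> C1_curve M (s i) (s (Suc i)) c))"

text \<open>At the finitely many break points of a piecewise \<open>C\<^sup>1\<close> curve the velocity is meaningless,
  which does not affect the integral.\<close>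

definition curve_length ::
    "('a, 'e::euclidean_space) riem \<Rightarrow> real \<Rightarrow> real \<Rightarrow> (real \<Rightarrow> 'a) \<Rightarrow> real" where
  "curve_length M a b c = integral {a..b} (\<lambda>t. tnorm M (c t) (velocity M {a..b} c t))"

definition rdist ::
    "('a::topological_space, 'e::euclidean_space) riem \<Rightarrow> 'a \<Rightarrow> 'a \<Rightarrow> real" where
  "rdist M x y =
     Inf {curve_length M 0 1 c | c. piecewise_C1_curve M 0 1 c \<and> c 0 = x \<and> c 1 = y}"

section \<open>Levi-Civita connection, parallel transport and geodesics\<close>

text \<open>The vector \<open>\<Gamma>\<^sub>p(u, v)\<close> with components \<open>\<Sum> \<Gamma>\<^sup>k\<^sub>i\<^sub>j u\<^sup>i v\<^sup>j\<close> in the chart \<open>\<kappa>\<close>, obtained from the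
  Koszul formula for vector fields with constant coordinates.\<close>

definition christoffel ::
    "('a, 'e::euclidean_space) riem \<Rightarrow> ('a, 'e) chart \<Rightarrow> 'e \<Rightarrow> 'e \<Rightarrow> 'e \<Rightarrow> 'e" where
  "christoffel M \<kappa> p u v = (THE z. \<forall>w. local_metric M \<kappa> p z w =
     (frechet_derivative (\<lambda>q. local_metric M \<kappa> q v w) (at p) u
      + frechet_derivative (\<lambda>q. local_metric M \<kappa> q u w) (at p) v
      - frechet_derivative (\<lambda>q. local_metric M \<kappa> q u v) (at p) w) / 2)"

text \<open>\<open>V\<close> is a vector field along \<open>c\<close> whose covariant derivative \<open>V' + \<Gamma>(c', V)\<close> vanishes.\<close>

definition parallel_along ::
    "('a, 'e::euclidean_space) riem \<Rightarrow> real set \<Rightarrow> (real \<Rightarrow> 'a) \<Rightarrow> (real \<Rightarrow> ('a, 'e) tangent)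
      \<Rightarrow> bool" where
  "parallel_along M I c V \<longleftrightarrow>
     (\<forall>t\<in>I. V t \<in> tangent_space M (c t) \<and>
        (\<forall>\<kappa>\<in>charts_at M (c t).
           ((\<lambda>s. V s \<kappa>) has_vector_derivative
              - christoffel M \<kappa> (snd \<kappa> (c t)) (velocity M I c t \<kappa>) (V t \<kappa>)) (at t within I)))"

definition parallel_transport ::
    "('a, 'e::euclidean_space) riem \<Rightarrow> (real \<Rightarrow> 'a) \<Rightarrow> real \<Rightarrow> real \<Rightarrow> ('a, 'e) tangent
      \<Rightarrow> ('a, 'e) tangent" where
  "parallel_transport M c a b u =
     (THE w. \<exists>V. parallel_along M {a..b} c V \<and> V a = u \<and> V b = w)"

definition geodesic ::
    "('a::topological_space, 'e::euclidean_space) riem \<Rightarrow> real set \<Rightarrow> (real \<Rightarrow> 'a) \<Rightarrow> bool" where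
  "geodesic M I c \<longleftrightarrow> differentiable_curve M I c \<and> parallel_along M I c (velocity M I c)"

definition minimising_geodesic ::
    "('a::topological_space, 'e::euclidean_space) riem \<Rightarrow> 'a \<Rightarrow> 'a \<Rightarrow> (real \<Rightarrow> 'a) \<Rightarrow> bool" where
  "minimising_geodesic M x y c \<longleftrightarrow>
     geodesic M {0..1} c \<and> c 0 = x \<and> c 1 = y \<and> curve_length M 0 1 c = rdist M x y"

text \<open>Completeness is geodesic completeness: every geodesic extends to \<open>\<real>\<close>, so that the
  exponential map is defined on all of each tangent space.\<close>

definition geodesically_complete ::
    "('a::topological_space, 'e::euclidean_space) riem \<Rightarrow> bool" where
  "geodesically_complete M \<longleftrightarrow>
     (\<forall>x. \<forall>v\<in>tangent_space M x. \<exists>c. geodesic M UNIV c \<and> c 0 = x \<and> velocity M UNIV c 0 = v)"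

definition exp_map ::
    "('a::topological_space, 'e::euclidean_space) riem \<Rightarrow> 'a \<Rightarrow> ('a, 'e) tangent \<Rightarrow> 'a" where
  "exp_map M x v =
     (THE y. \<exists>c. geodesic M UNIV c \<and> c 0 = x \<and> velocity M UNIV c 0 = v \<and> c 1 = y)"

text \<open>Beyond the injectivity radius the logarithm is not unique, so a logarithmic map is any
  selection of initial velocities of minimising geodesics.\<close>

definition log_map ::
    "('a::topological_space, 'e::euclidean_space) riem \<Rightarrow> ('a \<Rightarrow> 'a \<Rightarrow> ('a, 'e) tangent) \<Rightarrow> bool"
  where
  "log_map M lg \<longleftrightarrow> (\<forall>x y. lg x y \<in> tangent_space M x \<and> exp_map M x (lg x y) = y \<and>
     tnorm M x (lg x y) = rdist M x y)"

definition lipschitz_gradient ::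
    "('a::topological_space, 'e::euclidean_space) riem \<Rightarrow> real \<Rightarrow> ('a \<Rightarrow> real) \<Rightarrow> bool" where
  "lipschitz_gradient M L f \<longleftrightarrow> (\<forall>x y c. minimising_geodesic M x y c \<longrightarrow>
     tnorm M y (parallel_transport M c 0 1 (grad M f x) - grad M f y) \<le> L * rdist M x y)"

section \<open>The RIAG-R iteration\<close>

text \<open>Of the sequences, only \<open>x\<close> and \<open>G\<close> are meaningful at index \<open>0\<close>.\<close>

definition riag_r ::
    "('a::topological_space, 'e::euclidean_space) riem \<Rightarrow> ('a \<Rightarrow> 'a \<Rightarrow> ('a, 'e) tangent)
     \<Rightarrow> ('a \<Rightarrow> real) \<Rightarrow> real \<Rightarrow> real \<Rightarrow> real
     \<Rightarrow> (nat \<Rightarrow> 'a) \<Rightarrow> (nat \<Rightarrow> real) \<Rightarrow> (nat \<Rightarrow> ('a, 'e) tangent) \<Rightarrow> (nat \<Rightarrow> real)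
     \<Rightarrow> (nat \<Rightarrow> 'a) \<Rightarrow> (nat \<Rightarrow> real) \<Rightarrow> (nat \<Rightarrow> real) \<Rightarrow> bool" where
  "riag_r M lg f \<eta> \<epsilon> \<mu> x \<mu>b d \<mu>t w G \<alpha> \<longleftrightarrow> G 0 = 0 \<and>
     (\<forall>n\<ge>1.
        \<mu>b n = (if x n \<noteq> x (n - 1) then min \<mu> (\<mu> * rdist M (x n) (x (n - 1))) else \<mu>) \<and>
        d n = - lg (x n) (x (n - 1)) \<and>
        \<mu>t n = (if riem_metric M (x n) (grad M f (x n)) (d n) > 0 then 0 else \<mu>b n) \<and>
        w n = exp_map M (x n) (tscale (\<mu>t n) (d n)) \<and>
        G n = G (n - 1) + (tnorm M (w n) (grad M f (w n)))\<^sup>2 \<and>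
        \<alpha> n = \<eta> / (sqrt (G n) + \<epsilon>) \<and>
        x (n + 1) = exp_map M (w n) (tscale (- \<alpha> n) (grad M f (w n))))"

end

theory Submission imports Defs begin

text \<open>
  Everything rests on the descent inequality
  \<open>f (exp\<^sub>x v) \<le> f x + \<langle>grad f x, v\<rangle> + L/2 \<parallel>v\<parallel>\<^sup>2\<close> for \<^emph>\<open>all\<close> tangent vectors \<open>v\<close> (lemma
  \<open>descent_inequality\<close>).  Along the geodesic \<open>c\<close> with initial velocity \<open>v\<close>, the derivative of
  \<open>f \<circ> c\<close> is \<open>h t = \<langle>grad f (c t), c' t\<rangle>\<close>, so it suffices that \<open>h\<close> is Lipschitz with constant
  \<open>L \<parallel>v\<parallel>\<^sup>2\<close>.  The hypothesis on the gradient speaks of minimising geodesics only, and \<open>c\<close> need not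
  minimise; but a real function on an interval is Lipschitz as soon as it is so near each point, and
  short pieces of \<open>c\<close> do minimise.

  The usual proof of the latter fact uses the Gauss lemma.  Here it follows from the logarithm:
  any two points are joined by a minimising geodesic, and a short geodesic is determined by
  its end points.  In a chart the difference \<open>\<delta>\<close> of two slow geodesics solves
  \<open>\<delta>'' = O(m) \<cdot> sup \<parallel>\<delta>'\<parallel>\<close>, where \<open>m\<close> bounds the speeds; if \<open>\<delta>\<close> vanishes at both ends, or \<open>\<delta>\<close> and \<open>\<delta>'\<close>
  vanish at one, this forces \<open>sup \<parallel>\<delta>'\<parallel> = 0\<close> for small \<open>m\<close> (\<open>short_geodesics_unique\<close>).  The second
  boundary condition yields the uniqueness of geodesics with given initial velocity, hence that the
  exponential map is evaluated along geodesics (\<open>exp_map_geodesic\<close>).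

  To apply the Lipschitz hypothesis, the parallel transport along a short geodesic has to exist.  In
  one chart it is a linear differential equation; that its solution is parallel in every other chart
  as well is the transformation law of the Christoffel symbols (\<open>christoffel_change\<close>).  Its
  quadratic version merely says that geodesics satisfy the geodesic equation in both charts, and
  since completeness provides a geodesic in each direction, polarization gives the full law.

  With \<open>g\<^sub>n = \<parallel>grad f (w\<^sub>n)\<parallel>\<close> and \<open>\<delta>\<^sub>n = d(x\<^sub>n, x\<^sub>n\<^sub>-\<^sub>1)\<close>, two uses of the descent inequality in each step
  give the finite sum estimate; the term \<open>\<langle>grad f (x\<^sub>n), d\<^sub>n\<rangle>\<close> drops out because \<open>\<mu>t n = 0\<close> when it is
  positive.  Travelling from \<open>x\<^sub>n\<close> to \<open>x\<^sub>n\<^sub>+\<^sub>1\<close> through \<open>w\<^sub>n\<close> gives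
  \<open>\<delta>\<^sub>n\<^sub>+\<^sub>1 \<le> \<mu> \<delta>\<^sub>n + \<alpha>\<^sub>n g\<^sub>n\<close>, which bounds \<open>\<Sum> \<delta>\<^sub>n\<^sup>2\<close> by a multiple of \<open>\<Sum> \<alpha>\<^sub>n\<^sup>2 g\<^sub>n\<^sup>2\<close>.  The
  constant \<open>L'\<close> is chosen so that, for \<open>\<alpha>\<^sub>n \<le> \<eta>/\<epsilon> \<le> 1/(2L')\<close>, substituting this into the first estimate
  leaves half of \<open>\<Sum> \<alpha>\<^sub>n g\<^sub>n\<^sup>2\<close> on the left (\<open>perturbed_descent_summable\<close>).
\<close>

section \<open>Calculus in Euclidean space\<close>

lemma smooth_on_imp_differentiable:
  assumes "smooth_on S h" "p \<in> S"
  shows "h differentiable (at p)"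
  using assms unfolding smooth_on_def by (metis Ck_on.simps(2))

lemma smooth_on_derivative:
  assumes "smooth_on S h"
  shows "smooth_on S (\<lambda>p. frechet_derivative h (at p) v)"
  using assms unfolding smooth_on_def by (metis Ck_on.simps(2))

lemma smooth_on_imp_continuous_on:
  assumes "smooth_on S h"
  shows "continuous_on S h"
  using assms unfolding smooth_on_def by (metis Ck_on.simps(1))

lemma linear_eq_sum_Basis:
  fixes A :: "'e::euclidean_space \<Rightarrow> 'b::real_vector"
  assumes "linear A"
  shows "A v = (\<Sum>b\<in>Basis. (v \<bullet> b) *\<^sub>R A b)"
proof -
  have "A v = A (\<Sum>b\<in>Basis. (v \<bullet> b) *\<^sub>R b)" by (simp add: euclidean_representation)
  also have "\<dots> = (\<Sum>b\<in>Basis. (v \<bullet> b) *\<^sub>R A b)"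
    using assms by (simp add: linear_sum linear_scale)
  finally show ?thesis .
qed

lemma directional_derivative:
  fixes h :: "'e::euclidean_space \<Rightarrow> 'b::real_normed_vector"
  assumes "h differentiable (at (a + t *\<^sub>R u))"
  shows "((\<lambda>t. h (a + t *\<^sub>R u)) has_vector_derivative
           frechet_derivative h (at (a + t *\<^sub>R u)) u) (at t)"
proof -
  have "((\<lambda>t. a + t *\<^sub>R u) has_vector_derivative u) (at t)"
    by (auto intro!: derivative_eq_intros)
  moreover have "(h has_derivative frechet_derivative h (at (a + t *\<^sub>R u))) (at (a + t *\<^sub>R u))"
    using assms by (simp add: frechet_derivative_works)
  ultimately show ?thesis
    using vector_derivative_diff_chain_within[of "\<lambda>t. a + t *\<^sub>R u" u t UNIV h] 
    by (auto simp: o_def intro: has_derivative_at_withinI)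
qed

text \<open>Two applications of the mean value theorem, first in the direction \<open>u\<close> and then in the
  direction \<open>v\<close>.  The left-hand side is symmetric in \<open>u\<close> and \<open>v\<close>, which is the source of the symmetry
  of second derivatives.\<close>

lemma second_difference_mean_value:
  fixes h :: "'e::euclidean_space \<Rightarrow> real"
  assumes "t > 0"
    and h1: "\<And>\<alpha> \<beta>. \<lbrakk>0 \<le> \<alpha>; \<alpha> \<le> t; 0 \<le> \<beta>; \<beta> \<le> t\<rbrakk> \<Longrightarrow>
      h differentiable (at (p + \<alpha> *\<^sub>R u + \<beta> *\<^sub>R v))"
    and h2: "\<And>\<alpha> \<beta>. \<lbrakk>0 \<le> \<alpha>; \<alpha> \<le> t; 0 \<le> \<beta>; \<beta> \<le> t\<rbrakk> \<Longrightarrow>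
      (\<lambda>q. frechet_derivative h (at q) u) differentiable (at (p + \<alpha> *\<^sub>R u + \<beta> *\<^sub>R v))"
  shows "\<exists>\<alpha> \<beta>. 0 \<le> \<alpha> \<and> \<alpha> \<le> t \<and> 0 \<le> \<beta> \<and> \<beta> \<le> t \<and>
      h (p + t *\<^sub>R u + t *\<^sub>R v) - h (p + t *\<^sub>R u) - h (p + t *\<^sub>R v) + h p =
      t * t * frechet_derivative (\<lambda>q. frechet_derivative h (at q) u) (at (p + \<alpha> *\<^sub>R u + \<beta> *\<^sub>R v)) v"
proof -
  define D where "D = (\<lambda>q. frechet_derivative h (at q) u)"
  define a where "a = (\<lambda>\<alpha>. h (p + t *\<^sub>R v + \<alpha> *\<^sub>R u) - h (p + \<alpha> *\<^sub>R u))"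
  have a': "(a has_real_derivative D (p + t *\<^sub>R v + \<alpha> *\<^sub>R u) - D (p + \<alpha> *\<^sub>R u)) (at \<alpha>)"
    if "0 \<le> \<alpha>" "\<alpha> \<le> t" for \<alpha>
    unfolding a_def D_def has_real_derivative_iff_has_vector_derivative
    using that h1[of \<alpha> t] h1[of \<alpha> 0] \<open>t > 0\<close>
    by (intro has_vector_derivative_diff directional_derivative) (simp_all add: algebra_simps)
  obtain \<alpha> where \<alpha>: "0 < \<alpha>" "\<alpha> < t"
    and aeq: "a t - a 0 = t * (D (p + t *\<^sub>R v + \<alpha> *\<^sub>R u) - D (p + \<alpha> *\<^sub>R u))"
    using MVT2[of 0 t a, OF \<open>t > 0\<close>, OF a'] by auto
  define b where "b = (\<lambda>\<beta>. D (p + \<alpha> *\<^sub>R u + \<beta> *\<^sub>R v))"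
  have b': "(b has_real_derivative frechet_derivative D (at (p + \<alpha> *\<^sub>R u + \<beta> *\<^sub>R v)) v) (at \<beta>)"
    if "0 \<le> \<beta>" "\<beta> \<le> t" for \<beta>
    unfolding b_def has_real_derivative_iff_has_vector_derivative
    using that \<alpha> h2[of \<alpha> \<beta>] by (intro directional_derivative) (simp add: D_def)
  obtain \<beta> where \<beta>: "0 < \<beta>" "\<beta> < t"
    and beq: "b t - b 0 = t * frechet_derivative D (at (p + \<alpha> *\<^sub>R u + \<beta> *\<^sub>R v)) v"
    using MVT2[of 0 t b, OF \<open>t > 0\<close>, OF b'] by auto
  have "a t - a 0 = t * (b t - b 0)"
    using aeq by (simp add: b_def add_ac)
  then have "h (p + t *\<^sub>R u + t *\<^sub>R v) - h (p + t *\<^sub>R u) - h (p + t *\<^sub>R v) + h p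
     = t * t * frechet_derivative D (at (p + \<alpha> *\<^sub>R u + \<beta> *\<^sub>R v)) v"
    using beq by (simp add: a_def add_ac)
  then show ?thesis using \<alpha> \<beta> unfolding D_def by (intro exI[of _ \<alpha>] exI[of _ \<beta>]) auto
qed

text \<open>Both orders of differentiation are values, at points close to \<open>p\<close>, whose limit for \<open>t \<rightarrow> 0\<close>
  is the same second difference divided by \<open>t\<^sup>2\<close>.\<close>

lemma second_derivative_symmetric_real:
  fixes h :: "'e::euclidean_space \<Rightarrow> real"
  assumes sm: "smooth_on S h" and S: "open S" "p \<in> S"
  shows "frechet_derivative (\<lambda>q. frechet_derivative h (at q) u) (at p) v =
         frechet_derivative (\<lambda>q. frechet_derivative h (at q) v) (at p) u"
proof -
  define F where "F = (\<lambda>u v q. frechet_derivative (\<lambda>q. frechet_derivative h (at q) u) (at q) v)"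
  have cont: "isCont (F u v) p" for u v
    using smooth_on_imp_continuous_on[OF smooth_on_derivative[OF smooth_on_derivative[OF sm]]] S
    unfolding F_def by (simp add: continuous_on_eq_continuous_at)
  have "dist (F u v p) (F v u p) < 2 * e" if "e > 0" for e
  proof -
    obtain d1 where d1: "d1 > 0" "\<And>q. dist q p < d1 \<Longrightarrow> dist (F u v q) (F u v p) < e"
      using cont[of u v] \<open>e > 0\<close> unfolding continuous_at_eps_delta by (auto simp: dist_real_def)
    obtain d2 where d2: "d2 > 0" "\<And>q. dist q p < d2 \<Longrightarrow> dist (F v u q) (F v u p) < e"
      using cont[of v u] \<open>e > 0\<close> unfolding continuous_at_eps_delta by (auto simp: dist_real_def)
    obtain d3 where d3: "d3 > 0" "ball p d3 \<subseteq> S" using S open_contains_ball by blast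
    define d where "d = min d1 (min d2 d3)"
    define t where "t = d / (norm u + norm v + 1)"
    have "d > 0" using d1 d2 d3 by (simp add: d_def)
    have t0: "t > 0" unfolding t_def using \<open>d > 0\<close>
      by (smt (verit) divide_pos_pos norm_ge_zero)
    have close: "dist (p + \<alpha> *\<^sub>R u + \<beta> *\<^sub>R v) p < d" "dist (p + \<beta> *\<^sub>R v + \<alpha> *\<^sub>R u) p < d"
      if "0 \<le> \<alpha>" "\<alpha> \<le> t" "0 \<le> \<beta>" "\<beta> \<le> t" for \<alpha> \<beta>
    proof -
      have "norm (\<alpha> *\<^sub>R u + \<beta> *\<^sub>R v) \<le> t * norm u + t * norm v"
        using that by (intro order_trans[OF norm_triangle_ineq] add_mono)
          (auto intro: mult_right_mono)
      also have "\<dots> < t * (norm u + norm v + 1)" using t0 by (simp add: algebra_simps)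
      also have "\<dots> = d" unfolding t_def
        by (smt (verit) nonzero_eq_divide_eq norm_ge_zero)
      finally show "dist (p + \<alpha> *\<^sub>R u + \<beta> *\<^sub>R v) p < d" "dist (p + \<beta> *\<^sub>R v + \<alpha> *\<^sub>R u) p < d"
        by (simp_all add: dist_norm add_ac)
    qed
    have inS: "q \<in> S" if "dist q p < d" for q
      using that d3 by (auto simp: d_def dist_commute)
    obtain a1 b1 where ab1: "0 \<le> a1" "a1 \<le> t" "0 \<le> b1" "b1 \<le> t"
      and eq1: "h (p + t *\<^sub>R u + t *\<^sub>R v) - h (p + t *\<^sub>R u) - h (p + t *\<^sub>R v) + h p =
        t * t * F u v (p + a1 *\<^sub>R u + b1 *\<^sub>R v)"
      using second_difference_mean_value[OF t0, of h p u v] close inS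
        smooth_on_imp_differentiable[OF sm] smooth_on_imp_differentiable[OF smooth_on_derivative[OF sm]]
      unfolding F_def by blast
    obtain a2 b2 where ab2: "0 \<le> a2" "a2 \<le> t" "0 \<le> b2" "b2 \<le> t"
      and eq2: "h (p + t *\<^sub>R v + t *\<^sub>R u) - h (p + t *\<^sub>R v) - h (p + t *\<^sub>R u) + h p =
        t * t * F v u (p + a2 *\<^sub>R v + b2 *\<^sub>R u)"
      using second_difference_mean_value[OF t0, of h p v u] close inS
        smooth_on_imp_differentiable[OF sm] smooth_on_imp_differentiable[OF smooth_on_derivative[OF sm]]
      unfolding F_def by blast
    have "h (p + t *\<^sub>R v + t *\<^sub>R u) - h (p + t *\<^sub>R v) - h (p + t *\<^sub>R u) + h p =
      h (p + t *\<^sub>R u + t *\<^sub>R v) - h (p + t *\<^sub>R u) - h (p + t *\<^sub>R v) + h p" by (simp add: add_ac)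
    then have "t * t * F u v (p + a1 *\<^sub>R u + b1 *\<^sub>R v) = t * t * F v u (p + a2 *\<^sub>R v + b2 *\<^sub>R u)"
      by (rule trans[OF trans[OF eq1[symmetric] sym] eq2])
    then have "F u v (p + a1 *\<^sub>R u + b1 *\<^sub>R v) = F v u (p + a2 *\<^sub>R v + b2 *\<^sub>R u)"
      using t0 by simp
    moreover have "dist (F u v (p + a1 *\<^sub>R u + b1 *\<^sub>R v)) (F u v p) < e"
      using close(1)[OF ab1] by (intro d1) (simp add: d_def)
    moreover have "dist (F v u (p + a2 *\<^sub>R v + b2 *\<^sub>R u)) (F v u p) < e"
      using close(2)[OF ab2(3,4,1,2)] by (intro d2) (simp add: d_def)
    ultimately show ?thesis unfolding dist_real_def by linarith
  qed
  from this[of "dist (F u v p) (F v u p) / 2"] have "F u v p = F v u p"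
    by (metis field_sum_of_halves half_gt_zero less_irrefl mult_2 zero_less_dist_iff)
  then show ?thesis by (simp add: F_def)
qed

lemma frechet_derivative_inner_right:
  fixes h :: "'e::euclidean_space \<Rightarrow> 'b::euclidean_space"
  assumes "h differentiable (at p)"
  shows "(\<lambda>q. h q \<bullet> b) differentiable (at p)"
    "frechet_derivative (\<lambda>q. h q \<bullet> b) (at p) u = frechet_derivative h (at p) u \<bullet> b"
proof -
  have "((\<lambda>q. h q \<bullet> b) has_derivative (\<lambda>u. frechet_derivative h (at p) u \<bullet> b)) (at p)"
    using assms by (intro has_derivative_inner_left) (simp add: frechet_derivative_works)
  then show "(\<lambda>q. h q \<bullet> b) differentiable (at p)"
    "frechet_derivative (\<lambda>q. h q \<bullet> b) (at p) u = frechet_derivative h (at p) u \<bullet> b"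
    by (auto simp: differentiable_def dest: frechet_derivative_at[symmetric])
qed

lemma frechet_derivative_cong_open:
  assumes "open S" "p \<in> S" "\<And>q. q \<in> S \<Longrightarrow> h q = k q"
  shows "frechet_derivative h (at p) = frechet_derivative k (at p)"
    and "h differentiable (at p) \<longleftrightarrow> k differentiable (at p)"
proof -
  have *: "(h has_derivative D) (at p) \<longleftrightarrow> (k has_derivative D) (at p)" for D
    using assms has_derivative_transform_within_open[of h D p UNIV S k]
      has_derivative_transform_within_open[of k D p UNIV S h] by auto
  show "frechet_derivative h (at p) = frechet_derivative k (at p)"
    unfolding frechet_derivative_def * ..
  show "h differentiable (at p) \<longleftrightarrow> k differentiable (at p)"
    unfolding differentiable_def * ..
qed

lemma Ck_on_cong:
  assumes S: "open S" and "Ck_on k S g" "\<And>q. q \<in> S \<Longrightarrow> g q = f q"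
  shows "Ck_on k S f"
  using assms(2,3)
proof (induction k arbitrary: f g)
  case 0
  then show ?case by (simp cong: continuous_on_cong)
next
  case (Suc k)
  have eq: "frechet_derivative g (at q) = frechet_derivative f (at q)"
    "f differentiable (at q)" if "q \<in> S" for q
    using frechet_derivative_cong_open[OF S that, of g f] Suc.prems that by auto
  have "Ck_on k S (\<lambda>q. frechet_derivative f (at q) v)" for v
    by (rule Suc.IH[of "\<lambda>q. frechet_derivative g (at q) v"]) (use Suc.prems(1) eq(1) in auto)
  then show ?case using eq(2) by auto
qed

lemma smooth_on_inner_right:
  fixes h :: "'e::euclidean_space \<Rightarrow> 'b::euclidean_space"
  assumes "open S" "smooth_on S h"
  shows "smooth_on S (\<lambda>q. h q \<bullet> b)"
proof -
  have "Ck_on k S (\<lambda>q. h q \<bullet> b)" if "Ck_on k S h" for k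
    using that
  proof (induction k arbitrary: h)
    case 0
    then show ?case by (auto intro: continuous_intros)
  next
    case (Suc k)
    have "Ck_on k S (\<lambda>q. frechet_derivative h (at q) v \<bullet> b)" for v
      using Suc by auto
    then have "Ck_on k S (\<lambda>q. frechet_derivative (\<lambda>q. h q \<bullet> b) (at q) v)" for v
      by (rule Ck_on_cong[OF \<open>open S\<close>]) (use Suc.prems in \<open>simp add: frechet_derivative_inner_right\<close>)
    then show ?case using Suc.prems by (auto intro: frechet_derivative_inner_right)
  qed
  then show ?thesis using assms by (auto simp: smooth_on_def)
qed

lemma second_derivative_symmetric:
  fixes h :: "'e::euclidean_space \<Rightarrow> 'b::euclidean_space"
  assumes sm: "smooth_on S h" and S: "open S" "p \<in> S"
  shows "frechet_derivative (\<lambda>q. frechet_derivative h (at q) u) (at p) v =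
         frechet_derivative (\<lambda>q. frechet_derivative h (at q) v) (at p) u"
proof (rule euclidean_eqI)
  fix b :: 'b
  have *: "frechet_derivative (\<lambda>q. frechet_derivative (\<lambda>q. h q \<bullet> b) (at q) u) (at p) v
        = frechet_derivative (\<lambda>q. frechet_derivative h (at q) u) (at p) v \<bullet> b" for u v
  proof -
    have "frechet_derivative (\<lambda>q. frechet_derivative (\<lambda>q. h q \<bullet> b) (at q) u) (at p)
       = frechet_derivative (\<lambda>q. frechet_derivative h (at q) u \<bullet> b) (at p)"
      by (rule frechet_derivative_cong_open[OF S])
        (simp add: frechet_derivative_inner_right smooth_on_imp_differentiable[OF sm])
    then show ?thesis
      using frechet_derivative_inner_right(2)
        [OF smooth_on_imp_differentiable[OF smooth_on_derivative[OF sm] S(2)]] by simp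
  qed
  show "frechet_derivative (\<lambda>q. frechet_derivative h (at q) u) (at p) v \<bullet> b =
        frechet_derivative (\<lambda>q. frechet_derivative h (at q) v) (at p) u \<bullet> b"
    using second_derivative_symmetric_real[OF smooth_on_inner_right[OF S(1) sm] S] *
    by metis
qed

section \<open>Families of linear maps\<close>

text \<open>The metric in a chart and the derivative of a coordinate change are families of multilinear
  maps for which only the evaluations at fixed vectors are known to be differentiable.  The
  lemmas of this section deduce the product rule and uniform bounds from that.\<close>

lemma linear_family_derivative:
  fixes A :: "'e::euclidean_space \<Rightarrow> 'c::euclidean_space \<Rightarrow> 'b::real_normed_vector"
  assumes S: "open S" "p \<in> S" and lin: "\<And>q. q \<in> S \<Longrightarrow> linear (A q)"
    and diff: "\<And>v. (\<lambda>q. A q v) differentiable (at p)"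
  shows "linear (\<lambda>v. frechet_derivative (\<lambda>q. A q v) (at p) u)"
proof (rule linearI)
  have der: "((\<lambda>q. A q v) has_derivative frechet_derivative (\<lambda>q. A q v) (at p)) (at p)" for v
    using diff by (simp add: frechet_derivative_works)
  fix v w :: 'c and r :: real
  have "frechet_derivative (\<lambda>q. A q (v + w)) (at p) = frechet_derivative (\<lambda>q. A q v + A q w) (at p)"
    by (rule frechet_derivative_cong_open[OF S]) (simp add: lin linear_add)
  also have "\<dots> = (\<lambda>u. frechet_derivative (\<lambda>q. A q v) (at p) u + frechet_derivative (\<lambda>q. A q w) (at p) u)"
    by (intro frechet_derivative_at[symmetric] has_derivative_add der)
  finally show "frechet_derivative (\<lambda>q. A q (v + w)) (at p) u =
    frechet_derivative (\<lambda>q. A q v) (at p) u + frechet_derivative (\<lambda>q. A q w) (at p) u" by simp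
  have "frechet_derivative (\<lambda>q. A q (r *\<^sub>R v)) (at p) = frechet_derivative (\<lambda>q. r *\<^sub>R A q v) (at p)"
    by (rule frechet_derivative_cong_open[OF S]) (simp add: lin linear_scale)
  also have "\<dots> = (\<lambda>u. r *\<^sub>R frechet_derivative (\<lambda>q. A q v) (at p) u)"
    by (intro frechet_derivative_at[symmetric] has_derivative_scaleR_right der)
  finally show "frechet_derivative (\<lambda>q. A q (r *\<^sub>R v)) (at p) u =
    r *\<^sub>R frechet_derivative (\<lambda>q. A q v) (at p) u" by simp
qed

text \<open>The product rule at a zero of the scalar factor.\<close>

lemma vanishing_factor_derivative:
  assumes V: "(V has_vector_derivative V') (at t within I)"
    and h: "(h has_vector_derivative h') (at t within I)"
  shows "((\<lambda>s. ((V s - V t) \<bullet> b) *\<^sub>R h s) has_vector_derivative (V' \<bullet> b) *\<^sub>R h t) (at t within I)"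
proof -
  have "((\<lambda>s. V s - V t) has_vector_derivative V' - 0) (at t within I)"
    by (intro has_vector_derivative_diff V has_vector_derivative_const)
  then have "((\<lambda>s. (V s - V t) \<bullet> b) has_vector_derivative (V' - 0) \<bullet> b) (at t within I)"
    by (rule bounded_linear.has_vector_derivative[OF bounded_linear_inner_left])
  then have "((\<lambda>s. (V s - V t) \<bullet> b) has_real_derivative V' \<bullet> b) (at t within I)"
    by (simp add: has_real_derivative_iff_has_vector_derivative)
  from has_vector_derivative_scaleR[OF this h] show ?thesis by simp
qed

lemma linear_family_chain:
  fixes A :: "'e::euclidean_space \<Rightarrow> 'c::euclidean_space \<Rightarrow> 'b::real_normed_vector"
  assumes S: "open S" "p t \<in> S" and t: "t \<in> I" and lin: "\<And>q. q \<in> S \<Longrightarrow> linear (A q)"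
    and diff: "\<And>v. (\<lambda>q. A q v) differentiable (at (p t))"
    and p: "(p has_vector_derivative p') (at t within I)"
    and V: "(V has_vector_derivative V') (at t within I)"
  shows "((\<lambda>s. A (p s) (V s)) has_vector_derivative
    frechet_derivative (\<lambda>q. A q (V t)) (at (p t)) p' + A (p t) V') (at t within I)"
proof -
  have der: "((\<lambda>s. A (p s) v) has_vector_derivative frechet_derivative (\<lambda>q. A q v) (at (p t)) p')
      (at t within I)" for v
    using vector_derivative_diff_chain_within[OF p, of "\<lambda>q. A q v"] diff[of v]
    by (auto simp: o_def frechet_derivative_works intro: has_derivative_at_withinI)
  have contp: "continuous (at t within I) p"
    using p by (rule has_vector_derivative_continuous)
  have ev: "\<forall>\<^sub>F s in at t within I. p s \<in> S"
    using contp S by (simp add: continuous_within topological_tendstoD)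
  \<comment> \<open>Split \<open>A (p s) (V s)\<close> into \<open>A (p s) (V t)\<close>, with a fixed vector, and a sum whose scalar factors vanish at \<open>t\<close>.\<close>
  have "((\<lambda>s. A (p s) (V t) + (\<Sum>b\<in>Basis. ((V s - V t) \<bullet> b) *\<^sub>R A (p s) b))
      has_vector_derivative frechet_derivative (\<lambda>q. A q (V t)) (at (p t)) p' +
        (\<Sum>b\<in>Basis. (V' \<bullet> b) *\<^sub>R A (p t) b)) (at t within I)"
  proof (intro has_vector_derivative_add der has_vector_derivative_sum)
    fix b :: 'c
    show "((\<lambda>s. ((V s - V t) \<bullet> b) *\<^sub>R A (p s) b) has_vector_derivative (V' \<bullet> b) *\<^sub>R A (p t) b)
      (at t within I)"
      by (rule vanishing_factor_derivative[OF V der])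
  qed
  moreover have "\<forall>\<^sub>F s in at t within I. A (p s) (V t) + (\<Sum>b\<in>Basis. ((V s - V t) \<bullet> b) *\<^sub>R A (p s) b)
      = A (p s) (V s)"
    using ev
  proof eventually_elim
    case (elim s)
    then show ?case
      using linear_eq_sum_Basis[OF lin[OF elim], of "V s - V t"] lin[OF elim]
      by (simp add: linear_diff diff_eq_eq add.commute)
  qed
  ultimately show ?thesis
    using has_derivative_transform_eventually linear_eq_sum_Basis[OF lin[OF S(2)], of V'] t
    unfolding has_vector_derivative_def by (simp add: has_derivative_transform_eventually)
qed

lemma bilinear_family_chain:
  fixes g :: "'e::euclidean_space \<Rightarrow> 'c::euclidean_space \<Rightarrow> 'c \<Rightarrow> 'b::real_normed_vector"
  assumes S: "open S" "p t \<in> S" and t: "t \<in> I" and lin: "\<And>q. q \<in> S \<Longrightarrow> bilinear (g q)"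
    and diff: "\<And>v w. (\<lambda>q. g q v w) differentiable (at (p t))"
    and p: "(p has_vector_derivative p') (at t within I)"
    and V: "(V has_vector_derivative V') (at t within I)"
    and W: "(W has_vector_derivative W') (at t within I)"
  shows "((\<lambda>s. g (p s) (V s) (W s)) has_vector_derivative
    frechet_derivative (\<lambda>q. g q (V t) (W t)) (at (p t)) p' + g (p t) V' (W t) + g (p t) (V t) W')
    (at t within I)"
proof -
  have lin1: "linear (\<lambda>v. g q v w)" and lin2: "linear (g q v)" if "q \<in> S" for q v w
    using lin[OF that] by (auto simp: bilinear_def)
  have der: "((\<lambda>s. g (p s) v (W s)) has_vector_derivative
     frechet_derivative (\<lambda>q. g q v (W t)) (at (p t)) p' + g (p t) v W') (at t within I)" for v
    by (rule linear_family_chain[OF S t lin2 diff p W])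
  have contp: "continuous (at t within I) p"
    using p by (rule has_vector_derivative_continuous)
  have ev: "\<forall>\<^sub>F s in at t within I. p s \<in> S"
    using contp S by (simp add: continuous_within topological_tendstoD)
  have "((\<lambda>s. g (p s) (V t) (W s) + (\<Sum>b\<in>Basis. ((V s - V t) \<bullet> b) *\<^sub>R g (p s) b (W s)))
      has_vector_derivative frechet_derivative (\<lambda>q. g q (V t) (W t)) (at (p t)) p' + g (p t) (V t) W' +
        (\<Sum>b\<in>Basis. (V' \<bullet> b) *\<^sub>R g (p t) b (W t))) (at t within I)"
  proof (intro has_vector_derivative_add der has_vector_derivative_sum)
    fix b :: 'c
    show "((\<lambda>s. ((V s - V t) \<bullet> b) *\<^sub>R g (p s) b (W s)) has_vector_derivative (V' \<bullet> b) *\<^sub>R g (p t) b (W t))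
      (at t within I)"
      by (rule vanishing_factor_derivative[OF V der])
  qed
  moreover have "\<forall>\<^sub>F s in at t within I.
      g (p s) (V t) (W s) + (\<Sum>b\<in>Basis. ((V s - V t) \<bullet> b) *\<^sub>R g (p s) b (W s)) = g (p s) (V s) (W s)"
    using ev
  proof eventually_elim
    case (elim s)
    then show ?case
      using linear_eq_sum_Basis[OF lin1[OF elim], of "V s - V t" "W s"] lin1[OF elim, of "W s"]
      by (simp add: linear_diff[of "\<lambda>v. g (p s) v (W s)"] diff_eq_eq add.commute)
  qed
  ultimately show ?thesis
    using linear_eq_sum_Basis[OF lin1[OF S(2)], of V' "W t"] t
    unfolding has_vector_derivative_def by (simp add: has_derivative_transform_eventually add_ac)
qed

lemma C1_lipschitz_on_cball:
  fixes h :: "'e::euclidean_space \<Rightarrow> 'b::real_normed_vector"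
  assumes h: "Ck_on 1 S h" and B: "cball p r \<subseteq> S"
  shows "\<exists>C\<ge>0. \<forall>q1\<in>cball p r. \<forall>q2\<in>cball p r. norm (h q1 - h q2) \<le> C * norm (q1 - q2)"
proof -
  have diff: "(h has_derivative frechet_derivative h (at q)) (at q)" if "q \<in> cball p r" for q
    using that h B by (auto simp: frechet_derivative_works)
  have "\<exists>C\<ge>0. \<forall>q\<in>cball p r. norm (frechet_derivative h (at q) b) \<le> C" for b
  proof -
    have "continuous_on (cball p r) (\<lambda>q. frechet_derivative h (at q) b)"
      using h B by (auto intro: continuous_on_subset)
    then have "bounded ((\<lambda>q. frechet_derivative h (at q) b) ` cball p r)"
      by (intro compact_imp_bounded compact_continuous_image) auto
    then show ?thesis unfolding bounded_pos by (meson imageI less_imp_le)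
  qed
  then obtain C where C: "\<And>b. C b \<ge> 0" "\<And>b q. q \<in> cball p r \<Longrightarrow> norm (frechet_derivative h (at q) b) \<le> C b"
    by metis
  define K where "K = (\<Sum>b\<in>Basis. C b)"
  have "onorm (frechet_derivative h (at q)) \<le> K" if q: "q \<in> cball p r" for q
  proof (rule onorm_le)
    fix v
    have "linear (frechet_derivative h (at q))" using diff[OF q] has_derivative_linear by blast
    then have "norm (frechet_derivative h (at q) v) = norm (\<Sum>b\<in>Basis. (v \<bullet> b) *\<^sub>R frechet_derivative h (at q) b)"
      using linear_eq_sum_Basis by metis
    also have "\<dots> \<le> (\<Sum>b\<in>Basis. \<bar>v \<bullet> b\<bar> * norm (frechet_derivative h (at q) b))"
      by (rule order_trans[OF norm_sum]) simp
    also have "\<dots> \<le> (\<Sum>b\<in>Basis. norm v * C b)"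
      by (intro sum_mono mult_mono C(2) q) (simp_all add: Basis_le_norm)
    also have "\<dots> = K * norm v" by (simp add: K_def sum_distrib_left mult.commute)
    finally show "norm (frechet_derivative h (at q) v) \<le> K * norm v" .
  qed
  note on = this
  have "norm (h q1 - h q2) \<le> K * norm (q1 - q2)" if "q1 \<in> cball p r" "q2 \<in> cball p r" for q1 q2
    by (rule differentiable_bound[OF convex_cball has_derivative_at_withinI[OF diff] on that])
  moreover have "K \<ge> 0" unfolding K_def by (intro sum_nonneg C)
  ultimately show ?thesis by blast
qed

text \<open>The index set is arbitrary so that it can hold the remaining arguments of a multilinear
  map, or pairs of points together with the weight \<open>m\<close> being their distance: the same lemma then
  serves for boundedness and for Lipschitz continuity.\<close>

lemma linear_uniform_bound:
  fixes A :: "'i \<Rightarrow> 'e::euclidean_space \<Rightarrow> real"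
  assumes lin: "\<And>i. i \<in> I \<Longrightarrow> linear (A i)" and m: "\<And>i. i \<in> I \<Longrightarrow> m i \<ge> 0"
    and bd: "\<And>b. b \<in> Basis \<Longrightarrow> \<exists>C. \<forall>i\<in>I. \<bar>A i b\<bar> \<le> C * m i"
  shows "\<exists>C\<ge>0. \<forall>i\<in>I. \<forall>v. \<bar>A i v\<bar> \<le> C * (m i * norm v)"
proof -
  obtain C where C: "\<And>b i. b \<in> Basis \<Longrightarrow> i \<in> I \<Longrightarrow> \<bar>A i b\<bar> \<le> C b * m i" using bd by metis
  define K where "K = (\<Sum>b\<in>Basis. \<bar>C b\<bar>)"
  have "\<bar>A i v\<bar> \<le> K * (m i * norm v)" if i: "i \<in> I" for i v
  proof -
    have "\<bar>A i v\<bar> = \<bar>\<Sum>b\<in>Basis. (v \<bullet> b) * A i b\<bar>"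
      using linear_eq_sum_Basis[OF lin[OF i], of v] by simp
    also have "\<dots> \<le> (\<Sum>b\<in>Basis. \<bar>v \<bullet> b\<bar> * \<bar>A i b\<bar>)"
      by (rule order_trans[OF sum_abs]) (simp add: abs_mult)
    also have "\<dots> \<le> (\<Sum>b\<in>Basis. norm v * (\<bar>C b\<bar> * m i))"
    proof (intro sum_mono mult_mono)
      fix b :: 'e assume b: "b \<in> Basis"
      show "\<bar>A i b\<bar> \<le> \<bar>C b\<bar> * m i"
        using C[OF b i] mult_right_mono[OF abs_ge_self[of "C b"] m[OF i]] by linarith
    qed (auto simp: Basis_le_norm)
    also have "\<dots> = K * (m i * norm v)"
      by (simp add: K_def sum_distrib_left sum_distrib_right mult_ac)
    finally show ?thesis .
  qed
  moreover have "K \<ge> 0" by (simp add: K_def sum_nonneg)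
  ultimately show ?thesis by blast
qed

lemma bilinear_uniform_bound:
  fixes T :: "'i \<Rightarrow> 'e::euclidean_space \<Rightarrow> 'e \<Rightarrow> real"
  assumes lin: "\<And>i v. i \<in> I \<Longrightarrow> linear (T i v)" "\<And>i w. i \<in> I \<Longrightarrow> linear (\<lambda>v. T i v w)"
    and m: "\<And>i. i \<in> I \<Longrightarrow> m i \<ge> 0"
    and bd: "\<And>b c. b \<in> Basis \<Longrightarrow> c \<in> Basis \<Longrightarrow> \<exists>C. \<forall>i\<in>I. \<bar>T i b c\<bar> \<le> C * m i"
  shows "\<exists>C\<ge>0. \<forall>i\<in>I. \<forall>v w. \<bar>T i v w\<bar> \<le> C * (m i * norm w * norm v)"
proof -
  have "\<exists>C\<ge>0. \<forall>j\<in>I \<times> UNIV. \<forall>v. \<bar>T (fst j) v (snd j)\<bar> \<le> C * ((m (fst j) * norm (snd j)) * norm v)"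
  proof (rule linear_uniform_bound)
    fix b :: 'e assume "b \<in> Basis"
    then have "\<exists>C\<ge>0. \<forall>i\<in>I. \<forall>w. \<bar>T i b w\<bar> \<le> C * (m i * norm w)"
      using lin m bd by (intro linear_uniform_bound) auto
    then show "\<exists>C. \<forall>j\<in>I \<times> UNIV. \<bar>T (fst j) b (snd j)\<bar> \<le> C * (m (fst j) * norm (snd j))"
      by force
  qed (use lin m in auto)
  then show ?thesis by force
qed

lemma trilinear_uniform_bound:
  fixes T :: "'i \<Rightarrow> 'e::euclidean_space \<Rightarrow> 'e \<Rightarrow> 'e \<Rightarrow> real"
  assumes lin: "\<And>i u v. i \<in> I \<Longrightarrow> linear (T i u v)" "\<And>i u w. i \<in> I \<Longrightarrow> linear (\<lambda>v. T i u v w)"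
      "\<And>i v w. i \<in> I \<Longrightarrow> linear (\<lambda>u. T i u v w)"
    and m: "\<And>i. i \<in> I \<Longrightarrow> m i \<ge> 0"
    and bd: "\<And>a b c. a \<in> Basis \<Longrightarrow> b \<in> Basis \<Longrightarrow> c \<in> Basis \<Longrightarrow> \<exists>C. \<forall>i\<in>I. \<bar>T i a b c\<bar> \<le> C * m i"
  shows "\<exists>C\<ge>0. \<forall>i\<in>I. \<forall>u v w. \<bar>T i u v w\<bar> \<le> C * (m i * norm w * norm v * norm u)"
proof -
  have "\<exists>C\<ge>0. \<forall>j\<in>I \<times> UNIV. \<forall>u v. \<bar>T (fst j) u v (snd j)\<bar> \<le> C * ((m (fst j) * norm (snd j)) * norm v * norm u)"
  proof (rule bilinear_uniform_bound)
    fix a b :: 'e assume "a \<in> Basis" "b \<in> Basis"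
    then have "\<exists>C\<ge>0. \<forall>i\<in>I. \<forall>w. \<bar>T i a b w\<bar> \<le> C * (m i * norm w)"
      using lin m bd by (intro linear_uniform_bound) auto
    then show "\<exists>C. \<forall>j\<in>I \<times> UNIV. \<bar>T (fst j) a b (snd j)\<bar> \<le> C * (m (fst j) * norm (snd j))"
      by force
  qed (use lin m in auto)
  then show ?thesis by force
qed

section \<open>Ordinary differential equations on the unit interval\<close>

lemma vector_derivative_bound:
  fixes f :: "real \<Rightarrow> 'e::real_normed_vector"
  assumes f: "\<And>t. t \<in> S \<Longrightarrow> (f has_vector_derivative f' t) (at t within S)"
    and bd: "\<And>t. t \<in> S \<Longrightarrow> norm (f' t) \<le> K" and st: "s \<in> S" "t \<in> S" and S: "convex S"
  shows "norm (f s - f t) \<le> K * \<bar>s - t\<bar>"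
proof -
  have "onorm (\<lambda>h. h *\<^sub>R f' t) \<le> K" if "t \<in> S" for t
    by (rule onorm_le) (use bd[OF that] in \<open>simp add: mult.commute[of K] mult_left_mono\<close>)
  then have "norm (f s - f t) \<le> K * norm (s - t)"
    using f st S unfolding has_vector_derivative_def
    by (intro differentiable_bound[of S f "\<lambda>t h. h *\<^sub>R f' t"]) auto
  then show ?thesis by simp
qed

text \<open>The curves \<open>p\<close> and \<open>q\<close> are solutions of the geodesic equation of speed at most \<open>m\<close>.  Their difference
  \<open>\<delta>\<close> satisfies \<open>\<parallel>\<delta>''\<parallel> \<le> k D\<close> with \<open>D = sup \<parallel>\<delta>'\<parallel>\<close> and \<open>k < 1/2\<close>, so \<open>\<delta>'\<close> varies by at most \<open>k D\<close>.  Either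
  boundary condition bounds \<open>\<delta>' 0\<close> by \<open>k D\<close> as well, whence \<open>D \<le> 2 k D\<close>.\<close>

lemma short_geodesics_unique:
  fixes \<Gamma> :: "'e::euclidean_space \<Rightarrow> 'e \<Rightarrow> 'e \<Rightarrow> 'e"
  assumes bil: "\<And>a. a \<in> B \<Longrightarrow> bilinear (\<Gamma> a)"
    and bd: "\<And>a u v. a \<in> B \<Longrightarrow> norm (\<Gamma> a u v) \<le> C * norm u * norm v"
    and lip: "\<And>a b u v. a \<in> B \<Longrightarrow> b \<in> B \<Longrightarrow>
       norm (\<Gamma> a u v - \<Gamma> b u v) \<le> C * norm (a - b) * norm u * norm v"
    and C: "C \<ge> 0" and small: "C * (m\<^sup>2 + 2 * m) < 1 / 2"
    and p: "\<And>t. t \<in> {0..1} \<Longrightarrow> (p has_vector_derivative p' t) (at t within {0..1})"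
      "\<And>t. t \<in> {0..1} \<Longrightarrow> (p' has_vector_derivative - \<Gamma> (p t) (p' t) (p' t)) (at t within {0..1})"
      "\<And>t. t \<in> {0..1} \<Longrightarrow> p t \<in> B" "\<And>t. t \<in> {0..1} \<Longrightarrow> norm (p' t) \<le> m"
    and q: "\<And>t. t \<in> {0..1} \<Longrightarrow> (q has_vector_derivative q' t) (at t within {0..1})"
      "\<And>t. t \<in> {0..1} \<Longrightarrow> (q' has_vector_derivative - \<Gamma> (q t) (q' t) (q' t)) (at t within {0..1})"
      "\<And>t. t \<in> {0..1} \<Longrightarrow> q t \<in> B" "\<And>t. t \<in> {0..1} \<Longrightarrow> norm (q' t) \<le> m"
    and start: "p 0 = q 0" and bc: "p 1 = q 1 \<or> p' 0 = q' 0"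
    and t: "t \<in> {0..1}"
  shows "p t = q t \<and> p' t = q' t"
proof -
  define k where "k = C * (m\<^sup>2 + 2 * m)"
  have m: "m \<ge> 0" using order_trans[OF norm_ge_zero p(4)[of 0]] by simp
  have k: "0 \<le> k" "k < 1/2" using C m small by (auto simp: k_def)
  define \<delta> where "\<delta> = (\<lambda>t. p t - q t)"
  define \<delta>' where "\<delta>' = (\<lambda>t. p' t - q' t)"
  have d\<delta>: "(\<delta> has_vector_derivative \<delta>' t) (at t within {0..1})" if "t \<in> {0..1}" for t
    unfolding \<delta>_def \<delta>'_def by (intro has_vector_derivative_diff p q that)
  have d\<delta>': "(\<delta>' has_vector_derivative - \<Gamma> (p t) (p' t) (p' t) - (- \<Gamma> (q t) (q' t) (q' t))) (at t within {0..1})"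
    if "t \<in> {0..1}" for t
    unfolding \<delta>_def \<delta>'_def by (intro has_vector_derivative_diff p q that)
  have "continuous_on {0..1} \<delta>'"
    unfolding continuous_on_eq_continuous_within
    using has_vector_derivative_continuous[OF d\<delta>'] by blast
  from continuous_attains_sup[OF compact_Icc _ continuous_on_norm[OF this]]
  obtain \<tau> where \<tau>: "\<tau> \<in> {0..1}" "\<And>t. t \<in> {0..1} \<Longrightarrow> norm (\<delta>' t) \<le> norm (\<delta>' \<tau>)"
    by force
  define D where "D = norm (\<delta>' \<tau>)"
  have D: "D \<ge> 0" "\<And>t. t \<in> {0..1} \<Longrightarrow> norm (\<delta>' t) \<le> D" using \<tau> by (auto simp: D_def)
  have \<delta>: "norm (\<delta> t) \<le> D" if "t \<in> {0..1}" for t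
  proof -
    have "norm (\<delta> t - \<delta> 0) \<le> D * \<bar>t - 0\<bar>"
      using that D d\<delta> by (intro vector_derivative_bound[of "{0..1}" \<delta> \<delta>']) auto
    also have "\<dots> \<le> D" using D(1) that by (simp add: mult_left_le)
    finally show ?thesis using start by (simp add: \<delta>_def)
  qed
  have acc: "norm (- \<Gamma> (p t) (p' t) (p' t) - (- \<Gamma> (q t) (q' t) (q' t))) \<le> k * D" if t: "t \<in> {0..1}" for t
  proof -
    have lin: "linear (\<Gamma> (q t) u)" "linear (\<lambda>u. \<Gamma> (q t) u v)" for u v
      using bil[OF q(3)[OF t]] by (auto simp: bilinear_def)
    have "\<Gamma> (p t) (p' t) (p' t) - \<Gamma> (q t) (q' t) (q' t) = (\<Gamma> (p t) (p' t) (p' t) - \<Gamma> (q t) (p' t) (p' t))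
       + (\<Gamma> (q t) (\<delta>' t) (p' t) + \<Gamma> (q t) (q' t) (\<delta>' t))"
      using linear_diff[OF lin(1)] linear_diff[OF lin(2)] by (simp add: \<delta>'_def)
    also have "norm \<dots> \<le> C * norm (p t - q t) * norm (p' t) * norm (p' t)
       + (C * norm (\<delta>' t) * norm (p' t) + C * norm (q' t) * norm (\<delta>' t))"
      by (intro order_trans[OF norm_triangle_ineq] add_mono lip bd p q t)
    also have "\<dots> \<le> C * D * m * m + (C * D * m + C * m * D)"
      using \<delta>[OF t] D p(4)[OF t] q(4)[OF t] m C t
      by (intro add_mono mult_mono) (auto simp: \<delta>_def)
    also have "\<dots> = k * D" by (simp add: k_def algebra_simps power2_eq_square)
    finally show ?thesis by (simp add: norm_minus_commute)
  qed
  have var: "norm (\<delta>' s - \<delta>' t) \<le> k * D" if "s \<in> {0..1}" "t \<in> {0..1}" for s t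
  proof -
    have "norm (\<delta>' s - \<delta>' t) \<le> k * D * \<bar>s - t\<bar>"
      using that by (intro vector_derivative_bound[OF d\<delta>' acc]) auto
    also have "\<dots> \<le> k * D" using that D(1) k by (intro mult_left_le) auto
    finally show ?thesis .
  qed
  have "norm (\<delta>' 0) \<le> k * D"
    using bc
  proof
    assume "p 1 = q 1"
    \<comment> \<open>Since \<open>\<delta> 0 = \<delta> 1 = 0\<close>, the deviation of \<open>\<delta>\<close> from its linearisation at \<open>0\<close> is \<open>\<delta>' 0\<close> itself.\<close>
    have "norm ((\<delta> 1 - 1 *\<^sub>R \<delta>' 0) - (\<delta> 0 - 0 *\<^sub>R \<delta>' 0)) \<le> k * D * \<bar>1 - 0\<bar>"
    proof (rule vector_derivative_bound)
      fix t :: real assume t: "t \<in> {0..1}"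
      show "((\<lambda>t. \<delta> t - t *\<^sub>R \<delta>' 0) has_vector_derivative \<delta>' t - \<delta>' 0) (at t within {0..1})"
        using d\<delta>[OF t] by (auto intro!: derivative_eq_intros)
      show "norm (\<delta>' t - \<delta>' 0) \<le> k * D" using t by (intro var) auto
    qed auto
    then show ?thesis using start \<open>p 1 = q 1\<close> by (simp add: \<delta>_def)
  next
    assume "p' 0 = q' 0"
    then show ?thesis using k D by (simp add: \<delta>'_def)
  qed
  moreover have "norm (\<delta>' \<tau> - \<delta>' 0) \<le> k * D" using \<tau> by (intro var) auto
  ultimately have "D \<le> 2 * k * D"
    using norm_triangle_sub[of "\<delta>' \<tau>" "\<delta>' 0"] unfolding D_def by linarith
  then have "D = 0"
    using k D(1) mult_right_mono[of "2 * k" 1 D] by (cases "D = 0") (auto simp: mult_less_cancel_right2 not_le[symmetric])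
  then show ?thesis using \<delta>[OF t] D(2)[OF t] by (simp add: \<delta>_def \<delta>'_def)
qed

text \<open>Picard iteration.  The bound \<open>1/2\<close> makes the integral operator a contraction on the whole unit
  interval, so that no continuation of local solutions is needed.\<close>

lemma linear_ode_exists:
  fixes A :: "real \<Rightarrow> 'e::euclidean_space \<Rightarrow> 'e"
  assumes lin: "\<And>t. t \<in> {0..1} \<Longrightarrow> linear (A t)"
    and bd: "\<And>t v. t \<in> {0..1} \<Longrightarrow> norm (A t v) \<le> 1 / 2 * norm v"
    and cont: "\<And>Y. continuous_on {0..1} Y \<Longrightarrow> continuous_on {0..1} (\<lambda>t. A t (Y t))"
  shows "\<exists>Y. Y 0 = v \<and> (\<forall>t\<in>{0..1}. (Y has_vector_derivative A t (Y t)) (at t within {0..1}))"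
proof -
  \<comment> \<open>Bounded continuous functions live on all of \<open>\<real>\<close>; clamping the time extends functions on the unit interval.\<close>
  define c where "c = (\<lambda>t::real. max 0 (min 1 t))"
  have c: "c t \<in> {0..1}" for t by (auto simp: c_def)
  define F where "F = (\<lambda>Y::real \<Rightarrow>\<^sub>C 'e. \<lambda>t. v + integral {0..c t} (\<lambda>s. A s (Y s)))"
  have contA: "continuous_on {0..1} (\<lambda>s. A s (apply_bcontfun Y s))" for Y
    by (rule cont) simp
  have contI: "continuous_on {0..1} (\<lambda>t. v + integral {0..t} (\<lambda>s. A s (apply_bcontfun Y s)))" for Y
    by (intro continuous_intros indefinite_integral_continuous_1 integrable_continuous_real contA)
  have F: "F Y \<in> bcontfun" for Y
  proof -
    have "continuous_on UNIV (F Y)"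
      unfolding F_def
      by (rule continuous_on_compose2[OF contI]) (use c in \<open>auto simp: c_def intro!: continuous_intros\<close>)
    moreover have "bounded (range (F Y))"
    proof (rule bounded_subset)
      show "bounded ((\<lambda>t. v + integral {0..t} (\<lambda>s. A s (apply_bcontfun Y s))) ` {0..1})"
        by (intro compact_imp_bounded compact_continuous_image contI) auto
    qed (use c in \<open>auto simp: F_def\<close>)
    ultimately show ?thesis by (simp add: bcontfun_def)
  qed
  have "dist (Bcontfun (F Y)) (Bcontfun (F Z)) \<le> 1 / 2 * dist Y Z" for Y Z
  proof (rule dist_bound)
    fix t
    have sub: "{0..c t} \<subseteq> {0..1}" using c[of t] by auto
    have int: "(\<lambda>s. A s (apply_bcontfun Y s)) integrable_on {0..c t}" for Y
      by (intro integrable_continuous_real continuous_on_subset[OF contA sub])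
    have "dist (F Y t) (F Z t) = norm (integral {0..c t} (\<lambda>s. A s (Y s) - A s (Z s)))"
      using int by (simp add: F_def dist_norm integral_diff)
    also have "\<dots> \<le> 1 / 2 * dist Y Z * (c t - 0)"
    proof (rule integral_bound)
      show "continuous_on {0..c t} (\<lambda>s. A s (Y s) - A s (Z s))"
        by (intro continuous_intros continuous_on_subset[OF contA sub])
      fix s assume "s \<in> {0..c t}"
      then have s: "s \<in> {0..1}" using sub by auto
      have "norm (A s (Y s) - A s (Z s)) = norm (A s (Y s - Z s))"
        using lin[OF s] by (simp add: linear_diff)
      also have "\<dots> \<le> 1 / 2 * norm (Y s - Z s)" by (rule bd[OF s])
      also have "\<dots> \<le> 1 / 2 * dist Y Z" using dist_bounded[of Y s Z] by (simp add: dist_norm)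
      finally show "norm (A s (Y s) - A s (Z s)) \<le> 1 / 2 * dist Y Z" .
    qed (use c[of t] in auto)
    also have "\<dots> \<le> 1 / 2 * dist Y Z"
      using c[of t] by (intro mult_left_le) auto
    finally show "dist (apply_bcontfun (Bcontfun (F Y)) t) (apply_bcontfun (Bcontfun (F Z)) t) \<le> 1 / 2 * dist Y Z"
      by (simp add: Bcontfun_inverse F)
  qed
  then have "\<exists>!Y. Bcontfun (F Y) = Y"
    by (intro banach_fix_type[of "1/2"]) auto
  then obtain Y where "Bcontfun (F Y) = Y" by auto
  then have Y: "apply_bcontfun Y t = F Y t" for t using Bcontfun_inverse[OF F, of Y] by metis
  show ?thesis
  proof (intro exI[of _ "apply_bcontfun Y"] conjI ballI)
    show "Y 0 = v" using Y[of 0] by (simp add: F_def c_def)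
    fix t :: real assume t: "t \<in> {0..1}"
    have "((\<lambda>t. v + integral {0..t} (\<lambda>s. A s (Y s))) has_vector_derivative 0 + A t (Y t)) (at t within {0..1})"
      by (intro has_vector_derivative_add has_vector_derivative_const
          integral_has_vector_derivative contA t)
    moreover have "apply_bcontfun Y s = v + integral {0..s} (\<lambda>s. A s (Y s))" if "s \<in> {0..1}" for s
      using that Y[of s] by (simp add: F_def c_def)
    ultimately show "(Y has_vector_derivative A t (Y t)) (at t within {0..1})"
      by (auto intro: has_vector_derivative_transform[OF t])
  qed
qed

section \<open>Riemannian metrics on open subsets of Euclidean space\<close>

locale euclidean_metric =
  fixes U :: "'e::euclidean_space set" and g :: "'e \<Rightarrow> 'e \<Rightarrow> 'e \<Rightarrow> real"
  assumes open_U: "open U"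
    and bilinear: "p \<in> U \<Longrightarrow> bilinear (g p)"
    and sym: "p \<in> U \<Longrightarrow> g p u v = g p v u"
    and pos: "p \<in> U \<Longrightarrow> u \<noteq> 0 \<Longrightarrow> g p u u > 0"
    and smooth: "smooth_on U (\<lambda>p. g p u v)"
begin

lemma linear_right: "p \<in> U \<Longrightarrow> linear (g p u)"
  and linear_left: "p \<in> U \<Longrightarrow> linear (\<lambda>u. g p u v)"
  using bilinear by (auto simp: bilinear_def)

lemma differentiable: "p \<in> U \<Longrightarrow> (\<lambda>q. g q u v) differentiable (at p)"
  using smooth by (rule smooth_on_imp_differentiable)

text \<open>The map sending \<open>z\<close> to the values \<open>g p z b\<close> on the basis is linear and, by definiteness,
  injective, hence surjective.\<close>

lemma riesz:
  assumes p: "p \<in> U" and F: "linear F"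
  shows "\<exists>!z. \<forall>w. g p z w = F w"
proof -
  define T where "T = (\<lambda>z. \<Sum>b\<in>Basis. g p z b *\<^sub>R b)"
  have T: "T z \<bullet> b = g p z b" if "b \<in> Basis" for z b
    using that by (simp add: T_def)
  have uniq: "z = y" if "\<And>w. g p z w = g p y w" for z y
    using pos[OF p, of "z - y"] that[of "z - y"] linear_diff[OF linear_left[OF p]] by fastforce
  have linT: "linear T"
    unfolding T_def
    by (rule linearI) (simp_all add: linear_add[OF linear_left[OF p]] linear_scale[OF linear_left[OF p]]
      sum.distrib scaleR_add_left scaleR_sum_right)
  have "inj T"
  proof (rule injI)
    fix z y assume "T z = T y"
    then have *: "g p z b = g p y b" if "b \<in> Basis" for b using T that by metis
    have "g p z = g p y"
      using linear_eq_stdbasis[OF linear_right[OF p] linear_right[OF p]] * by blast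
    then show "z = y" by (intro uniq) simp
  qed
  then have "surj T" using linT linear_injective_imp_surjective by blast
  then obtain z where z: "T z = (\<Sum>b\<in>Basis. F b *\<^sub>R b)" by (metis surjD)
  have "g p z b = F b" if "b \<in> Basis" for b
    using T[OF that, of z] that by (simp add: z)
  then have "g p z = F"
    using linear_eq_stdbasis[OF linear_right[OF p] F] by blast
  then show ?thesis using uniq by (intro ex1I[of _ z]) auto
qed

definition dmetric :: "'e \<Rightarrow> 'e \<Rightarrow> 'e \<Rightarrow> 'e \<Rightarrow> real" where
  "dmetric p u v w = frechet_derivative (\<lambda>q. g q v w) (at p) u"

lemma dmetric_linear:
  assumes p: "p \<in> U"
  shows "linear (dmetric p u v)" "linear (\<lambda>v. dmetric p u v w)" "linear (\<lambda>u. dmetric p u v w)"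
proof -
  show "linear (dmetric p u v)" unfolding dmetric_def
    by (rule linear_family_derivative[OF open_U p linear_right differentiable[OF p]])
  show "linear (\<lambda>v. dmetric p u v w)" unfolding dmetric_def
    by (rule linear_family_derivative[OF open_U p linear_left differentiable[OF p]])
  show "linear (\<lambda>u. dmetric p u v w)" unfolding dmetric_def
    using differentiable[OF p] by (simp add: linear_frechet_derivative)
qed

lemma dmetric_sym: "p \<in> U \<Longrightarrow> dmetric p u v w = dmetric p u w v"
  unfolding dmetric_def
  using frechet_derivative_cong_open(1)[OF open_U, of p "\<lambda>q. g q v w" "\<lambda>q. g q w v"] sym by auto

definition koszul :: "'e \<Rightarrow> 'e \<Rightarrow> 'e \<Rightarrow> 'e \<Rightarrow> real" where
  "koszul p u v w = (dmetric p u v w + dmetric p v u w - dmetric p w u v) / 2"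

lemma koszul_linear:
  assumes p: "p \<in> U"
  shows "linear (koszul p u v)" "linear (\<lambda>v. koszul p u v w)" "linear (\<lambda>u. koszul p u v w)"
  using dmetric_linear[OF p]
  unfolding koszul_def linear_iff by (auto simp: algebra_simps add_divide_distrib diff_divide_distrib)

definition christ :: "'e \<Rightarrow> 'e \<Rightarrow> 'e \<Rightarrow> 'e" where
  "christ p u v = (THE z. \<forall>w. g p z w = koszul p u v w)"

lemma christ_eq: "p \<in> U \<Longrightarrow> g p (christ p u v) w = koszul p u v w"
  using theI'[OF riesz[OF _ koszul_linear(1)], of p p u v] unfolding christ_def by blast

lemma nondegenerate:
  assumes "p \<in> U" "\<And>w. g p z w = g p y w"
  shows "z = y"
  using riesz[OF assms(1) linear_right[OF assms(1), of y]] assms(2) by blast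

lemma christ_bilinear:
  assumes p: "p \<in> U"
  shows "bilinear (christ p)"
proof -
  note [simp] = linear_add[OF linear_left[OF p]] linear_scale[OF linear_left[OF p]] christ_eq[OF p]
    linear_add[OF koszul_linear(2)[OF p]] linear_scale[OF koszul_linear(2)[OF p]]
    linear_add[OF koszul_linear(3)[OF p]] linear_scale[OF koszul_linear(3)[OF p]]
  show ?thesis
    unfolding bilinear_def linear_iff by (auto intro!: nondegenerate[OF p])
qed

lemma christ_sym: "p \<in> U \<Longrightarrow> christ p u v = christ p v u"
  by (rule nondegenerate) (auto simp: christ_eq koszul_def dmetric_sym[of p _ u v])

text \<open>Compatibility of the connection with the metric: the terms of the two Koszul formulas that
  are antisymmetric in \<open>v\<close> and \<open>w\<close> cancel.\<close>

lemma christ_metric: "p \<in> U \<Longrightarrow> g p (christ p u v) w + g p v (christ p u w) = dmetric p u v w"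
  using dmetric_sym[of p u v w] dmetric_sym[of p v u w] dmetric_sym[of p w u v]
  by (simp add: sym[of p v] christ_eq koszul_def field_simps)

lemma metric_lower_bound:
  assumes B: "cball p0 r \<subseteq> U"
  shows "\<exists>l>0. \<forall>p\<in>cball p0 r. \<forall>u. l * (norm u)\<^sup>2 \<le> g p u u"
proof (cases "cball p0 r = {}")
  case True
  then show ?thesis by (intro exI[of _ 1]) auto
next
  case False
  have eq: "g p u u = (\<Sum>b\<in>Basis. \<Sum>c\<in>Basis. (u \<bullet> b) * ((u \<bullet> c) * g p b c))" if "p \<in> U" for p u
    using linear_eq_sum_Basis[OF linear_left[OF that], of u u]
      linear_eq_sum_Basis[OF linear_right[OF that], of _ u] by (simp add: sum_distrib_left)
  have "continuous_on (cball p0 r \<times> sphere 0 1) (\<lambda>x. g (fst x) b c)" for b c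
    by (rule continuous_on_compose2[OF smooth_on_imp_continuous_on[OF smooth]])
      (use B in \<open>auto intro!: continuous_intros\<close>)
  then have "continuous_on (cball p0 r \<times> sphere 0 1)
     (\<lambda>x. \<Sum>b\<in>Basis. \<Sum>c\<in>Basis. (snd x \<bullet> b) * ((snd x \<bullet> c) * g (fst x) b c))"
    by (intro continuous_intros)
  then have "continuous_on (cball p0 r \<times> sphere 0 1) (\<lambda>x. g (fst x) (snd x) (snd x))"
    by (rule continuous_on_eq) (use B in \<open>auto simp: eq\<close>)
  moreover have "cball p0 r \<times> sphere (0::'e) 1 \<noteq> {}"
    using False vector_choose_size[of 1] by (auto simp: ex_in_conv[symmetric])
  moreover have "compact (cball p0 r \<times> sphere (0::'e) 1)"
    by (intro compact_Times) auto
  ultimately obtain x where x: "x \<in> cball p0 r \<times> sphere 0 1"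
     "\<And>y. y \<in> cball p0 r \<times> sphere 0 1 \<Longrightarrow> g (fst x) (snd x) (snd x) \<le> g (fst y) (snd y) (snd y)"
    using continuous_attains_inf[of "cball p0 r \<times> sphere (0::'e) 1" "\<lambda>x. g (fst x) (snd x) (snd x)"]
    by blast
  define l where "l = g (fst x) (snd x) (snd x)"
  have "l > 0" unfolding l_def using x(1) B by (intro pos) auto
  moreover have "l * (norm u)\<^sup>2 \<le> g p u u" if p: "p \<in> cball p0 r" for p u
  proof (cases "u = 0")
    case True
    then show ?thesis using p B by (auto simp: linear_0[OF linear_right])
  next
    case False
    have pU: "p \<in> U" using p B by auto
    have "l \<le> g p (u /\<^sub>R norm u) (u /\<^sub>R norm u)"
      using x(2)[of "(p, u /\<^sub>R norm u)"] p False by (simp add: l_def)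
    also have "\<dots> = g p u u / (norm u)\<^sup>2"
      using linear_scale[OF linear_left[OF pU]] linear_scale[OF linear_right[OF pU]] 
      by (simp add: power2_eq_square divide_simps)
    finally show ?thesis using False by (simp add: field_simps)
  qed
  ultimately show ?thesis by blast
qed

lemma smooth_lipschitz:
  assumes "smooth_on U h" "cball p0 r \<subseteq> U"
  shows "\<exists>C\<ge>0. \<forall>x\<in>cball p0 r \<times> cball p0 r. \<bar>h (fst x) - h (snd x) :: real\<bar> \<le> C * norm (fst x - snd x)"
proof -
  have "Ck_on 1 U h" using assms(1) by (simp add: smooth_on_def del: Ck_on.simps One_nat_def)
  from C1_lipschitz_on_cball[OF this assms(2)] show ?thesis by auto
qed

lemma smooth_bounded:
  assumes "smooth_on U h" "cball p0 r \<subseteq> U"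
  shows "\<exists>C. \<forall>p\<in>cball p0 r. \<bar>h p :: real\<bar> \<le> C"
proof -
  have "compact (h ` cball p0 r)"
    using smooth_on_imp_continuous_on[OF assms(1)] assms(2)
    by (intro compact_continuous_image) (auto intro: continuous_on_subset)
  then show ?thesis using compact_imp_bounded bounded_real by (metis imageI)
qed

lemma dmetric_smooth: "smooth_on U (\<lambda>p. dmetric p u v w)"
  unfolding dmetric_def by (rule smooth_on_derivative[OF smooth])

lemma koszul_lipschitz:
  assumes B: "cball p0 r \<subseteq> U"
  shows "\<exists>C\<ge>0. \<forall>p\<in>cball p0 r. \<forall>q\<in>cball p0 r. \<forall>u v w.
     \<bar>koszul p u v w - koszul q u v w\<bar> \<le> C * (norm (p - q) * norm w * norm v * norm u)"
proof -
  have "\<exists>C\<ge>0. \<forall>x\<in>cball p0 r \<times> cball p0 r. \<forall>u v w.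
     \<bar>koszul (fst x) u v w - koszul (snd x) u v w\<bar> \<le> C * (norm (fst x - snd x) * norm w * norm v * norm u)"
  proof (rule trilinear_uniform_bound)
    fix u v w :: 'e
    obtain C1 C2 C3 where C:
      "\<And>x. x\<in>cball p0 r \<times> cball p0 r \<Longrightarrow> \<bar>dmetric (fst x) u v w - dmetric (snd x) u v w\<bar> \<le> C1 * norm (fst x - snd x)"
      "\<And>x. x\<in>cball p0 r \<times> cball p0 r \<Longrightarrow> \<bar>dmetric (fst x) v u w - dmetric (snd x) v u w\<bar> \<le> C2 * norm (fst x - snd x)"
      "\<And>x. x\<in>cball p0 r \<times> cball p0 r \<Longrightarrow> \<bar>dmetric (fst x) w u v - dmetric (snd x) w u v\<bar> \<le> C3 * norm (fst x - snd x)"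
      using smooth_lipschitz[OF dmetric_smooth B] by meson
    show "\<exists>C. \<forall>x\<in>cball p0 r \<times> cball p0 r. \<bar>koszul (fst x) u v w - koszul (snd x) u v w\<bar> \<le> C * norm (fst x - snd x)"
    proof (intro exI[of _ "(C1 + C2 + C3) / 2"] ballI)
      fix x assume x: "x \<in> cball p0 r \<times> cball p0 r"
      have "(C1 + C2 + C3) / 2 * norm (fst x - snd x) = 
         (C1 * norm (fst x - snd x) + C2 * norm (fst x - snd x) + C3 * norm (fst x - snd x)) / 2"
        by (simp add: algebra_simps)
      then show "\<bar>koszul (fst x) u v w - koszul (snd x) u v w\<bar> \<le> (C1 + C2 + C3) / 2 * norm (fst x - snd x)"
        using C[OF x] unfolding koszul_def by (simp add: abs_if field_simps split: if_splits)
    qed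
  next
    fix x u v w assume "x \<in> cball p0 r \<times> cball p0 r"
    then have "fst x \<in> U" "snd x \<in> U" using B by auto
    note lin = koszul_linear[OF this(1)] koszul_linear[OF this(2)]
    show "linear (\<lambda>w. koszul (fst x) u v w - koszul (snd x) u v w)"
      "linear (\<lambda>v. koszul (fst x) u v w - koszul (snd x) u v w)"
      "linear (\<lambda>u. koszul (fst x) u v w - koszul (snd x) u v w)"
      by (intro linear_compose_sub lin)+
  qed auto
  then show ?thesis by force
qed

lemma koszul_bound:
  assumes B: "cball p0 r \<subseteq> U"
  shows "\<exists>C\<ge>0. \<forall>p\<in>cball p0 r. \<forall>u v w. \<bar>koszul p u v w\<bar> \<le> C * (1 * norm w * norm v * norm u)"
proof (rule trilinear_uniform_bound)
  fix u v w :: 'e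
  obtain C1 C2 C3 where C:
      "\<And>x. x\<in>cball p0 r \<Longrightarrow> \<bar>dmetric x u v w\<bar> \<le> C1"
      "\<And>x. x\<in>cball p0 r \<Longrightarrow> \<bar>dmetric x v u w\<bar> \<le> C2"
      "\<And>x. x\<in>cball p0 r \<Longrightarrow> \<bar>dmetric x w u v\<bar> \<le> C3"
    using smooth_bounded[OF dmetric_smooth B] by meson
  show "\<exists>C. \<forall>x\<in>cball p0 r. \<bar>koszul x u v w\<bar> \<le> C * 1"
  proof (intro exI[of _ "(C1 + C2 + C3) / 2"] ballI)
    fix x assume x: "x \<in> cball p0 r"
    show "\<bar>koszul x u v w\<bar> \<le> (C1 + C2 + C3) / 2 * 1"
      using C[OF x] unfolding koszul_def by (simp add: abs_if field_simps split: if_splits)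
  qed
qed (use B in \<open>auto intro: koszul_linear\<close>)

lemma metric_lipschitz:
  assumes B: "cball p0 r \<subseteq> U"
  shows "\<exists>C\<ge>0. \<forall>p\<in>cball p0 r. \<forall>q\<in>cball p0 r. \<forall>u v.
     \<bar>g p u v - g q u v\<bar> \<le> C * (norm (p - q) * norm v * norm u)"
proof -
  have "\<exists>C\<ge>0. \<forall>x\<in>cball p0 r \<times> cball p0 r. \<forall>u v.
     \<bar>g (fst x) u v - g (snd x) u v\<bar> \<le> C * (norm (fst x - snd x) * norm v * norm u)"
  proof (rule bilinear_uniform_bound)
    fix u v :: 'e
    show "\<exists>C. \<forall>x\<in>cball p0 r \<times> cball p0 r. \<bar>g (fst x) u v - g (snd x) u v\<bar> \<le> C * norm (fst x - snd x)"
      using smooth_lipschitz[OF smooth B] by meson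
  next
    fix x u v assume "x \<in> cball p0 r \<times> cball p0 r"
    then have "fst x \<in> U" "snd x \<in> U" using B by auto
    note lin = linear_right[OF this(1)] linear_right[OF this(2)] linear_left[OF this(1)] linear_left[OF this(2)]
    show "linear (\<lambda>v. g (fst x) u v - g (snd x) u v)"
      "linear (\<lambda>u. g (fst x) u v - g (snd x) u v)"
      by (intro linear_compose_sub lin)+
  qed auto
  then show ?thesis by force
qed

text \<open>The Christoffel symbols are defined implicitly by \<open>g p (christ p u v) w = koszul p u v w\<close>, so instead
  of differentiating them, test this identity (and the difference of its instances at two
  points) against the vector to be estimated and use the uniform definiteness of \<open>g\<close>.\<close>

lemma christ_bounds:
  assumes B: "cball p0 r \<subseteq> U"
  shows "\<exists>C\<ge>0. (\<forall>p\<in>cball p0 r. \<forall>u v. norm (christ p u v) \<le> C * norm u * norm v) \<and>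
    (\<forall>p\<in>cball p0 r. \<forall>q\<in>cball p0 r. \<forall>u v.
       norm (christ p u v - christ q u v) \<le> C * norm (p - q) * norm u * norm v)"
proof -
  obtain l where l: "l > 0" "\<And>p u. p\<in>cball p0 r \<Longrightarrow> l * (norm u)\<^sup>2 \<le> g p u u"
    using metric_lower_bound[OF B] by blast
  obtain C1 where C1: "C1 \<ge> 0"
    "\<And>p u v w. p\<in>cball p0 r \<Longrightarrow> \<bar>koszul p u v w\<bar> \<le> C1 * (1 * norm w * norm v * norm u)"
    using koszul_bound[OF B] by blast
  obtain C2 where C2: "C2 \<ge> 0" "\<And>p q u v w. p\<in>cball p0 r \<Longrightarrow> q\<in>cball p0 r \<Longrightarrow>
     \<bar>koszul p u v w - koszul q u v w\<bar> \<le> C2 * (norm (p - q) * norm w * norm v * norm u)"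
    using koszul_lipschitz[OF B] by blast
  obtain C3 where C3: "C3 \<ge> 0" "\<And>p q u v. p\<in>cball p0 r \<Longrightarrow> q\<in>cball p0 r \<Longrightarrow>
     \<bar>g p u v - g q u v\<bar> \<le> C3 * (norm (p - q) * norm v * norm u)"
    using metric_lipschitz[OF B] by blast
  have div: "norm z \<le> K / l" if "l * (norm z)\<^sup>2 \<le> K * norm z" "K \<ge> 0" for K and z :: 'e
  proof (cases "z = 0")
    case True
    then show ?thesis using that l by simp
  next
    case False
    then have "l * norm z \<le> K" using that by (simp add: power2_eq_square)
    then show ?thesis using l by (simp add: field_simps)
  qed
  define D1 where "D1 = C1 / l"
  define D2 where "D2 = (C2 + C3 * D1) / l"
  have D: "D1 \<ge> 0" "D2 \<ge> 0" using C1 C2 C3 l by (auto simp: D1_def D2_def)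
  have b1: "norm (christ p u v) \<le> D1 * norm u * norm v" if p: "p \<in> cball p0 r" for p u v
  proof -
    have pU: "p \<in> U" using p B by auto
    have "l * (norm (christ p u v))\<^sup>2 \<le> koszul p u v (christ p u v)"
      using l(2)[OF p, of "christ p u v"] by (simp add: christ_eq[OF pU])
    also have "\<dots> \<le> (C1 * norm u * norm v) * norm (christ p u v)"
      using C1(2)[OF p, of u v "christ p u v"] by (simp add: mult_ac)
    finally have "norm (christ p u v) \<le> (C1 * norm u * norm v) / l"
      by (rule div) (use C1 in auto)
    then show ?thesis by (simp add: D1_def)
  qed
  have b2: "norm (christ p u v - christ q u v) \<le> D2 * norm (p - q) * norm u * norm v"
    if p: "p \<in> cball p0 r" and q: "q \<in> cball p0 r" for p q u v
  proof -
    have pU: "p \<in> U" and qU: "q \<in> U" using p q B by auto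
    define y where "y = christ q u v"
    define w where "w = christ p u v - y"
    have "l * (norm w)\<^sup>2 \<le> g p w w" by (rule l(2)[OF p])
    also have "\<dots> = koszul p u v w - g p y w"
      unfolding w_def by (simp add: linear_diff[OF linear_left[OF pU]] christ_eq[OF pU])
    also have "\<dots> = (koszul p u v w - koszul q u v w) - (g p y w - g q y w)"
      by (simp add: y_def christ_eq[OF qU])
    also have "\<dots> \<le> C2 * (norm (p - q) * norm w * norm v * norm u) + C3 * (norm (p - q) * norm w * norm y)"
      using C2(2)[OF p q, of u v w] C3(2)[OF p q, of y w] by linarith
    also have "\<dots> \<le> C2 * (norm (p - q) * norm w * norm v * norm u) +
        C3 * (norm (p - q) * norm w * (D1 * norm u * norm v))"
      using b1[OF q, of u v] C3 by (intro add_left_mono mult_left_mono) (auto simp: y_def)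
    also have "\<dots> = ((C2 + C3 * D1) * norm (p - q) * norm u * norm v) * norm w"
      by (simp add: algebra_simps)
    finally have "norm w \<le> ((C2 + C3 * D1) * norm (p - q) * norm u * norm v) / l"
      by (rule div) (use C2 C3 D in auto)
    then show ?thesis by (simp add: D2_def w_def y_def)
  qed
  define C where "C = D1 + D2"
  have "D1 * norm u * norm v \<le> C * norm u * norm v" for u v :: 'e
    using D by (intro mult_right_mono) (auto simp: C_def)
  moreover have "D2 * norm (p - q) * norm u * norm v \<le> C * norm (p - q) * norm u * norm v" for p q u v :: 'e
    using D by (intro mult_right_mono) (auto simp: C_def)
  moreover have "C \<ge> 0" using D by (simp add: C_def)
  ultimately show ?thesis using b1 b2 by (meson order_trans)
qed

lemma continuous_on_christ:
  assumes B: "cball p0 r \<subseteq> U" and p: "continuous_on T p" "p ` T \<subseteq> cball p0 r"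
    and u: "continuous_on T u" and v: "continuous_on T v"
  shows "continuous_on T (\<lambda>t. christ (p t) (u t) (v t))"
proof -
  obtain C where C: "C \<ge> 0" "\<And>p q u v. p \<in> cball p0 r \<Longrightarrow> q \<in> cball p0 r \<Longrightarrow>
      norm (christ p u v - christ q u v) \<le> C * norm (p - q) * norm u * norm v"
    using christ_bounds[OF B] by blast
  have "continuous_on (cball p0 r) (\<lambda>q. christ q b c)" for b c
  proof (rule lipschitz_on_continuous_on)
    show "(C * norm b * norm c)-lipschitz_on (cball p0 r) (\<lambda>q. christ q b c)"
      using C by (intro lipschitz_onI) (auto simp: dist_norm mult_ac)
  qed
  then have "continuous_on T (\<lambda>t. christ (p t) b c)" for b c
    by (rule continuous_on_compose2[OF _ p])
  then have "continuous_on T (\<lambda>t. \<Sum>b\<in>Basis. \<Sum>c\<in>Basis. (u t \<bullet> b) *\<^sub>R (v t \<bullet> c) *\<^sub>R christ (p t) b c)"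
    by (intro continuous_intros u v)
  moreover have "(\<Sum>b\<in>Basis. \<Sum>c\<in>Basis. (u t \<bullet> b) *\<^sub>R (v t \<bullet> c) *\<^sub>R christ (p t) b c) = christ (p t) (u t) (v t)"
    if "t \<in> T" for t
  proof -
    have "p t \<in> U" using that p B by auto
    from christ_bilinear[OF this] have lin: "linear (\<lambda>u. christ (p t) u v)" "linear (christ (p t) u)" for u v
      by (auto simp: bilinear_def)
    show ?thesis
      using linear_eq_sum_Basis[OF lin(1), of "u t" "v t"] linear_eq_sum_Basis[OF lin(2), of _ "v t"]
      by (simp add: scaleR_sum_right)
  qed
  ultimately show ?thesis by (rule continuous_on_eq)
qed

end

section \<open>Charts and tangent spaces\<close>

locale riemannian =
  fixes M :: "('a::{t2_space, second_countable_topology}, 'e::euclidean_space) riem"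
  assumes riemannian: "riemannian_manifold M"
begin

abbreviation "TM \<equiv> tangent_space M"

text \<open>The velocity of a curve defined on all of \<open>\<real>\<close>, hence two-sided at every time.\<close>

abbreviation "vel \<equiv> velocity M UNIV"

lemma smooth_atlas: "smooth_atlas (atlas M)"
  using riemannian by (simp add: riemannian_manifold_def)

lemma chart:
  assumes "\<kappa> \<in> atlas M"
  shows "open (fst \<kappa>)" "open (snd \<kappa> ` fst \<kappa>)"
    "continuous_on (fst \<kappa>) (snd \<kappa>)" "continuous_on (snd \<kappa> ` fst \<kappa>) (param \<kappa>)"
    "\<And>x. x \<in> fst \<kappa> \<Longrightarrow> param \<kappa> (snd \<kappa> x) = x"
proof -
  have "is_chart \<kappa>" using smooth_atlas assms by (simp add: smooth_atlas_def)
  then show "open (fst \<kappa>)" "open (snd \<kappa> ` fst \<kappa>)"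
    "continuous_on (fst \<kappa>) (snd \<kappa>)" "continuous_on (snd \<kappa> ` fst \<kappa>) (param \<kappa>)"
    "\<And>x. x \<in> fst \<kappa> \<Longrightarrow> param \<kappa> (snd \<kappa> x) = x"
    by (auto simp: is_chart_def homeomorphism_def)
qed

lemma charts_atD:
  assumes "\<kappa> \<in> charts_at M x"
  shows "\<kappa> \<in> atlas M" "x \<in> fst \<kappa>" "snd \<kappa> x \<in> snd \<kappa> ` fst \<kappa>" "param \<kappa> (snd \<kappa> x) = x"
  using assms chart(5) by (auto simp: charts_at_def)

lemma ex_chart_at: "\<exists>\<kappa>. \<kappa> \<in> charts_at M x"
proof -
  have "x \<in> (\<Union>\<kappa>\<in>atlas M. fst \<kappa>)" using smooth_atlas by (simp add: smooth_atlas_def)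
  then show ?thesis by (auto simp: charts_at_def)
qed

lemma local_metric: "\<kappa> \<in> atlas M \<Longrightarrow> euclidean_metric (snd \<kappa> ` fst \<kappa>) (local_metric M \<kappa>)"
  by (rule euclidean_metric.intro; use riemannian chart(2)[of \<kappa>] in \<open>auto simp: riemannian_manifold_def\<close>)

lemma christoffel_eq: "christoffel M \<kappa> = euclidean_metric.christ (local_metric M \<kappa>)" if "\<kappa> \<in> atlas M"
proof -
  interpret E: euclidean_metric "snd \<kappa> ` fst \<kappa>" "local_metric M \<kappa>" by (rule local_metric[OF that])
  show ?thesis
    by (intro ext) (simp add: christoffel_def E.christ_def E.koszul_def E.dmetric_def)
qed

lemma transition:
  assumes "\<kappa> \<in> charts_at M x" "\<kappa>' \<in> charts_at M x"
  shows "open (snd \<kappa> ` (fst \<kappa> \<inter> fst \<kappa>'))" "snd \<kappa> x \<in> snd \<kappa> ` (fst \<kappa> \<inter> fst \<kappa>')"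
    "smooth_on (snd \<kappa> ` (fst \<kappa> \<inter> fst \<kappa>')) (snd \<kappa>' \<circ> param \<kappa>)"
    "((snd \<kappa>' \<circ> param \<kappa>) has_derivative coord_change x \<kappa> \<kappa>') (at (snd \<kappa> x))"
    "linear (coord_change x \<kappa> \<kappa>')"
proof -
  note \<kappa> = charts_atD[OF assms(1)] and \<kappa>' = charts_atD[OF assms(2)]
  have "snd \<kappa> ` (fst \<kappa> \<inter> fst \<kappa>') = snd \<kappa> ` fst \<kappa> \<inter> param \<kappa> -` fst \<kappa>'"
    using chart(5)[OF \<kappa>(1)] by force
  then show *: "open (snd \<kappa> ` (fst \<kappa> \<inter> fst \<kappa>'))"
    using continuous_open_preimage[OF chart(4,2)[OF \<kappa>(1)] chart(1)[OF \<kappa>'(1)]] by simp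
  show in_S: "snd \<kappa> x \<in> snd \<kappa> ` (fst \<kappa> \<inter> fst \<kappa>')" using \<kappa> \<kappa>' by auto
  show sm: "smooth_on (snd \<kappa> ` (fst \<kappa> \<inter> fst \<kappa>')) (snd \<kappa>' \<circ> param \<kappa>)"
    using smooth_atlas \<kappa>(1) \<kappa>'(1) by (simp add: smooth_atlas_def)
  show "((snd \<kappa>' \<circ> param \<kappa>) has_derivative coord_change x \<kappa> \<kappa>') (at (snd \<kappa> x))"
    using smooth_on_imp_differentiable[OF sm in_S] by (simp add: coord_change_def frechet_derivative_works)
  then show "linear (coord_change x \<kappa> \<kappa>')" using has_derivative_linear by blast
qed

lemma coord_change_self:
  assumes "\<kappa> \<in> charts_at M x"
  shows "coord_change x \<kappa> \<kappa> u = u"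
proof -
  note \<kappa> = charts_atD[OF assms]
  have "frechet_derivative (snd \<kappa> \<circ> param \<kappa>) (at (snd \<kappa> x)) = frechet_derivative id (at (snd \<kappa> x))"
    by (rule frechet_derivative_cong_open[OF chart(2)[OF \<kappa>(1)] \<kappa>(3)])
      (use chart(5)[OF \<kappa>(1)] in auto)
  then show ?thesis unfolding coord_change_def by simp
qed

text \<open>The chain rule for coordinate changes.  It makes the coordinates prescribed in one chart
  extend consistently to a tangent vector.\<close>

lemma coord_change_comp:
  assumes "\<kappa> \<in> charts_at M x" "\<kappa>' \<in> charts_at M x" "\<kappa>'' \<in> charts_at M x"
  shows "coord_change x \<kappa>' \<kappa>'' (coord_change x \<kappa> \<kappa>' u) = coord_change x \<kappa> \<kappa>'' u"
proof -
  note tr = transition[OF assms(1,2)]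
  have p: "(snd \<kappa>' \<circ> param \<kappa>) (snd \<kappa> x) = snd \<kappa>' x" using charts_atD[OF assms(1)] by simp
  have "((snd \<kappa>'' \<circ> param \<kappa>') \<circ> (snd \<kappa>' \<circ> param \<kappa>) has_derivative
      coord_change x \<kappa>' \<kappa>'' \<circ> coord_change x \<kappa> \<kappa>') (at (snd \<kappa> x))"
    by (rule diff_chain_at[OF tr(4)]) (use transition(4)[OF assms(2,3)] p in simp)
  then have "((snd \<kappa>'' \<circ> param \<kappa>) has_derivative
      coord_change x \<kappa>' \<kappa>'' \<circ> coord_change x \<kappa> \<kappa>') (at (snd \<kappa> x))"
    by (rule has_derivative_transform_within_open[OF _ tr(1,2)])
      (use chart(5)[OF charts_atD(1)[OF assms(1)]] chart(5)[OF charts_atD(1)[OF assms(2)]] in auto)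
  from has_derivative_unique[OF this transition(4)[OF assms(1,3)]]
  show ?thesis by (simp add: fun_eq_iff)
qed

lemma tangent_spaceI:
  assumes "\<And>\<kappa> \<kappa>'. \<kappa> \<in> charts_at M x \<Longrightarrow> \<kappa>' \<in> charts_at M x \<Longrightarrow> v \<kappa>' = coord_change x \<kappa> \<kappa>' (v \<kappa>)"
    and "\<And>\<kappa>. \<kappa> \<notin> charts_at M x \<Longrightarrow> v \<kappa> = 0"
  shows "v \<in> TM x"
  unfolding tangent_space_def using assms by blast

lemma tangent_space_coord_change:
  assumes "v \<in> TM x" "\<kappa> \<in> charts_at M x" "\<kappa>' \<in> charts_at M x"
  shows "v \<kappa>' = coord_change x \<kappa> \<kappa>' (v \<kappa>)"
  using assms unfolding tangent_space_def by blast

lemma tangent_space_off_chart: "v \<in> TM x \<Longrightarrow> \<kappa> \<notin> charts_at M x \<Longrightarrow> v \<kappa> = 0"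
  unfolding tangent_space_def by blast

lemma tangent_of_in_tangent_space:
  assumes "\<kappa> \<in> charts_at M x"
  shows "tangent_of M \<kappa> x u \<in> TM x"
  by (rule tangent_spaceI) (simp_all add: tangent_of_def coord_change_comp[OF assms])

lemma tangent_of_coord:
  assumes "\<kappa> \<in> charts_at M x"
  shows "tangent_of M \<kappa> x u \<kappa> = u"
  using assms by (simp add: tangent_of_def coord_change_self)

lemma tangent_of_coords:
  assumes "\<kappa> \<in> charts_at M x" "v \<in> TM x"
  shows "tangent_of M \<kappa> x (v \<kappa>) = v"
proof
  fix \<kappa>'
  show "tangent_of M \<kappa> x (v \<kappa>) \<kappa>' = v \<kappa>'"
  proof (cases "\<kappa>' \<in> charts_at M x")
    case True
    then show ?thesis
      unfolding tangent_space_coord_change[OF assms(2,1) True] by (simp add: tangent_of_def)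
  next
    case False
    then show ?thesis using tangent_space_off_chart[OF assms(2)] by (simp add: tangent_of_def)
  qed
qed

lemma tangent_eqI:
  assumes "\<kappa> \<in> charts_at M x" "v \<in> TM x" "w \<in> TM x" "v \<kappa> = w \<kappa>"
  shows "v = w"
  by (metis assms tangent_of_coords)

lemma riem_metric_coords:
  assumes "\<kappa> \<in> charts_at M x" "v \<in> TM x" "w \<in> TM x"
  shows "riem_metric M x v w = local_metric M \<kappa> (snd \<kappa> x) (v \<kappa>) (w \<kappa>)"
  using assms charts_atD[OF assms(1)] by (simp add: local_metric_def tangent_of_coords)

lemma tangent_space_scale:
  assumes v: "v \<in> TM x"
  shows "tscale r v \<in> TM x"
proof (rule tangent_spaceI)
  fix \<kappa> \<kappa>' assume \<kappa>: "\<kappa> \<in> charts_at M x" "\<kappa>' \<in> charts_at M x"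
  show "tscale r v \<kappa>' = coord_change x \<kappa> \<kappa>' (tscale r v \<kappa>)"
    using linear_scale[OF transition(5)[OF \<kappa>], of r "v \<kappa>"] tangent_space_coord_change[OF v \<kappa>]
    by (simp only: tscale_def)
qed (simp add: tscale_def tangent_space_off_chart[OF v])

lemma tangent_space_diff:
  assumes v: "v \<in> TM x" and w: "w \<in> TM x"
  shows "v - w \<in> TM x"
proof (rule tangent_spaceI)
  fix \<kappa> \<kappa>' assume \<kappa>: "\<kappa> \<in> charts_at M x" "\<kappa>' \<in> charts_at M x"
  show "(v - w) \<kappa>' = coord_change x \<kappa> \<kappa>' ((v - w) \<kappa>)"
    using linear_diff[OF transition(5)[OF \<kappa>], of "v \<kappa>" "w \<kappa>"] tangent_space_coord_change[OF v \<kappa>]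
      tangent_space_coord_change[OF w \<kappa>]
    by (simp only: fun_diff_def)
qed (simp add: tangent_space_off_chart[OF v] tangent_space_off_chart[OF w])

lemma uminus_eq_tscale: "- v = tscale (- 1) v"
  by (simp add: tscale_def fun_eq_iff)

lemma local_metric_at:
  assumes "\<kappa> \<in> charts_at M x"
  shows "bilinear (local_metric M \<kappa> (snd \<kappa> x))"
    "local_metric M \<kappa> (snd \<kappa> x) a b = local_metric M \<kappa> (snd \<kappa> x) b a"
    "a \<noteq> 0 \<Longrightarrow> local_metric M \<kappa> (snd \<kappa> x) a a > 0"
  using riemannian charts_atD[OF assms] by (auto simp: riemannian_manifold_def)

lemma
  assumes v: "v \<in> TM x"
  shows riem_metric_nonneg: "riem_metric M x v v \<ge> 0"
    and riem_metric_eq_0: "riem_metric M x v v = 0 \<Longrightarrow> v = (\<lambda>_. 0)"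
proof -
  obtain \<kappa> where \<kappa>: "\<kappa> \<in> charts_at M x" using ex_chart_at by blast
  note g = local_metric_at[OF \<kappa>] and coords = riem_metric_coords[OF \<kappa> v v]
  show "riem_metric M x v v \<ge> 0"
    using g(3)[of "v \<kappa>"] bilinear_lzero[OF g(1), of 0] by (cases "v \<kappa> = 0") (auto simp: coords)
  show "v = (\<lambda>_. 0)" if "riem_metric M x v v = 0"
  proof
    fix \<kappa>'
    have "v \<kappa> = 0" using that g(3)[of "v \<kappa>"] by (auto simp: coords)
    then show "v \<kappa>' = 0"
      using tangent_space_coord_change[OF v \<kappa>, of \<kappa>'] tangent_space_off_chart[OF v, of \<kappa>']
        linear_0[OF transition(5)[OF \<kappa>, of \<kappa>']] by metis
  qed
qed

lemma
  assumes v: "v \<in> TM x" and w: "w \<in> TM x"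
  shows riem_metric_sym: "riem_metric M x v w = riem_metric M x w v"
    and riem_metric_scale_left: "riem_metric M x (tscale r v) w = r * riem_metric M x v w"
    and riem_metric_scale_right: "riem_metric M x v (tscale r w) = r * riem_metric M x v w"
proof -
  obtain \<kappa> where \<kappa>: "\<kappa> \<in> charts_at M x" using ex_chart_at by blast
  note g = local_metric_at[OF \<kappa>] and coords = riem_metric_coords[OF \<kappa>]
  show "riem_metric M x v w = riem_metric M x w v"
    unfolding coords[OF v w] coords[OF w v] by (rule g(2))
  show "riem_metric M x (tscale r v) w = r * riem_metric M x v w"
    unfolding coords[OF v w] coords[OF tangent_space_scale[OF v] w]
    by (simp add: tscale_def bilinear_lmul[OF g(1)])
  show "riem_metric M x v (tscale r w) = r * riem_metric M x v w"
    unfolding coords[OF v w] coords[OF v tangent_space_scale[OF w]]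
    by (simp add: tscale_def bilinear_rmul[OF g(1)])
qed

lemma riem_metric_diff_left:
  assumes u: "u \<in> TM x" and v: "v \<in> TM x" and w: "w \<in> TM x"
  shows "riem_metric M x (u - v) w = riem_metric M x u w - riem_metric M x v w"
proof -
  obtain \<kappa> where \<kappa>: "\<kappa> \<in> charts_at M x" using ex_chart_at by blast
  note coords = riem_metric_coords[OF \<kappa>]
  show ?thesis
    unfolding coords[OF u w] coords[OF v w] coords[OF tangent_space_diff[OF u v] w]
    by (simp add: bilinear_lsub[OF local_metric_at(1)[OF \<kappa>]])
qed

lemma riem_metric_diff_right:
  assumes "u \<in> TM x" "v \<in> TM x" "w \<in> TM x"
  shows "riem_metric M x w (u - v) = riem_metric M x w u - riem_metric M x w v"
  using riem_metric_sym[OF tangent_space_diff[OF assms(1,2)] assms(3)]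
    riem_metric_sym[OF assms(1,3)] riem_metric_sym[OF assms(2,3)] riem_metric_diff_left[OF assms] by simp

lemma tnorm_nonneg: "v \<in> TM x \<Longrightarrow> tnorm M x v \<ge> 0"
  by (simp add: tnorm_def riem_metric_nonneg)

lemma tnorm_square: "v \<in> TM x \<Longrightarrow> (tnorm M x v)\<^sup>2 = riem_metric M x v v"
  by (simp add: tnorm_def riem_metric_nonneg)

lemma tnorm_scale:
  assumes "v \<in> TM x"
  shows "tnorm M x (tscale r v) = \<bar>r\<bar> * tnorm M x v"
proof -
  have "riem_metric M x (tscale r v) (tscale r v) = r\<^sup>2 * riem_metric M x v v"
    using riem_metric_scale_left[OF assms tangent_space_scale[OF assms], of r r]
      riem_metric_scale_right[OF assms assms, of r]
    by (simp only: power2_eq_square mult.assoc)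
  then show ?thesis by (simp add: tnorm_def real_sqrt_mult)
qed

lemma riem_metric_Cauchy_Schwarz:
  assumes v: "v \<in> TM x" and w: "w \<in> TM x"
  shows "\<bar>riem_metric M x v w\<bar> \<le> tnorm M x v * tnorm M x w"
proof (cases "riem_metric M x w w = 0")
  case True
  then have "w = (\<lambda>_. 0)" by (rule riem_metric_eq_0[OF w])
  then have "w = tscale 0 w" by (simp add: tscale_def)
  then have "riem_metric M x v w = 0" using riem_metric_scale_right[OF v w, of 0] by simp
  then show ?thesis using v w by (simp add: tnorm_nonneg)
next
  case False
  then have pos: "riem_metric M x w w > 0" using riem_metric_nonneg[OF w] by simp
  define r where "r = riem_metric M x v w / riem_metric M x w w"
  have rw: "tscale r w \<in> TM x" by (rule tangent_space_scale[OF w])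
  have "0 \<le> riem_metric M x (v - tscale r w) (v - tscale r w)"
    by (rule riem_metric_nonneg[OF tangent_space_diff[OF v rw]])
  also have "\<dots> = riem_metric M x v v - r * riem_metric M x v w
      - (r * riem_metric M x w v - r * (r * riem_metric M x w w))"
    by (simp only: riem_metric_diff_left[OF v rw tangent_space_diff[OF v rw]]
        riem_metric_diff_right[OF v rw v] riem_metric_diff_right[OF v rw rw]
        riem_metric_scale_left[OF w v] riem_metric_scale_left[OF w rw] riem_metric_scale_right[OF v w]
        riem_metric_scale_right[OF w w])
  also have "\<dots> = riem_metric M x v v - (riem_metric M x v w)\<^sup>2 / riem_metric M x w w"
    using pos by (simp add: riem_metric_sym[OF w v] r_def power2_eq_square field_simps)
  finally have "(riem_metric M x v w)\<^sup>2 \<le> riem_metric M x v v * riem_metric M x w w"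
    using pos by (simp add: field_simps)
  then have "\<bar>riem_metric M x v w\<bar> \<le> sqrt (riem_metric M x v v * riem_metric M x w w)"
    by (simp add: real_le_rsqrt)
  then show ?thesis by (simp add: tnorm_def real_sqrt_mult)
qed

section \<open>The gradient\<close>

lemma C1_function_differentiable:
  assumes "C1_function M f" "\<kappa> \<in> charts_at M x"
  shows "((f \<circ> param \<kappa>) has_derivative frechet_derivative (f \<circ> param \<kappa>) (at (snd \<kappa> x))) (at (snd \<kappa> x))"
proof -
  have "Ck_on (Suc 0) (snd \<kappa> ` fst \<kappa>) (f \<circ> param \<kappa>)"
    using assms charts_atD[OF assms(2)] by (simp add: C1_function_def del: Ck_on.simps)
  then show ?thesis using charts_atD[OF assms(2)] by (auto simp: frechet_derivative_works)
qed

text \<open>The chain rule again: the differential of \<open>f\<close> applied to a tangent vector does not depend on the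
  chart.  Hence the gradient found in one chart by the Riesz lemma represents the differential in all.\<close>

lemma differential_chart_independent:
  assumes f: "C1_function M f" and "\<kappa> \<in> charts_at M x" "\<kappa>' \<in> charts_at M x" "u \<in> TM x"
  shows "frechet_derivative (f \<circ> param \<kappa>') (at (snd \<kappa>' x)) (u \<kappa>') =
         frechet_derivative (f \<circ> param \<kappa>) (at (snd \<kappa> x)) (u \<kappa>)"
proof -
  note tr = transition[OF assms(2,3)]
  have p: "(snd \<kappa>' \<circ> param \<kappa>) (snd \<kappa> x) = snd \<kappa>' x" using charts_atD[OF assms(2)] by simp
  have "((f \<circ> param \<kappa>') \<circ> (snd \<kappa>' \<circ> param \<kappa>) has_derivative
      frechet_derivative (f \<circ> param \<kappa>') (at (snd \<kappa>' x)) \<circ> coord_change x \<kappa> \<kappa>') (at (snd \<kappa> x))"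
    by (rule diff_chain_at[OF tr(4)]) (use C1_function_differentiable[OF f assms(3)] p in simp)
  then have "((f \<circ> param \<kappa>) has_derivative
      frechet_derivative (f \<circ> param \<kappa>') (at (snd \<kappa>' x)) \<circ> coord_change x \<kappa> \<kappa>') (at (snd \<kappa> x))"
    by (rule has_derivative_transform_within_open[OF _ tr(1,2)])
      (use chart(5)[OF charts_atD(1)[OF assms(2)]] chart(5)[OF charts_atD(1)[OF assms(3)]] in auto)
  from has_derivative_unique[OF this C1_function_differentiable[OF f assms(2)]]
  show ?thesis using tangent_space_coord_change[OF assms(4,2,3)] by (simp add: fun_eq_iff)
qed

lemma
  assumes f: "C1_function M f"
  shows grad_in_tangent_space: "grad M f x \<in> TM x"
    and grad_eq: "\<And>u \<kappa>. u \<in> TM x \<Longrightarrow> \<kappa> \<in> charts_at M x \<Longrightarrow>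
      riem_metric M x (grad M f x) u = frechet_derivative (f \<circ> param \<kappa>) (at (snd \<kappa> x)) (u \<kappa>)"
proof -
  define is_grad where "is_grad = (\<lambda>v. v \<in> TM x \<and>
     (\<forall>u\<in>TM x. \<forall>\<kappa>\<in>charts_at M x.
        riem_metric M x v u = frechet_derivative (f \<circ> param \<kappa>) (at (snd \<kappa> x)) (u \<kappa>)))"
  obtain \<kappa> where \<kappa>: "\<kappa> \<in> charts_at M x" using ex_chart_at by blast
  note c = charts_atD[OF \<kappa>]
  interpret E: euclidean_metric "snd \<kappa> ` fst \<kappa>" "local_metric M \<kappa>" by (rule local_metric[OF c(1)])
  obtain z where z: "\<And>w. local_metric M \<kappa> (snd \<kappa> x) z w = frechet_derivative (f \<circ> param \<kappa>) (at (snd \<kappa> x)) w"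
    using E.riesz[OF c(3) has_derivative_linear[OF C1_function_differentiable[OF f \<kappa>]]] by blast
  have "is_grad (tangent_of M \<kappa> x z)"
    unfolding is_grad_def
  proof (intro conjI ballI)
    show "tangent_of M \<kappa> x z \<in> TM x" by (rule tangent_of_in_tangent_space[OF \<kappa>])
    fix u \<kappa>' assume u: "u \<in> TM x" and \<kappa>': "\<kappa>' \<in> charts_at M x"
    have "riem_metric M x (tangent_of M \<kappa> x z) u = local_metric M \<kappa> (snd \<kappa> x) z (u \<kappa>)"
      by (simp add: riem_metric_coords[OF \<kappa>] tangent_of_in_tangent_space[OF \<kappa>] u tangent_of_coord[OF \<kappa>])
    then show "riem_metric M x (tangent_of M \<kappa> x z) u =
        frechet_derivative (f \<circ> param \<kappa>') (at (snd \<kappa>' x)) (u \<kappa>')"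
      using differential_chart_independent[OF f \<kappa> \<kappa>' u] z by simp
  qed
  moreover have "v = w" if "is_grad v" "is_grad w" for v w
  proof -
    have T: "v \<in> TM x" "w \<in> TM x" using that by (auto simp: is_grad_def)
    have "riem_metric M x v (v - w) = riem_metric M x w (v - w)"
      using that \<kappa> tangent_space_diff[OF T] by (auto simp: is_grad_def)
    then have "v - w = (\<lambda>_. 0)"
      using T tangent_space_diff[OF T] riem_metric_diff_left[OF T tangent_space_diff[OF T]]
      by (intro riem_metric_eq_0) auto
    then show ?thesis by (auto simp: fun_eq_iff)
  qed
  ultimately have "\<exists>!v. is_grad v" by blast
  then have "is_grad (grad M f x)" unfolding grad_def is_grad_def by (rule theI')
  then show "grad M f x \<in> TM x"
    "\<And>u \<kappa>. u \<in> TM x \<Longrightarrow> \<kappa> \<in> charts_at M x \<Longrightarrow>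
      riem_metric M x (grad M f x) u = frechet_derivative (f \<circ> param \<kappa>) (at (snd \<kappa> x)) (u \<kappa>)"
    by (auto simp: is_grad_def)
qed

section \<open>Curves, parallel fields and geodesics\<close>

lemma curve_has_velocity:
  assumes c: "differentiable_curve M I c" and t: "t \<in> I" and \<kappa>: "\<kappa> \<in> charts_at M (c t)"
  shows "((snd \<kappa> \<circ> c) has_vector_derivative velocity M I c t \<kappa>) (at t within I)"
  using assms by (simp add: differentiable_curve_def velocity_def vector_derivative_works[symmetric])

lemma eventually_in_chart:
  assumes c: "continuous (at t within I) c" and \<kappa>: "\<kappa> \<in> charts_at M (c t)"
  shows "\<forall>\<^sub>F s in at t within I. s \<in> I \<and> \<kappa> \<in> charts_at M (c s)"
proof -
  have "\<forall>\<^sub>F s in at t within I. c s \<in> fst \<kappa>"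
    using c charts_atD[OF \<kappa>] chart(1) by (simp add: continuous_within topological_tendstoD)
  moreover have "\<forall>\<^sub>F s in at t within I. s \<in> I" by (simp add: eventually_at_filter)
  ultimately show ?thesis
    by eventually_elim (use charts_atD(1)[OF \<kappa>] in \<open>auto simp: charts_at_def\<close>)
qed

lemma differentiable_curve_continuous:
  "differentiable_curve M I c \<Longrightarrow> t \<in> I \<Longrightarrow> continuous (at t within I) c"
  by (auto simp: differentiable_curve_def continuous_on_eq_continuous_within)

lemma velocityI:
  assumes "\<kappa> \<in> charts_at M (c t)" "at t within I \<noteq> bot"
    "((snd \<kappa> \<circ> c) has_vector_derivative v) (at t within I)"
  shows "velocity M I c t \<kappa> = v"
  using assms by (simp add: velocity_def vector_derivative_within)

text \<open>In the chart around \<open>c t\<close> the product rule produces \<open>\<partial>g(V, W) - g(\<Gamma>(c', V), W) - g(V, \<Gamma>(c', W))\<close>, which is \<open>0\<close>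
  by compatibility of the connection with the metric.\<close>

lemma parallel_along_metric:
  assumes c: "differentiable_curve M I c"
    and V: "parallel_along M I c V" and W: "parallel_along M I c W" and t: "t \<in> I"
  shows "((\<lambda>s. riem_metric M (c s) (V s) (W s)) has_vector_derivative 0) (at t within I)"
proof -
  obtain \<kappa> where \<kappa>: "\<kappa> \<in> charts_at M (c t)" using ex_chart_at by blast
  note c\<kappa> = charts_atD[OF \<kappa>]
  interpret E: euclidean_metric "snd \<kappa> ` fst \<kappa>" "local_metric M \<kappa>" by (rule local_metric[OF c\<kappa>(1)])
  define p where "p = snd \<kappa> \<circ> c"
  define p' where "p' = velocity M I c t \<kappa>"
  have pt: "p t \<in> snd \<kappa> ` fst \<kappa>" using c\<kappa> by (simp add: p_def)
  have dp: "(p has_vector_derivative p') (at t within I)"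
    unfolding p_def p'_def by (rule curve_has_velocity[OF c t \<kappa>])
  have dV: "((\<lambda>s. V s \<kappa>) has_vector_derivative - E.christ (p t) p' (V t \<kappa>)) (at t within I)"
    and dW: "((\<lambda>s. W s \<kappa>) has_vector_derivative - E.christ (p t) p' (W t \<kappa>)) (at t within I)"
    using V W t \<kappa> by (auto simp: parallel_along_def p_def p'_def christoffel_eq[OF c\<kappa>(1), symmetric])
  have "((\<lambda>s. local_metric M \<kappa> (p s) (V s \<kappa>) (W s \<kappa>)) has_vector_derivative
     frechet_derivative (\<lambda>q. local_metric M \<kappa> q (V t \<kappa>) (W t \<kappa>)) (at (p t)) p'
      + local_metric M \<kappa> (p t) (- E.christ (p t) p' (V t \<kappa>)) (W t \<kappa>)
      + local_metric M \<kappa> (p t) (V t \<kappa>) (- E.christ (p t) p' (W t \<kappa>))) (at t within I)"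
    by (rule bilinear_family_chain[where g="local_metric M \<kappa>",
          OF E.open_U pt t E.bilinear E.differentiable[OF pt] dp dV dW])
  moreover have "frechet_derivative (\<lambda>q. local_metric M \<kappa> q (V t \<kappa>) (W t \<kappa>)) (at (p t)) p'
      + local_metric M \<kappa> (p t) (- E.christ (p t) p' (V t \<kappa>)) (W t \<kappa>)
      + local_metric M \<kappa> (p t) (V t \<kappa>) (- E.christ (p t) p' (W t \<kappa>)) = 0"
    using E.christ_metric[OF pt, of p' "V t \<kappa>" "W t \<kappa>"]
    by (simp add: linear_neg[OF E.linear_left[OF pt]] linear_neg[OF E.linear_right[OF pt]] E.dmetric_def)
  ultimately have d: "((\<lambda>s. local_metric M \<kappa> (p s) (V s \<kappa>) (W s \<kappa>)) has_vector_derivative 0) (at t within I)"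
    by simp
  have eq: "local_metric M \<kappa> (p s) (V s \<kappa>) (W s \<kappa>) = riem_metric M (c s) (V s) (W s)"
    if "s \<in> I \<and> \<kappa> \<in> charts_at M (c s)" for s
    using that V W riem_metric_coords[of \<kappa> "c s" "V s" "W s"] by (simp add: parallel_along_def p_def)
  have "\<forall>\<^sub>F s in at t within I.
     local_metric M \<kappa> (p s) (V s \<kappa>) (W s \<kappa>) = riem_metric M (c s) (V s) (W s)"
    using eventually_in_chart[OF differentiable_curve_continuous[OF c t] \<kappa>] by eventually_elim (rule eq)
  then show ?thesis
    using d eq[of t] t \<kappa> unfolding has_vector_derivative_def
    by (simp add: has_derivative_transform_eventually)
qed

lemma parallel_along_metric_const:
  assumes "differentiable_curve M I c" "parallel_along M I c V" "parallel_along M I c W"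
    and "convex I" "s \<in> I" "t \<in> I"
  shows "riem_metric M (c s) (V s) (W s) = riem_metric M (c t) (V t) (W t)"
  using has_vector_derivative_zero_constant[OF \<open>convex I\<close> parallel_along_metric[OF assms(1-3)]] assms(5,6)
  by metis

lemma parallel_along_diff:
  assumes c: "differentiable_curve M I c"
    and V: "parallel_along M I c V" and W: "parallel_along M I c W"
  shows "parallel_along M I c (\<lambda>t. V t - W t)"
  unfolding parallel_along_def
proof (intro ballI conjI)
  fix t assume t: "t \<in> I"
  show "V t - W t \<in> TM (c t)"
    using V W t by (auto simp: parallel_along_def tangent_space_diff)
  fix \<kappa> assume \<kappa>: "\<kappa> \<in> charts_at M (c t)"
  note c\<kappa> = charts_atD[OF \<kappa>]
  interpret E: euclidean_metric "snd \<kappa> ` fst \<kappa>" "local_metric M \<kappa>" by (rule local_metric[OF c\<kappa>(1)])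
  have lin: "linear (christoffel M \<kappa> (snd \<kappa> (c t)) u)" for u
    using E.christ_bilinear[OF c\<kappa>(3)] by (simp add: christoffel_eq[OF c\<kappa>(1)] bilinear_def)
  have "((\<lambda>s. V s \<kappa> - W s \<kappa>) has_vector_derivative
     - christoffel M \<kappa> (snd \<kappa> (c t)) (velocity M I c t \<kappa>) (V t \<kappa>) -
     - christoffel M \<kappa> (snd \<kappa> (c t)) (velocity M I c t \<kappa>) (W t \<kappa>)) (at t within I)"
    using V W t \<kappa> by (intro has_vector_derivative_diff) (auto simp: parallel_along_def)
  then show "((\<lambda>s. (V s - W s) \<kappa>) has_vector_derivative
       - christoffel M \<kappa> (snd \<kappa> (c t)) (velocity M I c t \<kappa>) ((V t - W t) \<kappa>)) (at t within I)"
    by (simp add: linear_diff[OF lin])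
qed

text \<open>The difference of two parallel fields is parallel, hence of constant length.\<close>

lemma parallel_along_unique:
  assumes c: "differentiable_curve M I c" "convex I"
    and V: "parallel_along M I c V" and W: "parallel_along M I c W"
    and "s \<in> I" "t \<in> I" "V s = W s"
  shows "V t = W t"
proof -
  have T: "V r - W r \<in> TM (c r)" if "r \<in> I" for r
    using that V W by (auto simp: parallel_along_def tangent_space_diff)
  have "V s - W s = tscale 0 (V s - W s)" using \<open>V s = W s\<close> by (simp add: tscale_def fun_eq_iff)
  then have "riem_metric M (c s) (V s - W s) (V s - W s) = 0"
    using riem_metric_scale_left[OF T[OF \<open>s \<in> I\<close>] T[OF \<open>s \<in> I\<close>], of 0] by simp
  then have "riem_metric M (c t) (V t - W t) (V t - W t) = 0"
    using parallel_along_metric_const[OF c(1) parallel_along_diff[OF c(1) V W]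
        parallel_along_diff[OF c(1) V W] c(2) \<open>s \<in> I\<close> \<open>t \<in> I\<close>] by simp
  then have "V t - W t = (\<lambda>_. 0)"
    by (rule riem_metric_eq_0[OF T[OF \<open>t \<in> I\<close>]])
  then show ?thesis by (auto simp: fun_eq_iff)
qed

lemma geodesic_velocity_in: "geodesic M I c \<Longrightarrow> t \<in> I \<Longrightarrow> velocity M I c t \<in> TM (c t)"
  by (simp add: geodesic_def parallel_along_def)

lemma geodesic_speed_const:
  assumes "geodesic M I c" "convex I" "s \<in> I" "t \<in> I"
  shows "tnorm M (c s) (velocity M I c s) = tnorm M (c t) (velocity M I c t)"
proof -
  have "differentiable_curve M I c" "parallel_along M I c (velocity M I c)"
    using assms(1) by (auto simp: geodesic_def)
  from parallel_along_metric_const[OF this this(2) assms(2-4)] show ?thesis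
    by (simp only: tnorm_def)
qed

lemma function_along_curve:
  assumes f: "C1_function M f" and c: "differentiable_curve M UNIV c"
    and v: "vel c t \<in> TM (c t)"
  shows "((\<lambda>s. f (c s)) has_real_derivative riem_metric M (c t) (grad M f (c t)) (vel c t)) (at t)"
proof -
  obtain \<kappa> where \<kappa>: "\<kappa> \<in> charts_at M (c t)" using ex_chart_at by blast
  let ?h = "(f \<circ> param \<kappa>) \<circ> (snd \<kappa> \<circ> c)"
  let ?D = "frechet_derivative (f \<circ> param \<kappa>) (at (snd \<kappa> (c t)))"
  have D: "(f \<circ> param \<kappa> has_derivative ?D) (at ((snd \<kappa> \<circ> c) t) within (snd \<kappa> \<circ> c) ` UNIV)"
    using has_derivative_at_withinI[OF C1_function_differentiable[OF f \<kappa>], of "(snd \<kappa> \<circ> c) ` UNIV"]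
    by (simp only: comp_apply[of "snd \<kappa>" c t])
  have "(?h has_vector_derivative ?D (vel c t \<kappa>)) (at t within UNIV)"
    by (rule vector_derivative_diff_chain_within[OF curve_has_velocity[OF c UNIV_I \<kappa>] D])
  moreover have "\<forall>\<^sub>F s in at t within UNIV. ?h s = f (c s)"
    using eventually_in_chart[OF differentiable_curve_continuous[OF c UNIV_I] \<kappa>]
    by eventually_elim (simp only: comp_apply charts_atD(4))
  moreover have "?h t = f (c t)" by (simp only: comp_apply charts_atD(4)[OF \<kappa>])
  ultimately have "((\<lambda>s. f (c s)) has_vector_derivative ?D (vel c t \<kappa>)) (at t)"
    unfolding has_vector_derivative_def by (rule has_derivative_transform_eventually[OF _ _ _ UNIV_I])
  then show ?thesis
    by (simp only: grad_eq[OF f v \<kappa>] has_real_derivative_iff_has_vector_derivative)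
qed

lemma affine_chain:
  fixes h :: "real \<Rightarrow> 'b::real_normed_vector"
  assumes "(h has_vector_derivative h') (at (a + b * t))"
  shows "((\<lambda>t. h (a + b * t)) has_vector_derivative b *\<^sub>R h') (at t)"
proof -
  have "((\<lambda>t. a + b * t) has_vector_derivative b) (at t)" by (auto intro!: derivative_eq_intros)
  from vector_diff_chain_at[OF this assms] show ?thesis by (simp add: o_def)
qed

lemma
  assumes c: "geodesic M UNIV c"
  shows geodesic_affine: "geodesic M UNIV (\<lambda>t. c (a + b * t))"
    and velocity_affine: "vel (\<lambda>t. c (a + b * t)) t = tscale b (vel c (a + b * t))"
proof -
  let ?c = "\<lambda>t. c (a + b * t)"
  have dc: "differentiable_curve M UNIV c" and pc: "parallel_along M UNIV c (vel c)"
    using c by (auto simp: geodesic_def)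
  have vel: "((snd \<kappa> \<circ> ?c) has_vector_derivative b *\<^sub>R vel c (a + b * t) \<kappa>) (at t)"
    if "\<kappa> \<in> charts_at M (?c t)" for \<kappa> t
    using affine_chain curve_has_velocity[OF dc UNIV_I that] by (force simp: o_def)
  have veq: "vel ?c t = tscale b (vel c (a + b * t))" for t
  proof
    fix \<kappa>
    show "vel ?c t \<kappa> = tscale b (vel c (a + b * t)) \<kappa>"
    proof (cases "\<kappa> \<in> charts_at M (?c t)")
      case True
      then show ?thesis using velocityI[of \<kappa> ?c t UNIV] vel[OF True] by (simp add: tscale_def)
    qed (simp add: velocity_def tscale_def)
  qed
  then show "vel ?c t = tscale b (vel c (a + b * t))" .
  have "continuous_on UNIV ?c"
    by (rule continuous_on_compose2[of UNIV c]) (use dc in \<open>auto simp: differentiable_curve_def intro!: continuous_intros\<close>)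
  then have "differentiable_curve M UNIV ?c"
    using vel by (auto simp: differentiable_curve_def intro!: differentiableI_vector)
  moreover have "parallel_along M UNIV ?c (vel ?c)"
    unfolding parallel_along_def
  proof (intro ballI conjI)
    fix t :: real
    show "vel ?c t \<in> TM (?c t)"
      using pc unfolding veq by (intro tangent_space_scale) (simp add: parallel_along_def)
    fix \<kappa> assume \<kappa>: "\<kappa> \<in> charts_at M (?c t)"
    note c\<kappa> = charts_atD[OF \<kappa>]
    interpret E: euclidean_metric "snd \<kappa> ` fst \<kappa>" "local_metric M \<kappa>" by (rule local_metric[OF c\<kappa>(1)])
    have lin: "bilinear (christoffel M \<kappa> (snd \<kappa> (?c t)))"
      using E.christ_bilinear[OF c\<kappa>(3)] by (simp add: christoffel_eq[OF c\<kappa>(1)])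
    let ?v = "vel c (a + b * t) \<kappa>"
    have "((\<lambda>s. vel c s \<kappa>) has_vector_derivative - christoffel M \<kappa> (snd \<kappa> (?c t)) ?v ?v)
        (at (a + b * t))"
      using pc \<kappa> by (auto simp: parallel_along_def)
    from has_vector_derivative_scaleR[OF DERIV_const[of b] affine_chain[OF this]]
    have "((\<lambda>s. b *\<^sub>R vel c (a + b * s) \<kappa>) has_vector_derivative
       b *\<^sub>R b *\<^sub>R - christoffel M \<kappa> (snd \<kappa> (?c t)) ?v ?v) (at t)"
      by simp
    then show "((\<lambda>s. vel ?c s \<kappa>) has_vector_derivative
        - christoffel M \<kappa> (snd \<kappa> (?c t)) (vel ?c t \<kappa>) (vel ?c t \<kappa>)) (at t)"
      by (simp add: veq tscale_def bilinear_lmul[OF lin] bilinear_rmul[OF lin])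
  qed
  ultimately show "geodesic M UNIV ?c" by (simp add: geodesic_def)
qed

text \<open>Velocities in an interval are one-sided at its end points; for a curve that is the restriction of a
  differentiable curve on \<open>\<real>\<close> this makes no difference.\<close>

lemma velocity_restrict:
  assumes c: "differentiable_curve M UNIV c" and "a < b" "t \<in> {a..b}"
    and e: "\<And>s. s \<in> {a..b} \<Longrightarrow> e s = c s"
  shows "velocity M {a..b} e t = vel c t"
    and "\<And>\<kappa>. \<kappa> \<in> charts_at M (c t) \<Longrightarrow>
      ((snd \<kappa> \<circ> e) has_vector_derivative vel c t \<kappa>) (at t within {a..b})"
proof -
  show d: "((snd \<kappa> \<circ> e) has_vector_derivative vel c t \<kappa>) (at t within {a..b})"
    if \<kappa>: "\<kappa> \<in> charts_at M (c t)" for \<kappa>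
    using has_vector_derivative_within_subset[OF curve_has_velocity[OF c UNIV_I \<kappa>], of "{a..b}"]
    by (rule has_vector_derivative_transform[rotated 2]) (use assms e in auto)
  show "velocity M {a..b} e t = vel c t"
  proof
    fix \<kappa>
    show "velocity M {a..b} e t \<kappa> = vel c t \<kappa>"
    proof (cases "\<kappa> \<in> charts_at M (c t)")
      case True
      then show ?thesis
        using assms e[OF assms(3)] by (intro velocityI d) (auto simp: trivial_limit_within islimpt_Icc)
    next
      case False
      then show ?thesis using e[OF assms(3)] by (simp add: velocity_def)
    qed
  qed
qed

lemma parallel_along_restrict:
  assumes c: "differentiable_curve M UNIV c" and V: "parallel_along M UNIV c V" and "a < b"
  shows "parallel_along M {a..b} c V"
  unfolding parallel_along_def
proof (intro ballI conjI)
  fix t assume t: "t \<in> {a..b}"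
  show "V t \<in> TM (c t)" using V by (simp add: parallel_along_def)
  fix \<kappa> assume \<kappa>: "\<kappa> \<in> charts_at M (c t)"
  have "((\<lambda>s. V s \<kappa>) has_vector_derivative
      - christoffel M \<kappa> (snd \<kappa> (c t)) (vel c t \<kappa>) (V t \<kappa>)) (at t within UNIV)"
    using V \<kappa> by (simp add: parallel_along_def)
  then show "((\<lambda>s. V s \<kappa>) has_vector_derivative
      - christoffel M \<kappa> (snd \<kappa> (c t)) (velocity M {a..b} c t \<kappa>) (V t \<kappa>)) (at t within {a..b})"
    unfolding velocity_restrict(1)[OF c \<open>a < b\<close> t refl]
    by (rule has_vector_derivative_within_subset) simp
qed

lemma differentiable_curve_restrict:
  assumes c: "differentiable_curve M UNIV c" and "a < b"
    and e: "\<And>s. s \<in> {a..b} \<Longrightarrow> e s = c s"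
  shows "differentiable_curve M {a..b} e"
  unfolding differentiable_curve_def
proof (intro conjI ballI)
  have "continuous_on {a..b} c" using c continuous_on_subset by (auto simp: differentiable_curve_def)
  then show "continuous_on {a..b} e" by (rule continuous_on_eq) (simp add: e)
  fix t \<kappa> assume t: "t \<in> {a..b}" and "\<kappa> \<in> charts_at M (e t)"
  then have "\<kappa> \<in> charts_at M (c t)" using e by simp
  then show "snd \<kappa> \<circ> e differentiable at t within {a..b}"
    using velocity_restrict(2)[OF c \<open>a < b\<close> t e] by (blast intro: differentiableI_vector)
qed

lemma geodesic_restrict:
  assumes c: "geodesic M UNIV c" and "a < b"
  shows "geodesic M {a..b} c"
proof -
  have dc: "differentiable_curve M UNIV c" and pc: "parallel_along M UNIV c (vel c)"
    using c by (auto simp: geodesic_def)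
  have "parallel_along M {a..b} c (vel c)"
    by (rule parallel_along_restrict[OF dc pc \<open>a < b\<close>])
  moreover have "parallel_along M {a..b} c (velocity M {a..b} c)" if "parallel_along M {a..b} c (vel c)"
    unfolding parallel_along_def
  proof (intro ballI conjI)
    fix t assume t: "t \<in> {a..b}"
    note eq = velocity_restrict(1)[OF dc \<open>a < b\<close>, of _ c]
    show "velocity M {a..b} c t \<in> TM (c t)"
      using that t by (simp add: eq parallel_along_def)
    fix \<kappa> assume \<kappa>: "\<kappa> \<in> charts_at M (c t)"
    have "((\<lambda>s. vel c s \<kappa>) has_vector_derivative
       - christoffel M \<kappa> (snd \<kappa> (c t)) (velocity M {a..b} c t \<kappa>) (velocity M {a..b} c t \<kappa>)) (at t within {a..b})"
      using that t \<kappa> by (auto simp: eq parallel_along_def)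
    then show "((\<lambda>s. velocity M {a..b} c s \<kappa>) has_vector_derivative
       - christoffel M \<kappa> (snd \<kappa> (c t)) (velocity M {a..b} c t \<kappa>) (velocity M {a..b} c t \<kappa>)) (at t within {a..b})"
      by (rule has_vector_derivative_transform[OF t, rotated]) (simp add: eq)
  qed
  ultimately show ?thesis
    using differentiable_curve_restrict[OF dc \<open>a < b\<close>] by (simp add: geodesic_def)
qed

end

section \<open>Short geodesics\<close>

context riemannian
begin

lemma geodesic_chart_derivatives:
  assumes c: "geodesic M UNIV c" and \<kappa>: "\<kappa> \<in> charts_at M (c t)"
  shows "((\<lambda>s. snd \<kappa> (c s)) has_vector_derivative vel c t \<kappa>) (at t within S)"
    and "((\<lambda>s. vel c s \<kappa>) has_vector_derivative
      - christoffel M \<kappa> (snd \<kappa> (c t)) (vel c t \<kappa>) (vel c t \<kappa>)) (at t within S)"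
proof -
  have dc: "differentiable_curve M UNIV c" and pc: "parallel_along M UNIV c (vel c)"
    using c by (auto simp: geodesic_def)
  show "((\<lambda>s. snd \<kappa> (c s)) has_vector_derivative vel c t \<kappa>) (at t within S)"
    using curve_has_velocity[OF dc UNIV_I \<kappa>] unfolding o_def by (rule has_vector_derivative_within_subset) simp
  have "((\<lambda>s. vel c s \<kappa>) has_vector_derivative
      - christoffel M \<kappa> (snd \<kappa> (c t)) (vel c t \<kappa>) (vel c t \<kappa>)) (at t within UNIV)"
    using pc \<kappa> by (simp add: parallel_along_def)
  then show "((\<lambda>s. vel c s \<kappa>) has_vector_derivative
      - christoffel M \<kappa> (snd \<kappa> (c t)) (vel c t \<kappa>) (vel c t \<kappa>)) (at t within S)"
    by (rule has_vector_derivative_within_subset) simp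
qed

text \<open>While the geodesic is in the ball of radius \<open>r\<close>, its constant Riemannian speed bounds its
  Euclidean speed by \<open>m < r\<close>.  At the first exit time it would therefore still be in the image
  of the compact ball of radius \<open>m\<close>.\<close>

lemma slow_geodesic_stays_in_chart:
  assumes c: "geodesic M UNIV c" and \<kappa>: "\<kappa> \<in> charts_at M (c 0)"
    and B: "cball (snd \<kappa> (c 0)) r \<subseteq> snd \<kappa> ` fst \<kappa>"
    and l: "l > 0" "\<And>p u. p \<in> cball (snd \<kappa> (c 0)) r \<Longrightarrow> l * (norm u)\<^sup>2 \<le> local_metric M \<kappa> p u u"
    and speed: "tnorm M (c 0) (vel c 0) \<le> sqrt l * m" and m: "0 < m" "m < r"
    and t: "t \<in> {0..1}"
  shows "\<kappa> \<in> charts_at M (c t) \<and> snd \<kappa> (c t) \<in> cball (snd \<kappa> (c 0)) r \<and> norm (vel c t \<kappa>) \<le> m"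
proof -
  note \<kappa>0 = charts_atD[OF \<kappa>]
  note at = chart[OF \<kappa>0(1)]
  define p where "p = (\<lambda>t. snd \<kappa> (c t))"
  define W where "W = fst \<kappa> \<inter> snd \<kappa> -` ball (p 0) r"
  have "open W" unfolding W_def by (rule continuous_open_preimage[OF at(3,1)]) simp
  have contc: "continuous_on UNIV c" using c by (simp add: geodesic_def differentiable_curve_def)
  have good: "\<kappa> \<in> charts_at M (c t)" "p t \<in> cball (p 0) r" "norm (vel c t \<kappa>) \<le> m"
    if "c t \<in> W" for t
  proof -
    show \<kappa>t: "\<kappa> \<in> charts_at M (c t)" using that \<kappa>0 by (auto simp: W_def charts_at_def)
    show pt: "p t \<in> cball (p 0) r" using that by (auto simp: W_def p_def)
    have T: "vel c t \<in> TM (c t)" by (rule geodesic_velocity_in[OF c UNIV_I])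
    have "l * (norm (vel c t \<kappa>))\<^sup>2 \<le> local_metric M \<kappa> (p t) (vel c t \<kappa>) (vel c t \<kappa>)"
      using pt by (intro l(2)) (simp add: p_def)
    also have "\<dots> = riem_metric M (c t) (vel c t) (vel c t)"
      by (simp add: riem_metric_coords[OF \<kappa>t T T] p_def)
    also have "\<dots> = (tnorm M (c t) (vel c t))\<^sup>2" by (rule tnorm_square[OF T, symmetric])
    also have "\<dots> \<le> (sqrt l * m)\<^sup>2"
      using speed geodesic_speed_const[OF c, of t 0] by (intro power_mono tnorm_nonneg[OF T]) auto
    also have "\<dots> = l * m\<^sup>2" using l(1) by (simp add: power_mult_distrib)
    finally have "(norm (vel c t \<kappa>))\<^sup>2 \<le> m\<^sup>2" using l(1) by simp
    then show "norm (vel c t \<kappa>) \<le> m" by (rule power2_le_imp_le) (use m in simp)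
  qed
  have "c 0 \<in> W" using \<kappa>0 m by (simp add: W_def p_def)
  have "c t \<in> W" if "t \<in> {0..1}" for t
  proof (rule ccontr)
    assume "c t \<notin> W"
    define E where "E = {0..1} \<inter> c -` (- W)"
    have "closed E" unfolding E_def
      using \<open>open W\<close> contc
      by (intro continuous_closed_preimage) (auto intro: continuous_on_subset)
    moreover have "E \<subseteq> {0..1}" by (auto simp: E_def)
    ultimately have "compact E" using compact_Icc[of "0::real" 1]
      by (metis compact_Int_closed inf.absorb_iff2 inf_commute)
    moreover have "E \<noteq> {}" using \<open>c t \<notin> W\<close> that by (auto simp: E_def)
    ultimately obtain \<tau> where \<tau>: "\<tau> \<in> E" "\<And>s. s \<in> E \<Longrightarrow> \<tau> \<le> s" using compact_attains_inf by metis
    have \<tau>01: "0 < \<tau>" "\<tau> \<le> 1" using \<tau>(1) \<open>c 0 \<in> W\<close> by (auto simp: E_def less_le)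
    have before: "c s \<in> W" if "0 \<le> s" "s < \<tau>" for s
      using \<tau>(2)[of s] that \<tau>01 by (auto simp: E_def)
    define K where "K = param \<kappa> ` cball (p 0) m"
    have sub: "cball (p 0) m \<subseteq> snd \<kappa> ` fst \<kappa>" using B m by (auto simp: p_def subset_eq)
    have "compact K" unfolding K_def
      by (intro compact_continuous_image continuous_on_subset[OF at(4) sub]) simp
    then have "closed K" by (rule compact_imp_closed)
    \<comment> \<open>Closedness of \<open>K\<close> in the manifold, which needs the Hausdorff property, carries this bound over to the exit time \<open>\<tau>\<close>.\<close>
    have "c s \<in> K" if s: "0 \<le> s" "s < \<tau>" for s
    proof -
      have "norm (p s - p 0) \<le> m * \<bar>s - 0\<bar>"
      proof (rule vector_derivative_bound[where S="{0..<\<tau>}"])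
        fix s assume "s \<in> {0..<\<tau>}"
        then have "c s \<in> W" using before by simp
        from good[OF this] show "norm (vel c s \<kappa>) \<le> m"
          and "(p has_vector_derivative vel c s \<kappa>) (at s within {0..<\<tau>})"
          unfolding p_def by (auto intro: geodesic_chart_derivatives(1)[OF c])
      qed (use s \<tau>01 in auto)
      also have "\<dots> \<le> m" using s \<tau>01 m by simp
      finally have "p s \<in> cball (p 0) m" by (simp add: dist_norm norm_minus_commute)
      moreover have "c s = param \<kappa> (p s)" using charts_atD(4)[OF good(1)[OF before[OF s]]] by (simp add: p_def)
      ultimately show ?thesis by (auto simp: K_def)
    qed
    then have "{0..<\<tau>} \<subseteq> c -` K" by auto
    moreover have "closed (c -` K)" using \<open>closed K\<close> contc by (simp add: continuous_closed_vimage continuous_on_eq_continuous_at)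
    ultimately have "closure {0..<\<tau>} \<subseteq> c -` K" by (rule closure_minimal)
    moreover have "\<tau> \<in> closure {0..<\<tau>}" using \<tau>01 by simp
    ultimately have "c \<tau> \<in> K" by blast
    moreover have "K \<subseteq> W"
    proof
      fix y assume "y \<in> K"
      then obtain q where q: "q \<in> cball (p 0) m" "y = param \<kappa> q" by (auto simp: K_def)
      then obtain z where z: "z \<in> fst \<kappa>" "q = snd \<kappa> z" using sub by auto
      then show "y \<in> W" using q m at(5) by (auto simp: W_def)
    qed
    ultimately show False using \<tau>(1) by (auto simp: E_def)
  qed
  from good[OF this[OF t]] show ?thesis by (simp add: p_def)
qed

text \<open>The data common to the arguments about short geodesics starting at \<open>x\<close>: a chart, a ball in
  it, bounds for the Christoffel symbols there, and a speed \<open>s\<close> below which geodesics starting at \<open>x\<close> do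
  not leave the ball within unit time.\<close>

lemma slow_geodesic_chart:
  obtains \<kappa> r C m s where "\<kappa> \<in> charts_at M x" "cball (snd \<kappa> x) r \<subseteq> snd \<kappa> ` fst \<kappa>"
    "C \<ge> 0" "m > 0" "s > 0" "C * (m\<^sup>2 + 2 * m) < 1 / 2"
    "\<And>p u v. p \<in> cball (snd \<kappa> x) r \<Longrightarrow> norm (christoffel M \<kappa> p u v) \<le> C * norm u * norm v"
    "\<And>p q u v. p \<in> cball (snd \<kappa> x) r \<Longrightarrow> q \<in> cball (snd \<kappa> x) r \<Longrightarrow>
       norm (christoffel M \<kappa> p u v - christoffel M \<kappa> q u v) \<le> C * norm (p - q) * norm u * norm v"
    "\<And>p. p \<in> cball (snd \<kappa> x) r \<Longrightarrow> bilinear (christoffel M \<kappa> p)"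
    "\<And>c t. geodesic M UNIV c \<Longrightarrow> c 0 = x \<Longrightarrow> tnorm M x (vel c 0) \<le> s \<Longrightarrow> t \<in> {0..1} \<Longrightarrow>
       \<kappa> \<in> charts_at M (c t) \<and> snd \<kappa> (c t) \<in> cball (snd \<kappa> x) r \<and> norm (vel c t \<kappa>) \<le> m"
proof -
  obtain \<kappa> where \<kappa>: "\<kappa> \<in> charts_at M x" using ex_chart_at by blast
  note c\<kappa> = charts_atD[OF \<kappa>]
  interpret E: euclidean_metric "snd \<kappa> ` fst \<kappa>" "local_metric M \<kappa>" by (rule local_metric[OF c\<kappa>(1)])
  obtain r where r: "r > 0" "cball (snd \<kappa> x) r \<subseteq> snd \<kappa> ` fst \<kappa>"
    using E.open_U c\<kappa>(3) open_contains_cball by blast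
  obtain l where l: "l > 0" "\<And>p u. p \<in> cball (snd \<kappa> x) r \<Longrightarrow> l * (norm u)\<^sup>2 \<le> local_metric M \<kappa> p u u"
    using E.metric_lower_bound[OF r(2)] by blast
  obtain C where C: "C \<ge> 0"
    "\<And>p u v. p \<in> cball (snd \<kappa> x) r \<Longrightarrow> norm (christoffel M \<kappa> p u v) \<le> C * norm u * norm v"
    "\<And>p q u v. p \<in> cball (snd \<kappa> x) r \<Longrightarrow> q \<in> cball (snd \<kappa> x) r \<Longrightarrow>
       norm (christoffel M \<kappa> p u v - christoffel M \<kappa> q u v) \<le> C * norm (p - q) * norm u * norm v"
    using E.christ_bounds[OF r(2)] unfolding christoffel_eq[OF c\<kappa>(1)] by blast
  \<comment> \<open>With \<open>m \<le> 1\<close>, the quantity \<open>C (m\<^sup>2 + 2 m)\<close> is at most \<open>3 C m \<le> 3/8\<close>.\<close>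
  define m where "m = min (r / 2) (1 / (8 * (C + 1)))"
  have m: "m > 0" "m < r" "m \<le> 1 / (8 * (C + 1))" using r C by (auto simp: m_def min_less_iff_disj)
  have "m \<le> 1" using m(3) C(1) by (smt (verit) divide_le_eq_1)
  have "m * m \<le> m" using \<open>m \<le> 1\<close> m(1) by (simp add: mult_left_le)
  then have "C * (m\<^sup>2 + 2 * m) \<le> C * (3 * m)"
    using C(1) by (intro mult_left_mono) (simp_all add: power2_eq_square)
  also have "\<dots> \<le> C * (3 * (1 / (8 * (C + 1))))" using m(3) C(1) by (intro mult_left_mono) auto
  also have "\<dots> < 1 / 2" using C(1) by (simp add: field_simps)
  finally have Cm: "C * (m\<^sup>2 + 2 * m) < 1 / 2" .
  have s: "sqrt l * m > 0" using l m by simp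
  have bil: "bilinear (christoffel M \<kappa> p)" if "p \<in> cball (snd \<kappa> x) r" for p
    unfolding christoffel_eq[OF c\<kappa>(1)] using that r(2) by (intro E.christ_bilinear) auto
  have "\<kappa> \<in> charts_at M (c t) \<and> snd \<kappa> (c t) \<in> cball (snd \<kappa> x) r \<and> norm (vel c t \<kappa>) \<le> m"
    if "geodesic M UNIV c" "c 0 = x" "tnorm M x (vel c 0) \<le> sqrt l * m" "t \<in> {0..1}" for c t
    using slow_geodesic_stays_in_chart[of c \<kappa> r l m t] that \<kappa> r l m(1,2) by simp
  from that[OF \<kappa> r(2) C(1) m(1) s Cm C(2,3) bil this] show ?thesis by blast
qed

text \<open>Short geodesics from \<open>x\<close> are determined by their end point, and also by their initial velocity.
  The bound \<open>s\<close> depends on \<open>x\<close> only.\<close>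

lemma short_geodesics_agree:
  "\<exists>s>0. \<forall>c1 c2. geodesic M UNIV c1 \<and> geodesic M UNIV c2 \<and> c1 0 = x \<and> c2 0 = x \<and>
      tnorm M x (vel c1 0) \<le> s \<and> tnorm M x (vel c2 0) \<le> s \<and>
      (c1 1 = c2 1 \<or> vel c1 0 = vel c2 0) \<longrightarrow>
      (\<forall>t\<in>{0..1}. c1 t = c2 t \<and> vel c1 t = vel c2 t)"
proof -
  obtain \<kappa> r C m s where \<kappa>: "\<kappa> \<in> charts_at M x"
    and C: "C \<ge> 0" "C * (m\<^sup>2 + 2 * m) < 1 / 2" and s: "s > 0"
    and chr: "\<And>p u v. p \<in> cball (snd \<kappa> x) r \<Longrightarrow> norm (christoffel M \<kappa> p u v) \<le> C * norm u * norm v"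
    "\<And>p q u v. p \<in> cball (snd \<kappa> x) r \<Longrightarrow> q \<in> cball (snd \<kappa> x) r \<Longrightarrow>
       norm (christoffel M \<kappa> p u v - christoffel M \<kappa> q u v) \<le> C * norm (p - q) * norm u * norm v"
    "\<And>p. p \<in> cball (snd \<kappa> x) r \<Longrightarrow> bilinear (christoffel M \<kappa> p)"
    and stay: "\<And>c t. geodesic M UNIV c \<Longrightarrow> c 0 = x \<Longrightarrow> tnorm M x (vel c 0) \<le> s \<Longrightarrow> t \<in> {0..1} \<Longrightarrow>
       \<kappa> \<in> charts_at M (c t) \<and> snd \<kappa> (c t) \<in> cball (snd \<kappa> x) r \<and> norm (vel c t \<kappa>) \<le> m"
    using slow_geodesic_chart[of x] by metis
  show ?thesis
  proof (rule exI[of _ s], rule conjI[OF s], intro allI impI ballI, elim conjE)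
    fix c1 c2 and t :: real
    assume c: "geodesic M UNIV c1" "geodesic M UNIV c2" "c1 0 = x" "c2 0 = x"
      "tnorm M x (vel c1 0) \<le> s" "tnorm M x (vel c2 0) \<le> s"
      and bc: "c1 1 = c2 1 \<or> vel c1 0 = vel c2 0" and t: "t \<in> {0..1}"
    have *: "\<kappa> \<in> charts_at M (c1 t)" "snd \<kappa> (c1 t) \<in> cball (snd \<kappa> x) r" "norm (vel c1 t \<kappa>) \<le> m"
      "\<kappa> \<in> charts_at M (c2 t)" "snd \<kappa> (c2 t) \<in> cball (snd \<kappa> x) r" "norm (vel c2 t \<kappa>) \<le> m"
      if "t \<in> {0..1}" for t
      using stay[OF c(1,3,5) that] stay[OF c(2,4,6) that] by auto
    have "snd \<kappa> (c1 t) = snd \<kappa> (c2 t) \<and> vel c1 t \<kappa> = vel c2 t \<kappa>"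
    proof (rule short_geodesics_unique[where \<Gamma>="christoffel M \<kappa>" and B="cball (snd \<kappa> x) r" and C=C and m=m
          and p="\<lambda>t. snd \<kappa> (c1 t)" and q="\<lambda>t. snd \<kappa> (c2 t)"
          and p'="\<lambda>t. vel c1 t \<kappa>" and q'="\<lambda>t. vel c2 t \<kappa>"])
      show "snd \<kappa> (c1 1) = snd \<kappa> (c2 1) \<or> vel c1 0 \<kappa> = vel c2 0 \<kappa>"
        using bc by auto
    qed (use * c(3,4) t C(2) in \<open>auto intro: chr C geodesic_chart_derivatives c\<close>)
    then have "snd \<kappa> (c1 t) = snd \<kappa> (c2 t)" and v: "vel c1 t \<kappa> = vel c2 t \<kappa>" by auto
    then have eq: "c1 t = c2 t"
      using charts_atD(4)[OF *(1)[OF t]] charts_atD(4)[OF *(4)[OF t]] by metis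
    have "vel c1 t = vel c2 t"
    proof (rule tangent_eqI[OF *(1)[OF t]])
      show "vel c1 t \<in> TM (c1 t)" by (rule geodesic_velocity_in[OF c(1) UNIV_I])
      show "vel c2 t \<in> TM (c1 t)" unfolding eq by (rule geodesic_velocity_in[OF c(2) UNIV_I])
    qed (rule v)
    with eq show "c1 t = c2 t \<and> vel c1 t = vel c2 t" by simp
  qed
qed

text \<open>To reach the time \<open>t\<close> near \<open>t0\<close>, run both geodesics from \<open>t0\<close> with speed scaled by \<open>b = t - t0\<close>, which may be
  negative, for unit time.\<close>

lemma geodesic_unique_near:
  assumes c: "geodesic M UNIV c1" "geodesic M UNIV c2"
    and eq: "c1 t0 = c2 t0" "vel c1 t0 = vel c2 t0"
  shows "\<exists>h>0. \<forall>t\<in>ball t0 h. c1 t = c2 t \<and> vel c1 t = vel c2 t"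
proof -
  obtain s where s: "s > 0" and agree: "\<And>d1 d2 t. \<lbrakk>geodesic M UNIV d1; geodesic M UNIV d2; d1 0 = c1 t0; d2 0 = c1 t0;
      tnorm M (c1 t0) (vel d1 0) \<le> s; tnorm M (c1 t0) (vel d2 0) \<le> s;
      vel d1 0 = vel d2 0; t \<in> {0..1}\<rbrakk> \<Longrightarrow> d1 t = d2 t \<and> vel d1 t = vel d2 t"
    using short_geodesics_agree[of "c1 t0"] by blast
  define \<sigma> where "\<sigma> = tnorm M (c1 t0) (vel c1 t0)"
  have T: "vel c1 t0 \<in> TM (c1 t0)" by (rule geodesic_velocity_in[OF c(1) UNIV_I])
  have \<sigma>: "\<sigma> \<ge> 0" unfolding \<sigma>_def by (rule tnorm_nonneg[OF T])
  define h where "h = s / (\<sigma> + 1)"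
  have h: "h > 0" "h * \<sigma> \<le> s" using s \<sigma> by (auto simp: h_def field_simps)
  have "c1 t = c2 t \<and> vel c1 t = vel c2 t" if t: "t \<in> ball t0 h" for t
  proof (cases "t = t0")
    case False
    define b where "b = t - t0"
    have b: "\<bar>b\<bar> \<le> h" "b \<noteq> 0" using t False by (auto simp: b_def dist_real_def)
    have "\<bar>b\<bar> * \<sigma> \<le> s" using mult_right_mono[OF b(1) \<sigma>] h(2) by simp
    then have speed: "tnorm M (c1 t0) (tscale b (vel c1 t0)) \<le> s"
      by (simp add: tnorm_scale[OF T] \<sigma>_def)
    have "c1 (t0 + b * 1) = c2 (t0 + b * 1) \<and>
        vel (\<lambda>t. c1 (t0 + b * t)) 1 = vel (\<lambda>t. c2 (t0 + b * t)) 1"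
      using speed eq
      by (intro agree geodesic_affine c) (simp_all add: velocity_affine[OF c(1)] velocity_affine[OF c(2)])
    then have "c1 t = c2 t" "tscale b (vel c1 t) = tscale b (vel c2 t)"
      by (simp_all add: velocity_affine[OF c(1)] velocity_affine[OF c(2)] b_def)
    then show ?thesis using b(2) by (auto simp: tscale_def fun_eq_iff)
  qed (use eq in simp)
  then show ?thesis using h(1) by blast
qed

text \<open>The set of times at which the two geodesics and their velocities agree is open by local
  uniqueness, closed by continuity and the Hausdorff property, and contains \<open>0\<close>.\<close>

lemma geodesic_unique:
  assumes c: "geodesic M UNIV c1" "geodesic M UNIV c2"
    and eq: "c1 0 = c2 0" "vel c1 0 = vel c2 0"
  shows "c1 = c2"
proof -
  define E where "E = {t. c1 t = c2 t \<and> vel c1 t = vel c2 t}"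
  have contc: "continuous_on UNIV c1" "continuous_on UNIV c2"
    using c by (auto simp: geodesic_def differentiable_curve_def)
  have "open E"
    unfolding open_contains_ball
  proof
    fix t assume "t \<in> E"
    then show "\<exists>e>0. ball t e \<subseteq> E"
      using geodesic_unique_near[OF c, of t] by (auto simp: E_def subset_eq)
  qed
  moreover have "open (- E)"
    unfolding open_subopen[of "- E"]
  proof
    fix t assume t: "t \<in> - E"
    show "\<exists>T. open T \<and> t \<in> T \<and> T \<subseteq> - E"
    proof (cases "c1 t = c2 t")
      case False
      have "open {s. c1 s \<noteq> c2 s}" by (rule open_Collect_neq[OF contc])
      then show ?thesis using False by (intro exI[of _ "{s. c1 s \<noteq> c2 s}"]) (auto simp: E_def)
    next
      case True
      obtain \<kappa> where \<kappa>: "\<kappa> \<in> charts_at M (c1 t)" using ex_chart_at by blast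
      then have \<kappa>2: "\<kappa> \<in> charts_at M (c2 t)" using True by simp
      define D where "D = (\<lambda>s. vel c1 s \<kappa> - vel c2 s \<kappa>)"
      have "D t \<noteq> 0"
        using t True tangent_eqI[OF \<kappa> geodesic_velocity_in[OF c(1) UNIV_I], of "vel c2 t"]
          geodesic_velocity_in[OF c(2) UNIV_I, of t] by (auto simp: E_def D_def)
      moreover have "isCont D t"
        unfolding D_def
        by (intro continuous_intros has_vector_derivative_continuous[OF geodesic_chart_derivatives(2)[OF c(1) \<kappa>]]
            has_vector_derivative_continuous[OF geodesic_chart_derivatives(2)[OF c(2) \<kappa>2]])
      ultimately have "\<forall>\<^sub>F s in nhds t. D s \<in> - {0}"
        by (intro topological_tendstoD) (auto simp: continuous_at tendsto_at_iff_tendsto_nhds)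
      then obtain T where "open T" "t \<in> T" "\<And>s. s \<in> T \<Longrightarrow> D s \<noteq> 0"
        unfolding eventually_nhds by auto
      moreover have "s \<in> - E" if "D s \<noteq> 0" for s using that by (auto simp: E_def D_def)
      ultimately show ?thesis by (intro exI[of _ T]) blast
    qed
  qed
  ultimately have "closed E \<and> open E" by (simp add: open_closed)
  then have "E = {} \<or> E = UNIV" using clopen by blast
  moreover have "0 \<in> E" using eq by (simp add: E_def)
  ultimately show ?thesis by (auto simp: E_def fun_eq_iff)
qed

lemma exp_map_geodesic:
  assumes "geodesic M UNIV c"
  shows "exp_map M (c 0) (vel c 0) = c 1"
  unfolding exp_map_def
proof (rule the_equality)
  show "\<exists>e. geodesic M UNIV e \<and> e 0 = c 0 \<and> vel e 0 = vel c 0 \<and> e 1 = c 1"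
    using assms by blast
  show "y = c 1" if "\<exists>e. geodesic M UNIV e \<and> e 0 = c 0 \<and> vel e 0 = vel c 0 \<and> e 1 = y" for y
    using that geodesic_unique[OF _ assms] by blast
qed

section \<open>Change of charts and parallel transport\<close>

definition hessian_change :: "('a, 'e) chart \<Rightarrow> ('a, 'e) chart \<Rightarrow> 'e \<Rightarrow> 'e \<Rightarrow> 'e \<Rightarrow> 'e" where
  "hessian_change \<kappa> \<kappa>' p u v =
     frechet_derivative (\<lambda>q. frechet_derivative (snd \<kappa>' \<circ> param \<kappa>) (at q) v) (at p) u"

text \<open>The second derivative of the coordinate change from \<open>\<kappa>\<close> to \<open>\<kappa>'\<close>, the inhomogeneous term in the
  transformation law of the Christoffel symbols.','definition\<close>

lemma hessian_change:
  assumes "\<kappa> \<in> charts_at M x" "\<kappa>' \<in> charts_at M x"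
  shows "hessian_change \<kappa> \<kappa>' (snd \<kappa> x) u v = hessian_change \<kappa> \<kappa>' (snd \<kappa> x) v u"
    and "linear (\<lambda>v. hessian_change \<kappa> \<kappa>' (snd \<kappa> x) u v)"
    and "linear (\<lambda>u. hessian_change \<kappa> \<kappa>' (snd \<kappa> x) u v)"
proof -
  note tr = transition[OF assms]
  have diff: "(\<lambda>q. frechet_derivative (snd \<kappa>' \<circ> param \<kappa>) (at q) v) differentiable (at (snd \<kappa> x))" for v
    by (rule smooth_on_imp_differentiable[OF smooth_on_derivative[OF tr(3)] tr(2)])
  show "hessian_change \<kappa> \<kappa>' (snd \<kappa> x) u v = hessian_change \<kappa> \<kappa>' (snd \<kappa> x) v u"
    unfolding hessian_change_def by (rule second_derivative_symmetric[OF tr(3,1,2)])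
  show "linear (\<lambda>v. hessian_change \<kappa> \<kappa>' (snd \<kappa> x) u v)"
    unfolding hessian_change_def
    by (rule linear_family_derivative[OF tr(1,2) linear_frechet_derivative[OF smooth_on_imp_differentiable[OF tr(3)]] diff])
  show "linear (\<lambda>u. hessian_change \<kappa> \<kappa>' (snd \<kappa> x) u v)"
    unfolding hessian_change_def by (rule linear_frechet_derivative[OF diff])
qed

lemma coord_change_along_curve:
  assumes \<kappa>: "\<kappa> \<in> charts_at M (c t)" "\<kappa>' \<in> charts_at M (c t)" and t: "t \<in> I"
    and c: "((\<lambda>s. snd \<kappa> (c s)) has_vector_derivative p') (at t within I)"
    and Y: "(Y has_vector_derivative Y') (at t within I)"
  shows "((\<lambda>s. coord_change (c s) \<kappa> \<kappa>' (Y s)) has_vector_derivative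
     hessian_change \<kappa> \<kappa>' (snd \<kappa> (c t)) p' (Y t) + coord_change (c t) \<kappa> \<kappa>' Y') (at t within I)"
proof -
  note tr = transition[OF \<kappa>]
  have diff: "(\<lambda>q. frechet_derivative (snd \<kappa>' \<circ> param \<kappa>) (at q) v) differentiable (at (snd \<kappa> (c t)))" for v
    by (rule smooth_on_imp_differentiable[OF smooth_on_derivative[OF tr(3)] tr(2)])
  show ?thesis
    unfolding hessian_change_def coord_change_def
    by (rule linear_family_chain[where A="\<lambda>q. frechet_derivative (snd \<kappa>' \<circ> param \<kappa>) (at q)"
          and p="\<lambda>s. snd \<kappa> (c s)", OF tr(1,2) t
          linear_frechet_derivative[OF smooth_on_imp_differentiable[OF tr(3)]] diff c Y])
qed

end

locale complete_riemannian = riemannian M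
  for M :: "('a::{t2_space, second_countable_topology}, 'e::euclidean_space) riem" +
  assumes complete: "geodesically_complete M"
begin

lemma ex_geodesic:
  assumes "v \<in> TM x"
  obtains c where "geodesic M UNIV c" "c 0 = x" "vel c 0 = v" "c 1 = exp_map M x v"
  using complete assms exp_map_geodesic unfolding geodesically_complete_def by metis

text \<open>Take the geodesic with initial coordinates \<open>x\<close>, \<open>u\<close> and differentiate the coordinates of its velocity in
  the chart \<open>\<kappa>'\<close> in two ways: by the geodesic equation in \<open>\<kappa>'\<close>, and as the coordinate change of the
  coordinates in \<open>\<kappa>\<close>, using the geodesic equation in \<open>\<kappa>\<close>.\<close>

lemma christoffel_change_quadratic:
  assumes \<kappa>: "\<kappa> \<in> charts_at M x" "\<kappa>' \<in> charts_at M x"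
  shows "hessian_change \<kappa> \<kappa>' (snd \<kappa> x) u u - coord_change x \<kappa> \<kappa>' (christoffel M \<kappa> (snd \<kappa> x) u u) =
     - christoffel M \<kappa>' (snd \<kappa>' x) (coord_change x \<kappa> \<kappa>' u) (coord_change x \<kappa> \<kappa>' u)"
proof -
  define v where "v = tangent_of M \<kappa> x u"
  have v: "v \<in> TM x" "v \<kappa> = u"
    unfolding v_def by (rule tangent_of_in_tangent_space[OF \<kappa>(1)], rule tangent_of_coord[OF \<kappa>(1)])
  have v': "v \<kappa>' = coord_change x \<kappa> \<kappa>' u"
    using tangent_space_coord_change[OF v(1) \<kappa>] v(2) by simp
  obtain c where c: "geodesic M UNIV c" "c 0 = x" "vel c 0 = v"
    using ex_geodesic[OF v(1)] by metis
  have \<kappa>c: "\<kappa> \<in> charts_at M (c 0)" "\<kappa>' \<in> charts_at M (c 0)" using \<kappa> c by auto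
  have d1: "((\<lambda>s. vel c s \<kappa>') has_vector_derivative
     - christoffel M \<kappa>' (snd \<kappa>' x) (coord_change x \<kappa> \<kappa>' u) (coord_change x \<kappa> \<kappa>' u)) (at 0)"
    using geodesic_chart_derivatives(2)[OF c(1) \<kappa>c(2), of UNIV] by (simp add: c v')
  have "((\<lambda>s. coord_change (c s) \<kappa> \<kappa>' (vel c s \<kappa>)) has_vector_derivative
     hessian_change \<kappa> \<kappa>' (snd \<kappa> x) u u + coord_change x \<kappa> \<kappa>' (- christoffel M \<kappa> (snd \<kappa> x) u u)) (at 0)"
    using coord_change_along_curve[OF \<kappa>c UNIV_I geodesic_chart_derivatives[OF c(1) \<kappa>c(1)]]
    by (simp add: c v(2))
  moreover have dc: "continuous (at 0 within UNIV) c"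
    using c(1) by (intro differentiable_curve_continuous) (auto simp: geodesic_def)
  have "\<forall>\<^sub>F s in at 0 within UNIV. coord_change (c s) \<kappa> \<kappa>' (vel c s \<kappa>) = vel c s \<kappa>'"
    using eventually_in_chart[OF dc \<kappa>c(1)] eventually_in_chart[OF dc \<kappa>c(2)]
  proof eventually_elim
    case (elim s)
    then show ?case
      using tangent_space_coord_change[OF geodesic_velocity_in[OF c(1) UNIV_I]] by metis
  qed
  moreover have "coord_change (c 0) \<kappa> \<kappa>' (vel c 0 \<kappa>) = vel c 0 \<kappa>'"
    by (simp add: c v v')
  ultimately have "((\<lambda>s. vel c s \<kappa>') has_vector_derivative
     hessian_change \<kappa> \<kappa>' (snd \<kappa> x) u u + coord_change x \<kappa> \<kappa>' (- christoffel M \<kappa> (snd \<kappa> x) u u)) (at 0)"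
    unfolding has_vector_derivative_def by (rule has_derivative_transform_eventually[OF _ _ _ UNIV_I])
  from vector_derivative_unique_at[OF this d1] show ?thesis
    by (simp add: linear_neg[OF transition(5)[OF \<kappa>]])
qed

text \<open>Polarization of the quadratic law; symmetry of the second derivative of the coordinate change
  is essential here.\<close>

lemma christoffel_change:
  assumes \<kappa>: "\<kappa> \<in> charts_at M x" "\<kappa>' \<in> charts_at M x"
  shows "hessian_change \<kappa> \<kappa>' (snd \<kappa> x) u v - coord_change x \<kappa> \<kappa>' (christoffel M \<kappa> (snd \<kappa> x) u v) =
     - christoffel M \<kappa>' (snd \<kappa>' x) (coord_change x \<kappa> \<kappa>' u) (coord_change x \<kappa> \<kappa>' v)"
proof -
  note a = charts_atD[OF \<kappa>(1)] and a' = charts_atD[OF \<kappa>(2)]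
  interpret E: euclidean_metric "snd \<kappa> ` fst \<kappa>" "local_metric M \<kappa>" by (rule local_metric[OF a(1)])
  interpret E': euclidean_metric "snd \<kappa>' ` fst \<kappa>'" "local_metric M \<kappa>'" by (rule local_metric[OF a'(1)])
  define D where "D = coord_change x \<kappa> \<kappa>'"
  have D: "linear D" unfolding D_def by (rule transition(5)[OF \<kappa>])
  define T where "T = (\<lambda>u v. hessian_change \<kappa> \<kappa>' (snd \<kappa> x) u v - D (E.christ (snd \<kappa> x) u v)
      + E'.christ (snd \<kappa>' x) (D u) (D v))"
  note bil = E.christ_bilinear[OF a(3)] E'.christ_bilinear[OF a'(3)]
  note lin = linear_add[OF D] linear_add[OF hessian_change(2)[OF \<kappa>]] linear_add[OF hessian_change(3)[OF \<kappa>]]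
    bilinear_ladd[OF bil(1)] bilinear_radd[OF bil(1)] bilinear_ladd[OF bil(2)] bilinear_radd[OF bil(2)]
  have diag: "T u u = 0" for u
    using christoffel_change_quadratic[OF \<kappa>, of u]
    by (simp add: T_def D_def christoffel_eq[OF a(1)] christoffel_eq[OF a'(1)])
  have sym: "T u v = T v u" for u v
    using hessian_change(1)[OF \<kappa>, of u v] E.christ_sym[OF a(3), of u v] E'.christ_sym[OF a'(3), of "D u" "D v"]
    by (simp add: T_def)
  have "T (u + v) (u + v) = (T u u + T v v) + (T u v + T v u)"
    unfolding T_def lin by (simp add: algebra_simps)
  then have "T u v + T u v = 0" using diag sym[of v u] by simp
  then have "T u v = 0" by (metis mult_2 add_cancel_left_left double_zero_sym scaleR_2 scaleR_eq_0_iff zero_neq_numeral)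
  then show ?thesis
    by (simp add: T_def D_def christoffel_eq[OF a(1)] christoffel_eq[OF a'(1)] add_eq_0_iff2)
qed

text \<open>Solve the linear equation \<open>Y' = - \<Gamma>(c', Y)\<close> in the chart around \<open>x\<close>.  For slow geodesics its
  coefficients are small enough for one Picard step, and the transformation law turns the
  solution into a field that is parallel in all charts.\<close>

lemma parallel_field_exists:
  "\<exists>s>0. \<forall>c v. geodesic M UNIV c \<and> c 0 = x \<and> tnorm M x (vel c 0) \<le> s \<and> v \<in> TM x \<longrightarrow>
     (\<exists>V. parallel_along M {0..1} c V \<and> V 0 = v)"
proof -
  obtain \<kappa> r C m s where \<kappa>: "\<kappa> \<in> charts_at M x" and r: "cball (snd \<kappa> x) r \<subseteq> snd \<kappa> ` fst \<kappa>"
    and C: "C \<ge> 0" "C * (m\<^sup>2 + 2 * m) < 1 / 2" and m: "m > 0" and s: "s > 0"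
    and chr: "\<And>p u v. p \<in> cball (snd \<kappa> x) r \<Longrightarrow> norm (christoffel M \<kappa> p u v) \<le> C * norm u * norm v"
    "\<And>p. p \<in> cball (snd \<kappa> x) r \<Longrightarrow> bilinear (christoffel M \<kappa> p)"
    and stay: "\<And>c t. geodesic M UNIV c \<Longrightarrow> c 0 = x \<Longrightarrow> tnorm M x (vel c 0) \<le> s \<Longrightarrow> t \<in> {0..1} \<Longrightarrow>
       \<kappa> \<in> charts_at M (c t) \<and> snd \<kappa> (c t) \<in> cball (snd \<kappa> x) r \<and> norm (vel c t \<kappa>) \<le> m"
    using slow_geodesic_chart[of x] by metis
  note a = charts_atD[OF \<kappa>]
  interpret E: euclidean_metric "snd \<kappa> ` fst \<kappa>" "local_metric M \<kappa>" by (rule local_metric[OF a(1)])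
  show ?thesis
  proof (intro exI[of _ s] conjI s allI impI, elim conjE)
    fix c v assume c: "geodesic M UNIV c" "c 0 = x" "tnorm M x (vel c 0) \<le> s"
      and v: "v \<in> TM x"
    have *: "\<kappa> \<in> charts_at M (c t)" "snd \<kappa> (c t) \<in> cball (snd \<kappa> x) r" "norm (vel c t \<kappa>) \<le> m"
      if "t \<in> {0..1}" for t using stay[OF c that] by auto
    have dc: "differentiable_curve M UNIV c" using c(1) by (simp add: geodesic_def)
    have d: "((\<lambda>s. snd \<kappa> (c s)) has_vector_derivative vel c t \<kappa>) (at t within {0..1})"
      "((\<lambda>s. vel c s \<kappa>) has_vector_derivative
         - christoffel M \<kappa> (snd \<kappa> (c t)) (vel c t \<kappa>) (vel c t \<kappa>)) (at t within {0..1})"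
      if "t \<in> {0..1}" for t using geodesic_chart_derivatives[OF c(1) *(1)[OF that]] by auto
    have cont: "continuous_on {0..1} (\<lambda>s. snd \<kappa> (c s))" "continuous_on {0..1} (\<lambda>s. vel c s \<kappa>)"
      unfolding continuous_on_eq_continuous_within
      using has_vector_derivative_continuous[OF d(1)] has_vector_derivative_continuous[OF d(2)] by blast+
    define A where "A = (\<lambda>t y. - christoffel M \<kappa> (snd \<kappa> (c t)) (vel c t \<kappa>) y)"
    have "\<exists>Y. Y 0 = v \<kappa> \<and> (\<forall>t\<in>{0..1}. (Y has_vector_derivative A t (Y t)) (at t within {0..1}))"
    proof (rule linear_ode_exists)
      fix t :: real assume t: "t \<in> {0..1}"
      show "linear (A t)" unfolding A_def
        using chr(2)[OF *(2)[OF t]] by (intro linear_compose_neg) (simp add: bilinear_def)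
      fix y
      have "C * m \<le> 1 / 2" using C m by (smt (verit, best) distrib_left mult_nonneg_nonneg zero_le_power2)
      have "norm (A t y) \<le> C * norm (vel c t \<kappa>) * norm y"
        unfolding A_def using chr(1)[OF *(2)[OF t]] by simp
      also have "\<dots> \<le> C * m * norm y"
        using C(1) *(3)[OF t] by (intro mult_right_mono mult_left_mono) auto
      also have "\<dots> \<le> 1 / 2 * norm y" using \<open>C * m \<le> 1 / 2\<close> by (intro mult_right_mono) auto
      finally show "norm (A t y) \<le> 1 / 2 * norm y" .
    next
      fix Y :: "real \<Rightarrow> 'e" assume "continuous_on {0..1} Y"
      then show "continuous_on {0..1} (\<lambda>t. A t (Y t))"
        unfolding A_def christoffel_eq[OF a(1)] using * cont
        by (intro continuous_on_minus E.continuous_on_christ[OF r]) auto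
    qed
    then obtain Y where Y0: "Y 0 = v \<kappa>"
      and Y: "\<And>t. t \<in> {0..1} \<Longrightarrow> (Y has_vector_derivative A t (Y t)) (at t within {0..1})" by blast
    define V where "V = (\<lambda>t. tangent_of M \<kappa> (c t) (Y t))"
    have "parallel_along M {0..1} c V"
      unfolding parallel_along_def
    proof (intro ballI conjI)
      fix t :: real assume t: "t \<in> {0..1}"
      show "V t \<in> TM (c t)" unfolding V_def by (rule tangent_of_in_tangent_space[OF *(1)[OF t]])
      fix \<kappa>' assume \<kappa>': "\<kappa>' \<in> charts_at M (c t)"
      have vel: "velocity M {0..1} c t = vel c t"
        by (rule velocity_restrict(1)[OF dc _ t]) auto
      have vel': "vel c t \<kappa>' = coord_change (c t) \<kappa> \<kappa>' (vel c t \<kappa>)"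
        by (rule tangent_space_coord_change[OF geodesic_velocity_in[OF c(1) UNIV_I] *(1)[OF t] \<kappa>'])
      have V': "V t \<kappa>' = coord_change (c t) \<kappa> \<kappa>' (Y t)" using \<kappa>' by (simp add: V_def tangent_of_def)
      have "((\<lambda>s. coord_change (c s) \<kappa> \<kappa>' (Y s)) has_vector_derivative
        hessian_change \<kappa> \<kappa>' (snd \<kappa> (c t)) (vel c t \<kappa>) (Y t) + coord_change (c t) \<kappa> \<kappa>' (A t (Y t)))
        (at t within {0..1})"
        by (rule coord_change_along_curve[OF *(1)[OF t] \<kappa>' t d(1)[OF t] Y[OF t]])
      also have "hessian_change \<kappa> \<kappa>' (snd \<kappa> (c t)) (vel c t \<kappa>) (Y t) + coord_change (c t) \<kappa> \<kappa>' (A t (Y t))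
         = - christoffel M \<kappa>' (snd \<kappa>' (c t)) (velocity M {0..1} c t \<kappa>') (V t \<kappa>')"
        using christoffel_change[OF *(1)[OF t] \<kappa>', of "vel c t \<kappa>" "Y t"]
        by (simp add: A_def vel vel' V' linear_neg[OF transition(5)[OF *(1)[OF t] \<kappa>']])
      finally have der: "((\<lambda>s. coord_change (c s) \<kappa> \<kappa>' (Y s)) has_vector_derivative
         - christoffel M \<kappa>' (snd \<kappa>' (c t)) (velocity M {0..1} c t \<kappa>') (V t \<kappa>')) (at t within {0..1})" .
      have "continuous (at t within {0..1}) c"
        using differentiable_curve_continuous[OF dc UNIV_I] continuous_within_subset by blast
      from eventually_in_chart[OF this \<kappa>']
      have "\<forall>\<^sub>F s in at t within {0..1}. coord_change (c s) \<kappa> \<kappa>' (Y s) = V s \<kappa>'"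
        by eventually_elim (simp add: V_def tangent_of_def)
      with der show "((\<lambda>s. V s \<kappa>') has_vector_derivative
         - christoffel M \<kappa>' (snd \<kappa>' (c t)) (velocity M {0..1} c t \<kappa>') (V t \<kappa>')) (at t within {0..1})"
        unfolding has_vector_derivative_def
        by (rule has_derivative_transform_eventually[OF _ _ _ t]) (rule V'[symmetric])
    qed
    moreover have "V 0 = v" unfolding V_def using c(2) Y0 tangent_of_coords[OF \<kappa> v] by simp
    ultimately show "\<exists>V. parallel_along M {0..1} c V \<and> V 0 = v" by blast
  qed
qed

end

section \<open>Lengths and distances\<close>

context riemannian
begin

lemma velocity_in_tangent_space:
  assumes cont: "continuous (at t within I) c" and t: "t \<in> I" "at t within I \<noteq> bot"
    and diff: "\<And>\<kappa>. \<kappa> \<in> charts_at M (c t) \<Longrightarrow> (snd \<kappa> \<circ> c) differentiable (at t within I)"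
  shows "velocity M I c t \<in> TM (c t)"
proof (rule tangent_spaceI)
  fix \<kappa> \<kappa>' assume \<kappa>: "\<kappa> \<in> charts_at M (c t)" "\<kappa>' \<in> charts_at M (c t)"
  have der: "((snd \<kappa> \<circ> c) has_vector_derivative velocity M I c t \<kappa>) (at t within I)"
    using diff[OF \<kappa>(1)] \<kappa> by (simp add: velocity_def vector_derivative_works[symmetric])
  note tr = transition[OF \<kappa>]
  have D: "((snd \<kappa>' \<circ> param \<kappa>) has_derivative coord_change (c t) \<kappa> \<kappa>') (at ((snd \<kappa> \<circ> c) t) within (snd \<kappa> \<circ> c) ` I)"
    using has_derivative_at_withinI[OF tr(4)] by (simp only: comp_apply[of "snd \<kappa>" c t])
  have "((snd \<kappa>' \<circ> param \<kappa>) \<circ> (snd \<kappa> \<circ> c) has_vector_derivative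
      coord_change (c t) \<kappa> \<kappa>' (velocity M I c t \<kappa>)) (at t within I)"
    by (rule vector_derivative_diff_chain_within[OF der D])
  moreover have "\<forall>\<^sub>F s in at t within I. ((snd \<kappa>' \<circ> param \<kappa>) \<circ> (snd \<kappa> \<circ> c)) s = (snd \<kappa>' \<circ> c) s"
    using eventually_in_chart[OF cont \<kappa>(1)] by eventually_elim (simp only: comp_apply charts_atD(4))
  moreover have "((snd \<kappa>' \<circ> param \<kappa>) \<circ> (snd \<kappa> \<circ> c)) t = (snd \<kappa>' \<circ> c) t"
    by (simp only: comp_apply charts_atD(4)[OF \<kappa>(1)])
  ultimately have "((snd \<kappa>' \<circ> c) has_vector_derivative
      coord_change (c t) \<kappa> \<kappa>' (velocity M I c t \<kappa>)) (at t within I)"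
    unfolding has_vector_derivative_def by (rule has_derivative_transform_eventually[OF _ _ _ t(1)])
  then show "velocity M I c t \<kappa>' = coord_change (c t) \<kappa> \<kappa>' (velocity M I c t \<kappa>)"
    by (rule velocityI[where c=c and t=t and I=I, OF \<kappa>(2) t(2)])
qed (simp add: velocity_def)

text \<open>Off the finitely many break points the velocity is a tangent vector, whose norm is
  nonnegative.  At the break points the integrand is arbitrary.\<close>

lemma curve_length_nonneg:
  assumes "piecewise_C1_curve M 0 1 c"
  shows "curve_length M 0 1 c \<ge> 0"
proof -
  obtain k :: nat and s :: "nat \<Rightarrow> real" where s: "s 0 = 0" "s k = 1"
    "\<And>i. i < k \<Longrightarrow> s i < s (Suc i)" "\<And>i. i < k \<Longrightarrow> C1_curve M (s i) (s (Suc i)) c"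
    using assms unfolding piecewise_C1_curve_def by metis
  have mono: "s i \<le> s j" if "i \<le> j" "j \<le> k" for i j
    using that
  proof (induction j rule: dec_induct)
    case (step n)
    then show ?case using s(3)[of n] by simp
  qed simp
  define g where "g = (\<lambda>t. if t \<in> s ` {..k} then 0 else tnorm M (c t) (velocity M {0..1} c t))"
  have "g t \<ge> 0" if t: "t \<in> {0..1}" for t
  proof (cases "t \<in> s ` {..k}")
    case False
    have "t < s k" using t s(2) False by (metis atLeastAtMost_iff atMost_iff imageI le_refl less_eq_real_def)
    define j where "j = (LEAST j. t < s j)"
    have j: "t < s j" "j \<le> k" unfolding j_def using \<open>t < s k\<close> by (auto intro: LeastI Least_le)
    have "j \<noteq> 0" using j(1) s(1) t by (intro notI) simp
    then obtain i where i: "j = Suc i" by (cases j) auto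
    have "\<not> t < s i" using not_less_Least[of i "\<lambda>j. t < s j"] i by (simp add: j_def)
    moreover have "t \<noteq> s i" using False i j(2) by auto
    ultimately have ti: "s i < t" "t < s (Suc i)" using j(1) i by auto
    have "i < k" using i j(2) by simp
    then have C1: "differentiable_curve M {s i..s (Suc i)} c" using s(4) by (simp add: C1_curve_def)
    have "0 \<le> s i" "s (Suc i) \<le> 1" using mono[of 0 i] mono[of "Suc i" k] s(1,2) \<open>i < k\<close> by auto
    then have t01: "0 < t" "t < 1" using ti by auto
    have at: "at t within {s i..s (Suc i)} = at t" "at t within {0..1} = at t"
      using ti t01 by (auto intro: at_within_Icc_at)
    have "velocity M {0..1} c t \<in> TM (c t)"
    proof (rule velocity_in_tangent_space)
      show "continuous (at t within {0..1}) c"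
        using differentiable_curve_continuous[OF C1, of t] ti at by simp
      show "(snd \<kappa> \<circ> c) differentiable (at t within {0..1})" if "\<kappa> \<in> charts_at M (c t)" for \<kappa>
        using C1 that ti unfolding differentiable_curve_def at by (auto simp: at[symmetric])
    qed (use t at in auto)
    then show ?thesis using False by (simp add: g_def tnorm_nonneg)
  qed (simp add: g_def)
  then have "integral {0..1} g \<ge> 0"
    by (cases "g integrable_on {0..1}") (auto intro: integral_nonneg simp: not_integrable_integral)
  also have "integral {0..1} g = curve_length M 0 1 c"
    unfolding curve_length_def
    by (rule integral_spike[of "s ` {..k}"]) (auto simp: g_def intro: negligible_finite)
  finally show ?thesis .
qed

lemma rdist_le_curve_length:
  assumes "piecewise_C1_curve M 0 1 c"
  shows "rdist M (c 0) (c 1) \<le> curve_length M 0 1 c"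
  unfolding rdist_def
proof (rule cInf_lower)
  show "bdd_below {curve_length M 0 1 e |e. piecewise_C1_curve M 0 1 e \<and> e 0 = c 0 \<and> e 1 = c 1}"
    using curve_length_nonneg by (auto intro!: bdd_belowI[of _ 0])
qed (use assms in blast)

lemma geodesic_piece_C1:
  assumes c: "geodesic M UNIV c" and "a < b" and e: "\<And>s. s \<in> {a..b} \<Longrightarrow> e s = c s"
  shows "C1_curve M a b e"
  unfolding C1_curve_def
proof (intro conjI ballI)
  have dc: "differentiable_curve M UNIV c" using c by (simp add: geodesic_def)
  show "differentiable_curve M {a..b} e" by (rule differentiable_curve_restrict[OF dc \<open>a < b\<close> e])
  fix \<kappa> assume \<kappa>: "\<kappa> \<in> atlas M"
  have "continuous_on {t \<in> {a..b}. e t \<in> fst \<kappa>} (\<lambda>t. vel c t \<kappa>)"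
    unfolding continuous_on_eq_continuous_within
  proof
    fix t assume "t \<in> {t \<in> {a..b}. e t \<in> fst \<kappa>}"
    then have "\<kappa> \<in> charts_at M (c t)" using \<kappa> e by (auto simp: charts_at_def)
    from has_vector_derivative_continuous[OF geodesic_chart_derivatives(2)[OF c this]]
    show "continuous (at t within {t \<in> {a..b}. e t \<in> fst \<kappa>}) (\<lambda>t. vel c t \<kappa>)" .
  qed
  then show "continuous_on {t \<in> {a..b}. e t \<in> fst \<kappa>} (\<lambda>t. velocity M {a..b} e t \<kappa>)"
  proof (rule continuous_on_eq)
    fix t assume t: "t \<in> {t \<in> {a..b}. e t \<in> fst \<kappa>}"
    have "velocity M {a..b} e t = vel c t"
      using t e by (intro velocity_restrict(1)[OF dc \<open>a < b\<close>]) auto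
    then show "vel c t \<kappa> = velocity M {a..b} e t \<kappa>" by simp
  qed
qed

lemma velocity_cong_open:
  assumes c: "geodesic M UNIV c" and S: "open S" "t \<in> S" "\<And>s. s \<in> S \<Longrightarrow> e s = c s"
    and t: "0 < t" "t < 1"
  shows "velocity M {0..1} e t = vel c t"
proof
  fix \<kappa>
  have et: "e t = c t" by (rule S(3)[OF S(2)])
  have dc: "differentiable_curve M UNIV c" using c by (simp add: geodesic_def)
  have at: "at t within {0..1} = at t" using t by (intro at_within_Icc_at) auto
  show "velocity M {0..1} e t \<kappa> = vel c t \<kappa>"
  proof (cases "\<kappa> \<in> charts_at M (c t)")
    case True
    have "((snd \<kappa> \<circ> e) has_vector_derivative vel c t \<kappa>) (at t)"
      by (rule has_vector_derivative_transform_within_open[OF curve_has_velocity[OF dc UNIV_I True] S(1,2)])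
        (simp add: S(3))
    then show ?thesis using True at et by (intro velocityI) auto
  qed (simp add: velocity_def et)
qed

text \<open>Run \<open>c1\<close> backwards and then \<open>c2\<close>, each at double speed.  Applied to geodesics issuing from a common
  point, this replaces both the symmetry and the triangle inequality of the distance.\<close>

lemma rdist_broken_geodesic:
  assumes c: "geodesic M UNIV c1" "geodesic M UNIV c2" and start: "c1 0 = c2 0"
  shows "rdist M (c1 1) (c2 1) \<le> tnorm M (c1 0) (vel c1 0) + tnorm M (c2 0) (vel c2 0)"
proof -
  define d1 where "d1 = (\<lambda>t. c1 (1 + (-2) * t))"
  define d2 where "d2 = (\<lambda>t. c2 (-1 + 2 * t))"
  have d: "geodesic M UNIV d1" "geodesic M UNIV d2"
    unfolding d1_def d2_def by (rule geodesic_affine[OF c(1)], rule geodesic_affine[OF c(2)])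
  define e where "e = (\<lambda>t. if t \<le> 1/2 then d1 t else d2 t)"
  have e2: "e t = d2 t" if "1/2 \<le> t" for t
  proof (cases "t = 1/2")
    case True
    show ?thesis unfolding True using start by (simp add: e_def d1_def d2_def)
  qed (use that in \<open>simp add: e_def\<close>)
  have "C1_curve M 0 (1/2) e" by (rule geodesic_piece_C1[OF d(1)]) (auto simp: e_def)
  moreover have "C1_curve M (1/2) 1 e" by (rule geodesic_piece_C1[OF d(2)]) (auto simp: e2)
  ultimately have "piecewise_C1_curve M 0 1 e"
    unfolding piecewise_C1_curve_def
    by (intro exI[of _ 2] exI[of _ "\<lambda>i. real i / 2"]) (auto simp: less_2_cases_iff)
  then have "rdist M (e 0) (e 1) \<le> curve_length M 0 1 e" by (rule rdist_le_curve_length)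
  moreover have "e 0 = c1 1" "e 1 = c2 1" by (auto simp: e_def d1_def d2_def)
  moreover have "curve_length M 0 1 e = tnorm M (c1 0) (vel c1 0) + tnorm M (c2 0) (vel c2 0)"
  proof -
    let ?l1 = "tnorm M (c1 0) (vel c1 0)" and ?l2 = "tnorm M (c2 0) (vel c2 0)"
    let ?f = "\<lambda>t. tnorm M (e t) (velocity M {0..1} e t)"
    have f1: "?f t = 2 * ?l1" if "t \<in> {0<..<1/2}" for t
    proof -
      have "velocity M {0..1} e t = vel d1 t"
        by (rule velocity_cong_open[OF d(1), of "{0<..<1/2}"]) (use that in \<open>auto simp: e_def\<close>)
      also have "\<dots> = tscale (-2) (vel c1 (1 + (-2) * t))"
        unfolding d1_def by (rule velocity_affine[OF c(1)])
      finally have "?f t = tnorm M (c1 (1 + (-2) * t)) (tscale (-2) (vel c1 (1 + (-2) * t)))"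
        using that by (simp add: e_def d1_def)
      also have "\<dots> = 2 * tnorm M (c1 (1 + (-2) * t)) (vel c1 (1 + (-2) * t))"
        by (simp add: tnorm_scale[OF geodesic_velocity_in[OF c(1) UNIV_I]])
      also have "tnorm M (c1 (1 + (-2) * t)) (vel c1 (1 + (-2) * t)) = ?l1"
        by (rule geodesic_speed_const[OF c(1)]) auto
      finally show ?thesis .
    qed
    have f2: "?f t = 2 * ?l2" if "t \<in> {1/2<..<1}" for t
    proof -
      have "velocity M {0..1} e t = vel d2 t"
        by (rule velocity_cong_open[OF d(2), of "{1/2<..<1}"]) (use that in \<open>auto simp: e2\<close>)
      also have "\<dots> = tscale 2 (vel c2 (-1 + 2 * t))"
        unfolding d2_def by (rule velocity_affine[OF c(2)])
      finally have "?f t = tnorm M (c2 (-1 + 2 * t)) (tscale 2 (vel c2 (-1 + 2 * t)))"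
        using that by (simp add: e2 d2_def)
      also have "\<dots> = 2 * tnorm M (c2 (-1 + 2 * t)) (vel c2 (-1 + 2 * t))"
        by (simp add: tnorm_scale[OF geodesic_velocity_in[OF c(2) UNIV_I]])
      also have "tnorm M (c2 (-1 + 2 * t)) (vel c2 (-1 + 2 * t)) = ?l2"
        by (rule geodesic_speed_const[OF c(2)]) auto
      finally show ?thesis .
    qed
    have "(?f has_integral (1/2 - 0) *\<^sub>R (2 * ?l1)) {0..1/2}"
      by (rule has_integral_spike_finite[of "{0, 1/2}", OF _ _ has_integral_const_real[of "2 * ?l1" 0 "1/2", simplified content_real]])
        (use f1 in auto)
    moreover have "(?f has_integral (1 - 1/2) *\<^sub>R (2 * ?l2)) {1/2..1}"
      by (rule has_integral_spike_finite[of "{1/2, 1}", OF _ _ has_integral_const_real[of "2 * ?l2" "1/2" 1, simplified content_real]])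
        (use f2 in auto)
    ultimately have "(?f has_integral (1/2 - 0) *\<^sub>R (2 * ?l1) + (1 - 1/2) *\<^sub>R (2 * ?l2)) {0..1}"
      by (rule has_integral_combine[rotated 2]) auto
    then show ?thesis unfolding curve_length_def by (simp add: integral_unique)
  qed
  ultimately show ?thesis by simp
qed

lemma rdist_le_geodesic_speed:
  assumes c: "geodesic M UNIV c"
  shows "rdist M (c 0) (c 1) \<le> tnorm M (c 0) (vel c 0)"
proof -
  have T: "vel c 0 \<in> TM (c 0)" by (rule geodesic_velocity_in[OF c UNIV_I])
  have "vel (\<lambda>t. c (0 + 0 * t)) 0 = tscale 0 (vel c (0 + 0 * 0))"
    by (rule velocity_affine[OF c])
  then show ?thesis
    using rdist_broken_geodesic[OF geodesic_affine[OF c, of 0 0] c] tnorm_scale[OF T, of 0] by simp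
qed

lemma geodesic_length:
  assumes c: "geodesic M UNIV c"
  shows "curve_length M 0 1 c = tnorm M (c 0) (vel c 0)"
proof -
  have "tnorm M (c t) (velocity M {0..1} c t) = tnorm M (c 0) (vel c 0)" if "t \<in> {0..1}" for t
    using velocity_restrict(1)[of c 0 1 t c] geodesic_speed_const[OF c, of t 0] that c
    by (simp add: geodesic_def)
  then have "curve_length M 0 1 c = integral {0..1::real} (\<lambda>t. tnorm M (c 0) (vel c 0))"
    unfolding curve_length_def by (rule Henstock_Kurzweil_Integration.integral_cong)
  then show ?thesis by simp
qed

end

context complete_riemannian
begin

lemma rdist_two_steps:
  assumes u: "u \<in> TM x" and v: "v \<in> TM (exp_map M x u)"
  shows "rdist M (exp_map M (exp_map M x u) v) x \<le> tnorm M (exp_map M x u) v + tnorm M x u"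
proof -
  obtain c where c: "geodesic M UNIV c" "c 0 = x" "vel c 0 = u" "c 1 = exp_map M x u"
    using ex_geodesic[OF u] by metis
  obtain e where e: "geodesic M UNIV e" "e 0 = exp_map M x u" "vel e 0 = v"
     "e 1 = exp_map M (exp_map M x u) v"
    using ex_geodesic[OF v] by metis
  define d where "d = (\<lambda>t. c (1 + (-1) * t))"
  have d: "geodesic M UNIV d" unfolding d_def by (rule geodesic_affine[OF c(1)])
  have vd: "vel d 0 = tscale (-1) (vel c (1 + (-1) * 0))"
    unfolding d_def by (rule velocity_affine[OF c(1)])
  have "tnorm M (d 0) (vel d 0) = tnorm M (c 1) (vel c 1)"
    using tnorm_scale[OF geodesic_velocity_in[OF c(1) UNIV_I], of 1 "-1"] by (simp add: vd) (simp add: d_def)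
  also have "\<dots> = tnorm M x u" using geodesic_speed_const[OF c(1), of 1 0] c by simp
  finally show ?thesis
    using rdist_broken_geodesic[OF e(1) d] e c by (simp add: d_def)
qed

lemma minimising_geodesic_exists:
  assumes lg: "log_map M lg"
  obtains c where "geodesic M UNIV c" "c 0 = x" "c 1 = y" "minimising_geodesic M x y c"
    "tnorm M x (vel c 0) = rdist M x y"
proof -
  have l: "lg x y \<in> TM x" "exp_map M x (lg x y) = y" "tnorm M x (lg x y) = rdist M x y"
    using lg by (auto simp: log_map_def)
  obtain c where c: "geodesic M UNIV c" "c 0 = x" "vel c 0 = lg x y" "c 1 = exp_map M x (lg x y)"
    using ex_geodesic[OF l(1)] by metis
  have "minimising_geodesic M x y c"
    unfolding minimising_geodesic_def
    using geodesic_restrict[OF c(1), of 0 1] geodesic_length[OF c(1)] c l by simp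
  then show thesis using that c l by simp
qed

lemma parallel_transport_eq:
  assumes c: "differentiable_curve M {a..b} c" and "a \<le> b" and V: "parallel_along M {a..b} c V"
  shows "parallel_transport M c a b (V a) = V b"
  unfolding parallel_transport_def
proof (rule the_equality)
  show "\<exists>W. parallel_along M {a..b} c W \<and> W a = V a \<and> W b = V b" using V by blast
  show "w = V b" if "\<exists>W. parallel_along M {a..b} c W \<and> W a = V a \<and> W b = w" for w
    using that parallel_along_unique[OF c _ _ V, of _ a b] \<open>a \<le> b\<close> by auto
qed

section \<open>The descent inequality\<close>

text \<open>Compare the geodesic \<open>\<gamma>\<close>, the piece of \<open>c\<close> from \<open>x = c t0\<close> to \<open>y = c t\<close>, with the minimising geodesic \<open>\<sigma>\<close>
  from \<open>x\<close> to \<open>y\<close>.  Both are short, so they agree, and the Lipschitz condition applies to \<open>\<sigma>\<close>.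
  Parallel transport preserves inner products and carries \<open>\<sigma>' 0\<close> to \<open>\<sigma>' 1\<close>, so the change of
  \<open>\<langle>grad f, c'\<rangle>\<close> is \<open>\<langle>P grad f x - grad f y, c'\<rangle>\<close>, to be estimated by Cauchy-Schwarz.\<close>

lemma gradient_along_geodesic_locally_lipschitz:
  assumes lg: "log_map M lg" and f: "C1_function M f" and L: "lipschitz_gradient M L f" "L \<ge> 0"
    and c: "geodesic M UNIV c"
  defines "h \<equiv> \<lambda>t. riem_metric M (c t) (grad M f (c t)) (vel c t)"
    and "l \<equiv> tnorm M (c 0) (vel c 0)"
  shows "\<exists>\<delta>>0. \<forall>t. \<bar>t - t0\<bar> < \<delta> \<longrightarrow> \<bar>h t - h t0\<bar> \<le> L * l\<^sup>2 * \<bar>t - t0\<bar>"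
proof -
  define x where "x = c t0"
  obtain s1 where s1: "s1 > 0" and agree: "\<And>d1 d2 t. \<lbrakk>geodesic M UNIV d1; geodesic M UNIV d2; d1 0 = x; d2 0 = x;
      tnorm M x (vel d1 0) \<le> s1; tnorm M x (vel d2 0) \<le> s1;
      d1 1 = d2 1; t \<in> {0..1}\<rbrakk> \<Longrightarrow> d1 t = d2 t \<and> vel d1 t = vel d2 t"
    using short_geodesics_agree[of x] by blast
  obtain s2 where s2: "s2 > 0" and par: "\<And>d v. \<lbrakk>geodesic M UNIV d; d 0 = x;
      tnorm M x (vel d 0) \<le> s2; v \<in> TM x\<rbrakk> \<Longrightarrow>
     \<exists>V. parallel_along M {0..1} d V \<and> V 0 = v"
    using parallel_field_exists[of x] by blast
  define s where "s = min s1 s2"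
  have s: "s > 0" "s \<le> s1" "s \<le> s2" using s1 s2 by (auto simp: s_def)
  have Tc: "vel c t \<in> TM (c t)" for t by (rule geodesic_velocity_in[OF c UNIV_I])
  have l: "l \<ge> 0" unfolding l_def by (rule tnorm_nonneg[OF Tc])
  define \<delta> where "\<delta> = s / (l + 1)"
  have \<delta>: "\<delta> > 0" "\<delta> * l \<le> s" using s l by (auto simp: \<delta>_def field_simps)
  have "\<bar>h t - h t0\<bar> \<le> L * l\<^sup>2 * \<bar>t - t0\<bar>" if t: "\<bar>t - t0\<bar> < \<delta>" for t
  proof (cases "t = t0")
    case False
    define b where "b = t - t0"
    have b: "b \<noteq> 0" "\<bar>b\<bar> \<le> \<delta>" using False t by (auto simp: b_def)
    define \<gamma> where "\<gamma> = (\<lambda>r. c (t0 + b * r))"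
    have \<gamma>: "geodesic M UNIV \<gamma>" unfolding \<gamma>_def by (rule geodesic_affine[OF c])
    have v\<gamma>: "vel \<gamma> r = tscale b (vel c (t0 + b * r))" for r
      unfolding \<gamma>_def by (rule velocity_affine[OF c])
    define y where "y = c t"
    have ends: "\<gamma> 0 = x" "\<gamma> 1 = y" by (auto simp: \<gamma>_def x_def y_def b_def)
    have speed: "tnorm M x (vel \<gamma> 0) = \<bar>b\<bar> * l"
      using tnorm_scale[OF Tc[of t0], of b] geodesic_speed_const[OF c, of t0 0]
      by (simp add: v\<gamma> x_def l_def)
    have bl: "\<bar>b\<bar> * l \<le> s" using mult_right_mono[OF b(2) l] \<delta>(2) by linarith
    have dist: "rdist M x y \<le> \<bar>b\<bar> * l" using rdist_le_geodesic_speed[OF \<gamma>] by (simp add: ends speed)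
    obtain \<sigma> where \<sigma>: "geodesic M UNIV \<sigma>" "\<sigma> 0 = x" "\<sigma> 1 = y" "minimising_geodesic M x y \<sigma>"
       "tnorm M x (vel \<sigma> 0) = rdist M x y"
      using minimising_geodesic_exists[OF lg] by metis
    have d0: "rdist M x y \<ge> 0"
      using tnorm_nonneg[OF geodesic_velocity_in[OF \<sigma>(1) UNIV_I], of 0] \<sigma> by simp
    have same: "vel \<sigma> r = vel \<gamma> r" if "r \<in> {0..1}" for r
      using agree[OF \<sigma>(1) \<gamma> \<sigma>(2) ends(1)] \<sigma>(3,5) ends(2) speed bl dist s that by auto
    have Ty: "grad M f y \<in> TM y" and Tx: "grad M f x \<in> TM x"
      by (rule grad_in_tangent_space[OF f])+
    obtain V where V: "parallel_along M {0..1} \<sigma> V" "V 0 = grad M f x"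
      using par[OF \<sigma>(1,2) _ Tx] \<sigma>(5) dist bl s by auto
    have g01: "geodesic M {0..1} \<sigma>" by (rule geodesic_restrict[OF \<sigma>(1)]) simp
    then have d01: "differentiable_curve M {0..1} \<sigma>" and p01: "parallel_along M {0..1} \<sigma> (velocity M {0..1} \<sigma>)"
      by (auto simp: geodesic_def)
    have vel: "velocity M {0..1} \<sigma> r = vel \<gamma> r" if "r \<in> {0..1}" for r
      using velocity_restrict(1)[of \<sigma> 0 1 r \<sigma>] same[OF that] that \<sigma>(1) by (simp add: geodesic_def)
    have V1: "V 1 \<in> TM y" using V(1) \<sigma>(3) by (auto simp: parallel_along_def)
    have "parallel_transport M \<sigma> 0 1 (grad M f x) = V 1"
      using parallel_transport_eq[OF d01 _ V(1)] V(2) by simp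
    moreover have "tnorm M y (parallel_transport M \<sigma> 0 1 (grad M f x) - grad M f y) \<le> L * rdist M x y"
      using L(1) \<sigma>(4) unfolding lipschitz_gradient_def by blast
    ultimately have lip: "tnorm M y (V 1 - grad M f y) \<le> L * rdist M x y" by simp
    have T\<gamma>: "vel \<gamma> 1 \<in> TM y" "vel \<gamma> 0 \<in> TM x"
      using geodesic_velocity_in[OF \<gamma> UNIV_I] ends by metis+
    have "riem_metric M y (V 1) (vel \<gamma> 1) = riem_metric M x (grad M f x) (vel \<gamma> 0)"
      using parallel_along_metric_const[OF d01 V(1) p01, of 1 0] V(2) \<sigma>(2,3) by (simp add: vel)
    also have "\<dots> = b * h t0"
      unfolding v\<gamma> using riem_metric_scale_right[OF Tx, of "vel c t0" b] Tc[of t0]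
      by (simp add: h_def x_def)
    finally have e0: "riem_metric M y (V 1) (vel \<gamma> 1) = b * h t0" .
    have e1: "riem_metric M y (grad M f y) (vel \<gamma> 1) = b * h t"
      unfolding v\<gamma> using riem_metric_scale_right[OF Ty, of "vel c t" b] Tc[of t]
      by (simp add: h_def y_def b_def)
    have sp1: "tnorm M y (vel \<gamma> 1) = \<bar>b\<bar> * l"
      using geodesic_speed_const[OF \<gamma>, of 1 0] speed ends by simp
    have "\<bar>b\<bar> * \<bar>h t - h t0\<bar> = \<bar>riem_metric M y (V 1 - grad M f y) (vel \<gamma> 1)\<bar>"
      unfolding riem_metric_diff_left[OF V1 Ty T\<gamma>(1)] e0 e1
      by (simp add: abs_mult[symmetric] algebra_simps abs_minus_commute)
    also have "\<dots> \<le> tnorm M y (V 1 - grad M f y) * (\<bar>b\<bar> * l)"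
      using riem_metric_Cauchy_Schwarz[OF tangent_space_diff[OF V1 Ty] T\<gamma>(1)] by (simp add: sp1)
    also have "\<dots> \<le> (L * (\<bar>b\<bar> * l)) * (\<bar>b\<bar> * l)"
      using lip mult_left_mono[OF dist L(2)] l by (intro mult_right_mono) auto
    also have "\<dots> = \<bar>b\<bar> * (L * l\<^sup>2 * \<bar>b\<bar>)" by (simp add: power2_eq_square)
    finally show ?thesis using b(1) by (simp add: b_def)
  qed simp
  then show ?thesis using \<delta>(1) by blast
qed

lemma gradient_along_geodesic_lipschitz:
  assumes lg: "log_map M lg" and f: "C1_function M f" and L: "lipschitz_gradient M L f" "L \<ge> 0"
    and c: "geodesic M UNIV c" and "a \<le> b"
  defines "h \<equiv> \<lambda>t. riem_metric M (c t) (grad M f (c t)) (vel c t)"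
    and "l \<equiv> tnorm M (c 0) (vel c 0)"
  shows "\<bar>h b - h a\<bar> \<le> L * l\<^sup>2 * (b - a)"
  using \<open>a \<le> b\<close>
proof (induction rule: Bolzano)
  case (trans a b c)
  then show ?case by (simp add: algebra_simps)
next
  case (local x)
  obtain \<delta> where \<delta>: "\<delta> > 0" "\<And>t. \<bar>t - x\<bar> < \<delta> \<Longrightarrow> \<bar>h t - h x\<bar> \<le> L * l\<^sup>2 * \<bar>t - x\<bar>"
    using gradient_along_geodesic_locally_lipschitz[OF lg f L c, of x] unfolding h_def l_def by blast
  have "\<bar>h b - h a\<bar> \<le> L * l\<^sup>2 * (b - a)" if "a \<le> x" "x \<le> b" "b - a < \<delta>" for a b
  proof -
    have "\<bar>h b - h x\<bar> \<le> L * l\<^sup>2 * (b - x)" "\<bar>h a - h x\<bar> \<le> L * l\<^sup>2 * (x - a)"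
      using \<delta>(2)[of b] \<delta>(2)[of a] that by auto
    moreover have "L * l\<^sup>2 * (b - a) = L * l\<^sup>2 * (b - x) + L * l\<^sup>2 * (x - a)" by (simp add: algebra_simps)
    ultimately show ?thesis by linarith
  qed
  then show ?case using \<delta>(1) by blast
qed

text \<open>Integrate the Lipschitz bound for the derivative of \<open>f\<close> along the geodesic with initial
  velocity \<open>v\<close>.\<close>

lemma descent_inequality:
  assumes lg: "log_map M lg" and f: "C1_function M f" and L: "lipschitz_gradient M L f" "L \<ge> 0"
    and v: "v \<in> TM x"
  shows "f (exp_map M x v) \<le> f x + riem_metric M x (grad M f x) v + L / 2 * (tnorm M x v)\<^sup>2"
proof -
  obtain c where c: "geodesic M UNIV c" "c 0 = x" "vel c 0 = v" "c 1 = exp_map M x v"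
    using ex_geodesic[OF v] by metis
  define h where "h = (\<lambda>t. riem_metric M (c t) (grad M f (c t)) (vel c t))"
  define K where "K = L * (tnorm M x v)\<^sup>2"
  have h: "h t - h 0 \<le> K * t" if "t \<ge> 0" for t
    using gradient_along_geodesic_lipschitz[OF lg f L c(1) that] c by (simp add: h_def K_def)
  define \<psi> where "\<psi> = (\<lambda>t. f (c t) - h 0 * t - K * t\<^sup>2 / 2)"
  have "\<psi> 1 \<le> \<psi> 0"
  proof (rule DERIV_nonpos_imp_nonincreasing[where f=\<psi>])
    fix t :: real assume t: "0 \<le> t"
    have "((\<lambda>s. f (c s)) has_real_derivative h t) (at t)"
      unfolding h_def using c(1)
      by (intro function_along_curve[OF f] geodesic_velocity_in) (auto simp: geodesic_def)
    then have "(\<psi> has_real_derivative h t - h 0 - K * t) (at t)"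
      unfolding \<psi>_def by (auto intro!: derivative_eq_intros)
    then show "\<exists>y. (\<psi> has_real_derivative y) (at t) \<and> y \<le> 0" using h[OF t] by force
  qed simp
  then show ?thesis using c by (simp add: \<psi>_def h_def K_def)
qed

end

section \<open>The series argument\<close>

text \<open>Young's inequality with the weight for which the factor of \<open>a\<^sup>2\<close>, a priori larger than \<open>\<mu>\<^sup>2\<close>, is the
  midpoint of \<open>\<mu>\<^sup>2\<close> and \<open>1\<close>; the difference of the two sides is then a square.\<close>

lemma weighted_square_of_sum:
  fixes a b :: real
  assumes "0 < \<mu>" "\<mu> < 1"
  shows "(\<mu> * a + b)\<^sup>2 \<le> (1 + \<mu>\<^sup>2) / 2 * a\<^sup>2 + (1 + \<mu>\<^sup>2) / (1 - \<mu>\<^sup>2) * b\<^sup>2"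
proof -
  have pos: "1 - \<mu>\<^sup>2 > 0" using assms by (simp add: power_less_one_iff)
  have "(1 + \<mu>\<^sup>2) / 2 * a\<^sup>2 + (1 + \<mu>\<^sup>2) / (1 - \<mu>\<^sup>2) * b\<^sup>2 - (\<mu> * a + b)\<^sup>2
      = ((1 - \<mu>\<^sup>2) * a - 2 * \<mu> * b)\<^sup>2 / (2 * (1 - \<mu>\<^sup>2))"
    using pos by (simp add: field_simps power2_eq_square)
  also have "\<dots> \<ge> 0" using pos by simp
  finally show ?thesis by simp
qed

text \<open>The sequences \<open>\<delta>\<close>, \<open>a\<close>, \<open>g\<close>, \<open>m\<close> stand for the distances of consecutive iterates, the step sizes, the
  gradient norms and the inertial coefficients.  In the proof \<open>S\<close>, \<open>Q\<close>, \<open>R\<close> are the partial sums of \<open>\<delta>\<^sup>2\<close>,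
  \<open>a\<^sup>2 g\<^sup>2\<close> and \<open>a g\<^sup>2\<close>.  Up to constants, the recursion for \<open>\<delta>\<close> bounds \<open>S\<close> by \<open>Q\<close> with a factor less than \<open>1\<close> in front of the
  returning \<open>S\<close>; the descent bounds \<open>R\<close> by \<open>L' Q\<close>; and small step sizes bound \<open>L' Q\<close> by \<open>R / 2\<close>.\<close>

lemma perturbed_descent_summable:
  fixes F \<delta> a g m :: "nat \<Rightarrow> real" and L L' A \<mu> Fmin :: real
  assumes L: "L > 0" and \<mu>: "0 < \<mu>" "\<mu> < 1"
    and L': "L' = L / 2 + 2 * L * \<mu>\<^sup>2 * (1 + \<mu>\<^sup>2) / (1 - \<mu>\<^sup>2)\<^sup>2"
    and A: "A \<le> 1 / (2 * L')"
    and a: "\<And>n. n \<ge> 1 \<Longrightarrow> 0 < a n" "\<And>n. n \<ge> 1 \<Longrightarrow> a n \<le> A"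
    and m: "\<And>n. n \<ge> 1 \<Longrightarrow> 0 \<le> m n" "\<And>n. n \<ge> 1 \<Longrightarrow> m n \<le> \<mu>"
    and g: "\<And>n. g n \<ge> 0" and \<delta>: "\<And>n. \<delta> n \<ge> 0" and Fmin: "\<And>n. F n \<ge> Fmin"
    and descent: "\<And>n. n \<ge> 1 \<Longrightarrow>
       F (Suc n) \<le> F n + L / 2 * ((m n)\<^sup>2 * (\<delta> n)\<^sup>2) - a n * (1 - L * a n / 2) * (g n)\<^sup>2"
    and step: "\<And>n. n \<ge> 1 \<Longrightarrow> \<delta> (Suc n) \<le> m n * \<delta> n + a n * g n"
  shows "(\<Sum>n=1..N. a n * (1 - L * a n / 2) * (g n)\<^sup>2) \<le> F 1 - Fmin + L / 2 * (\<Sum>n=1..N. (m n)\<^sup>2 * (\<delta> n)\<^sup>2)"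
    and "summable (\<lambda>n. (\<delta> (Suc n))\<^sup>2)"
    and "summable (\<lambda>n. a (Suc n) * (g (Suc n))\<^sup>2)"
proof -
  have tele: "(\<Sum>n=1..N. a n * (1 - L * a n / 2) * (g n)\<^sup>2) \<le> F 1 - F (Suc N) + L / 2 * (\<Sum>n=1..N. (m n)\<^sup>2 * (\<delta> n)\<^sup>2)" for N
  proof (induction N)
    case (Suc N)
    then show ?case using descent[of "Suc N"] by (simp add: distrib_left)
  qed simp
  show first: "(\<Sum>n=1..N. a n * (1 - L * a n / 2) * (g n)\<^sup>2) \<le> F 1 - Fmin + L / 2 * (\<Sum>n=1..N. (m n)\<^sup>2 * (\<delta> n)\<^sup>2)" for N
    using tele[of N] Fmin[of "Suc N"] by linarith
  define S Q R where "S = (\<lambda>N. \<Sum>n=1..N. (\<delta> n)\<^sup>2)" and "Q = (\<lambda>N. \<Sum>n=1..N. (a n)\<^sup>2 * (g n)\<^sup>2)"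
    and "R = (\<lambda>N. \<Sum>n=1..N. a n * (g n)\<^sup>2)"
  have q: "1 - \<mu>\<^sup>2 > 0" using \<mu> by (simp add: power_less_one_iff)
  define c where "c = (1 + \<mu>\<^sup>2) / (1 - \<mu>\<^sup>2)"
  have c: "c > 0" using q by (simp add: c_def add_pos_nonneg)
  have \<delta>2: "(\<delta> (Suc n))\<^sup>2 \<le> (1 + \<mu>\<^sup>2) / 2 * (\<delta> n)\<^sup>2 + c * ((a n)\<^sup>2 * (g n)\<^sup>2)" if "n \<ge> 1" for n
  proof -
    have "\<delta> (Suc n) \<le> \<mu> * \<delta> n + a n * g n"
      using step[OF that] mult_right_mono[OF m(2)[OF that] \<delta>, of n] by linarith
    then have "(\<delta> (Suc n))\<^sup>2 \<le> (\<mu> * \<delta> n + a n * g n)\<^sup>2" by (rule power_mono) (rule \<delta>)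
    also have "\<dots> \<le> (1 + \<mu>\<^sup>2) / 2 * (\<delta> n)\<^sup>2 + c * (a n * g n)\<^sup>2"
      unfolding c_def by (rule weighted_square_of_sum[OF \<mu>])
    finally show ?thesis by (simp add: power_mult_distrib)
  qed
  have SB: "S N \<le> 2 / (1 - \<mu>\<^sup>2) * ((\<delta> 1)\<^sup>2 + c * Q N)" for N
  proof -
    have "S (Suc N) \<le> (\<delta> 1)\<^sup>2 + (1 + \<mu>\<^sup>2) / 2 * S N + c * Q N"
    proof (induction N)
      case (Suc N)
      have "S (Suc (Suc N)) = S (Suc N) + (\<delta> (Suc (Suc N)))\<^sup>2" by (simp add: S_def)
      also have "\<dots> \<le> (\<delta> 1)\<^sup>2 + (1 + \<mu>\<^sup>2) / 2 * S N + c * Q N +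
         ((1 + \<mu>\<^sup>2) / 2 * (\<delta> (Suc N))\<^sup>2 + c * ((a (Suc N))\<^sup>2 * (g (Suc N))\<^sup>2))"
        using Suc \<delta>2[of "Suc N"] by linarith
      also have "\<dots> = (\<delta> 1)\<^sup>2 + (1 + \<mu>\<^sup>2) / 2 * S (Suc N) + c * Q (Suc N)"
        by (simp add: S_def Q_def distrib_left)
      finally show ?case .
    qed (simp add: S_def Q_def)
    moreover have "S N \<le> S (Suc N)" by (simp add: S_def)
    ultimately have "S N \<le> (\<delta> 1)\<^sup>2 + (1 + \<mu>\<^sup>2) / 2 * S N + c * Q N" by linarith
    then have "(1 - \<mu>\<^sup>2) * S N \<le> 2 * ((\<delta> 1)\<^sup>2 + c * Q N)" by (simp add: field_simps)
    then show ?thesis using q by (simp add: field_simps)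
  qed
  have L'pos: "L' > 0"
    using L q unfolding L' by (intro add_pos_nonneg divide_nonneg_nonneg mult_nonneg_nonneg) auto
  have QR: "L' * Q N \<le> R N / 2" for N
  proof -
    have "L' * ((a n)\<^sup>2 * (g n)\<^sup>2) \<le> a n * (g n)\<^sup>2 / 2" if "n \<ge> 1" for n
    proof -
      have "L' * a n \<le> L' * (1 / (2 * L'))" using a(2)[OF that] A L'pos by (intro mult_left_mono) auto
      then have "L' * a n \<le> 1 / 2" using L'pos by simp
      then have "(L' * a n) * (a n * (g n)\<^sup>2) \<le> 1 / 2 * (a n * (g n)\<^sup>2)"
        using a(1)[OF that] by (intro mult_right_mono) auto
      then show ?thesis by (simp add: power2_eq_square mult_ac)
    qed
    then show ?thesis unfolding Q_def R_def sum_distrib_left sum_divide_distrib by (intro sum_mono) auto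
  qed
  define K where "K = F 1 - Fmin + L * \<mu>\<^sup>2 / (1 - \<mu>\<^sup>2) * (\<delta> 1)\<^sup>2"
  have RB: "R N \<le> 2 * K" for N
  proof -
    have "(\<Sum>n=1..N. (m n)\<^sup>2 * (\<delta> n)\<^sup>2) \<le> (\<Sum>n=1..N. \<mu>\<^sup>2 * (\<delta> n)\<^sup>2)"
      using m by (intro sum_mono mult_right_mono power_mono) auto
    also have "\<dots> = \<mu>\<^sup>2 * S N" by (simp add: S_def sum_distrib_left)
    also have "\<dots> \<le> \<mu>\<^sup>2 * (2 / (1 - \<mu>\<^sup>2) * ((\<delta> 1)\<^sup>2 + c * Q N))" using SB by (intro mult_left_mono) auto
    finally have "L / 2 * (\<Sum>n=1..N. (m n)\<^sup>2 * (\<delta> n)\<^sup>2) \<le> L / 2 * (\<mu>\<^sup>2 * (2 / (1 - \<mu>\<^sup>2) * ((\<delta> 1)\<^sup>2 + c * Q N)))"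
      using L by (intro mult_left_mono) auto
    also have "\<dots> = L * \<mu>\<^sup>2 / (1 - \<mu>\<^sup>2) * (\<delta> 1)\<^sup>2 + L * \<mu>\<^sup>2 * (1 + \<mu>\<^sup>2) / (1 - \<mu>\<^sup>2)\<^sup>2 * Q N"
      unfolding c_def by (simp add: algebra_simps add_divide_distrib power2_eq_square)
    finally have mid: "L / 2 * (\<Sum>n=1..N. (m n)\<^sup>2 * (\<delta> n)\<^sup>2) \<le>
      L * \<mu>\<^sup>2 / (1 - \<mu>\<^sup>2) * (\<delta> 1)\<^sup>2 + L * \<mu>\<^sup>2 * (1 + \<mu>\<^sup>2) / (1 - \<mu>\<^sup>2)\<^sup>2 * Q N" .
    have "R N - L / 2 * Q N = (\<Sum>n=1..N. a n * (1 - L * a n / 2) * (g n)\<^sup>2)"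
      unfolding R_def Q_def sum_distrib_left sum_subtractf[symmetric]
      by (intro sum.cong) (auto simp: algebra_simps power2_eq_square)
    then have "R N - L / 2 * Q N \<le> K + L * \<mu>\<^sup>2 * (1 + \<mu>\<^sup>2) / (1 - \<mu>\<^sup>2)\<^sup>2 * Q N"
      using first[of N] mid unfolding K_def by linarith
    moreover have "L * \<mu>\<^sup>2 * (1 + \<mu>\<^sup>2) / (1 - \<mu>\<^sup>2)\<^sup>2 * Q N \<le> 2 * L * \<mu>\<^sup>2 * (1 + \<mu>\<^sup>2) / (1 - \<mu>\<^sup>2)\<^sup>2 * Q N"
    proof -
      have "Q N \<ge> 0" unfolding Q_def by (intro sum_nonneg) auto
      moreover have "L * \<mu>\<^sup>2 * (1 + \<mu>\<^sup>2) / (1 - \<mu>\<^sup>2)\<^sup>2 \<ge> 0" using L by simp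
      ultimately have "L * \<mu>\<^sup>2 * (1 + \<mu>\<^sup>2) / (1 - \<mu>\<^sup>2)\<^sup>2 * Q N \<ge> 0" by (rule mult_nonneg_nonneg[rotated])
      then show ?thesis by simp
    qed
    moreover have "L / 2 * Q N + 2 * L * \<mu>\<^sup>2 * (1 + \<mu>\<^sup>2) / (1 - \<mu>\<^sup>2)\<^sup>2 * Q N = L' * Q N"
      unfolding L' by (rule distrib_right[symmetric])
    ultimately show ?thesis using QR[of N] by linarith
  qed
  have shift: "(\<Sum>n<N. h (Suc n)) = (\<Sum>n=1..N. h n)" for h :: "nat \<Rightarrow> real" and N
    by (simp add: sum.atLeast1_atMost_eq)
  show "summable (\<lambda>n. a (Suc n) * (g (Suc n))\<^sup>2)"
  proof (rule summableI_nonneg_bounded)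
    show "(\<Sum>n<N. a (Suc n) * (g (Suc n))\<^sup>2) \<le> 2 * K" for N
      using RB[of N] unfolding R_def shift[of "\<lambda>n. a n * (g n)\<^sup>2"] .
    show "0 \<le> a (Suc n) * (g (Suc n))\<^sup>2" for n using a(1)[of "Suc n"] by simp
  qed
  show "summable (\<lambda>n. (\<delta> (Suc n))\<^sup>2)"
  proof (rule summableI_nonneg_bounded)
    fix N
    have "L' * Q N \<le> K" using QR[of N] RB[of N] by linarith
    then have "Q N \<le> K / L'" using L'pos by (simp add: field_simps)
    then have "2 / (1 - \<mu>\<^sup>2) * ((\<delta> 1)\<^sup>2 + c * Q N) \<le> 2 / (1 - \<mu>\<^sup>2) * ((\<delta> 1)\<^sup>2 + c * (K / L'))"
      using q c by (intro mult_left_mono add_left_mono) auto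
    then show "(\<Sum>n<N. (\<delta> (Suc n))\<^sup>2) \<le> 2 / (1 - \<mu>\<^sup>2) * ((\<delta> 1)\<^sup>2 + c * (K / L'))"
      using SB[of N] unfolding S_def shift[of "\<lambda>n. (\<delta> n)\<^sup>2"] by linarith
  qed simp
qed

text \<open>If \<open>g\<close> stayed above some \<open>r > 0\<close>, then \<open>a \<le> a g\<^sup>2 / r\<^sup>2\<close> would be summable.\<close>

lemma liminf_zero_of_weighted_summable:
  fixes a g :: "nat \<Rightarrow> real"
  assumes a: "\<And>n. n \<ge> 1 \<Longrightarrow> 0 < a n" and g: "\<And>n. g n \<ge> 0"
    and sum: "summable (\<lambda>n. a (Suc n) * (g (Suc n))\<^sup>2)"
    and div: "filterlim (\<lambda>N. \<Sum>n=1..N. a n) at_top sequentially"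
  shows "liminf (\<lambda>n. ereal (g n)) = 0"
proof (rule antisym)
  show "0 \<le> liminf (\<lambda>n. ereal (g n))" by (rule Liminf_bounded) (simp add: g)
  show "liminf (\<lambda>n. ereal (g n)) \<le> 0"
  proof (rule ccontr)
    assume "\<not> liminf (\<lambda>n. ereal (g n)) \<le> 0"
    then obtain r where r: "0 < ereal r" "ereal r < liminf (\<lambda>n. ereal (g n))"
      using ereal_dense2[of 0] by (auto simp: not_le)
    then have "r > 0" and "\<forall>\<^sub>F n in sequentially. r < g n" using less_LiminfD[OF r(2)] by auto
    then obtain n0 where n0: "\<And>n. n \<ge> n0 \<Longrightarrow> r < g n" by (auto simp: eventually_sequentially)
    have "summable (\<lambda>n. a (Suc n))"
    proof (rule summable_comparison_test')
      show "summable (\<lambda>n. a (Suc n) * (g (Suc n))\<^sup>2 / r\<^sup>2)" by (rule summable_divide[OF sum])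
      show "norm (a (Suc n)) \<le> a (Suc n) * (g (Suc n))\<^sup>2 / r\<^sup>2" if "n \<ge> n0" for n
      proof -
        have "r\<^sup>2 \<le> (g (Suc n))\<^sup>2" using n0[of "Suc n"] that \<open>r > 0\<close> by (intro power_mono) auto
        then have "a (Suc n) * r\<^sup>2 \<le> a (Suc n) * (g (Suc n))\<^sup>2" using a[of "Suc n"] by (intro mult_left_mono) auto
        then show ?thesis using a[of "Suc n"] \<open>r > 0\<close> by (simp add: field_simps)
      qed
    qed
    then have "(\<Sum>n<N. a (Suc n)) \<le> (\<Sum>n. a (Suc n))" for N
      using a by (intro sum_le_suminf) (auto intro: less_imp_le)
    then have bd: "(\<Sum>n=1..N. a n) \<le> (\<Sum>n. a (Suc n))" for N
      by (simp add: sum.atLeast1_atMost_eq)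
    from div have "\<forall>\<^sub>F N in sequentially. (\<Sum>n=1..N. a n) > (\<Sum>n. a (Suc n))"
      by (simp add: filterlim_at_top_dense)
    then show False using bd by (auto simp: eventually_sequentially not_less[symmetric])
  qed
qed

lemma tendsto_zero_of_weighted_summable:
  fixes a g :: "nat \<Rightarrow> real"
  assumes a: "\<And>n. n \<ge> 1 \<Longrightarrow> 0 < a n" and g: "\<And>n. g n \<ge> 0"
    and sum: "summable (\<lambda>n. a (Suc n) * (g (Suc n))\<^sup>2)"
    and inf: "(INF n\<in>{1..}. a n) > 0"
  shows "g \<longlonglongrightarrow> 0"
proof -
  define I where "I = (INF n\<in>{1..}. a n)"
  have "bdd_below (a ` {1..})" using a by (auto intro!: bdd_belowI[of _ 0] less_imp_le)
  then have I: "I \<le> a n" if "n \<ge> 1" for n unfolding I_def using that by (intro cINF_lower) auto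
  have "I > 0" using inf by (simp only: I_def)
  have "(\<lambda>n. (g (Suc n))\<^sup>2) \<longlonglongrightarrow> 0"
  proof (rule tendsto_sandwich[where f="\<lambda>_. 0"])
    show "(\<lambda>n. a (Suc n) * (g (Suc n))\<^sup>2 / I) \<longlonglongrightarrow> 0"
      using tendsto_divide[OF summable_LIMSEQ_zero[OF sum] tendsto_const, of I] \<open>I > 0\<close> by simp
    have "I * (g (Suc n))\<^sup>2 \<le> a (Suc n) * (g (Suc n))\<^sup>2" for n
      using I[of "Suc n"] by (intro mult_right_mono) auto
    then show "\<forall>\<^sub>F n in sequentially. (g (Suc n))\<^sup>2 \<le> a (Suc n) * (g (Suc n))\<^sup>2 / I"
      using \<open>I > 0\<close> by (simp add: field_simps)
  qed auto
  then have "(\<lambda>n. sqrt ((g (Suc n))\<^sup>2)) \<longlonglongrightarrow> sqrt 0" by (rule tendsto_real_sqrt)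
  then have "(\<lambda>n. g (Suc n)) \<longlonglongrightarrow> 0" using g by simp
  then show ?thesis by (rule LIMSEQ_imp_Suc)
qed

section \<open>Convergence of the iteration\<close>

context complete_riemannian
begin

text \<open>The step from \<open>x n\<close> to \<open>w n\<close> raises \<open>f\<close> by its quadratic term at most, since the linear term is
  nonpositive whenever \<open>\<mu>t n\<close> is not \<open>0\<close>; the step from \<open>w n\<close> to \<open>x (n + 1)\<close> is a gradient step.\<close>

lemma riag_r_iterates:
  assumes lg: "log_map M lg" and f: "C1_function M f" and L: "lipschitz_gradient M L f" "L > 0"
    and par: "\<eta> > 0" "\<epsilon> > 0" "0 < \<mu>"
    and alg: "riag_r M lg f \<eta> \<epsilon> \<mu> x \<mu>b d \<mu>t w G \<alpha>"
    and n: "n \<ge> 1"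
  shows "0 < \<alpha> n" "\<alpha> n \<le> \<eta> / \<epsilon>" "0 \<le> \<mu>t n" "\<mu>t n \<le> \<mu>"
    and "f (x (Suc n)) \<le> f (x n) + L / 2 * ((\<mu>t n)\<^sup>2 * (rdist M (x n) (x (n - 1)))\<^sup>2)
       - \<alpha> n * (1 - L * \<alpha> n / 2) * (tnorm M (w n) (grad M f (w n)))\<^sup>2"
    and "rdist M (x (Suc n)) (x n) \<le> \<mu>t n * rdist M (x n) (x (n - 1)) + \<alpha> n * tnorm M (w n) (grad M f (w n))"
proof -
  let ?g = "\<lambda>n. tnorm M (w n) (grad M f (w n))" and ?D = "rdist M (x n) (x (n - 1))"
  have G0: "G 0 = 0" and Gs: "\<And>n. n \<ge> 1 \<Longrightarrow> G n = G (n - 1) + (?g n)\<^sup>2"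
    using alg by (auto simp: riag_r_def)
  have \<mu>b: "\<mu>b n = (if x n \<noteq> x (n - 1) then min \<mu> (\<mu> * ?D) else \<mu>)"
    and dn: "d n = - lg (x n) (x (n - 1))"
    and \<mu>t: "\<mu>t n = (if riem_metric M (x n) (grad M f (x n)) (d n) > 0 then 0 else \<mu>b n)"
    and wn: "w n = exp_map M (x n) (tscale (\<mu>t n) (d n))"
    and \<alpha>: "\<alpha> n = \<eta> / (sqrt (G n) + \<epsilon>)"
    and xs: "x (Suc n) = exp_map M (w n) (tscale (- \<alpha> n) (grad M f (w n)))"
    using alg n by (auto simp: riag_r_def)
  have G: "G k \<ge> 0" for k
  proof (induction k)
    case (Suc k)
    then show ?case using Gs[of "Suc k"] by simp
  qed (simp add: G0)
  have den: "\<epsilon> \<le> sqrt (G n) + \<epsilon>" using G[of n] by simp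
  show \<alpha>pos: "0 < \<alpha> n" unfolding \<alpha> using par G[of n] by (intro divide_pos_pos add_nonneg_pos) auto
  show "\<alpha> n \<le> \<eta> / \<epsilon>" unfolding \<alpha> using par den by (intro frac_le) auto
  have lgT: "lg (x n) (x (n - 1)) \<in> TM (x n)" "tnorm M (x n) (lg (x n) (x (n - 1))) = ?D"
    using lg by (auto simp: log_map_def)
  have D0: "?D \<ge> 0" using tnorm_nonneg[OF lgT(1)] lgT(2) by simp
  show \<mu>t0: "0 \<le> \<mu>t n" "\<mu>t n \<le> \<mu>" unfolding \<mu>t \<mu>b using par D0 by auto
  have dT: "d n \<in> TM (x n)" and dnorm: "tnorm M (x n) (d n) = ?D"
    unfolding dn uminus_eq_tscale using tangent_space_scale[OF lgT(1)] tnorm_scale[OF lgT(1), of "-1"] lgT(2) by auto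
  have gT: "grad M f y \<in> TM y" for y by (rule grad_in_tangent_space[OF f])
  have L0: "L \<ge> 0" using L(2) by simp
  note uT = tangent_space_scale[OF dT, of "\<mu>t n"] and vT = tangent_space_scale[OF gT, of "- \<alpha> n" "w n"]
  have unorm: "tnorm M (x n) (tscale (\<mu>t n) (d n)) = \<mu>t n * ?D"
    using tnorm_scale[OF dT] \<mu>t0 by (simp add: dnorm)
  have vnorm: "tnorm M (w n) (tscale (- \<alpha> n) (grad M f (w n))) = \<alpha> n * ?g n"
    using tnorm_scale[OF gT] \<alpha>pos by simp
  have "f (w n) \<le> f (x n) + riem_metric M (x n) (grad M f (x n)) (tscale (\<mu>t n) (d n)) + L / 2 * (\<mu>t n * ?D)\<^sup>2"
    using descent_inequality[OF lg f L(1) L0 uT] by (simp add: wn unorm)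
  moreover have "riem_metric M (x n) (grad M f (x n)) (tscale (\<mu>t n) (d n)) \<le> 0"
    unfolding riem_metric_scale_right[OF gT dT] using \<mu>t \<mu>t0(1) by (auto simp: mult_nonneg_nonpos)
  ultimately have 1: "f (w n) \<le> f (x n) + L / 2 * ((\<mu>t n)\<^sup>2 * ?D\<^sup>2)" by (simp add: power_mult_distrib)
  have "f (x (Suc n)) \<le> f (w n) + riem_metric M (w n) (grad M f (w n)) (tscale (- \<alpha> n) (grad M f (w n)))
      + L / 2 * (\<alpha> n * ?g n)\<^sup>2"
    using descent_inequality[OF lg f L(1) L0 vT] by (simp add: xs vnorm)
  also have "riem_metric M (w n) (grad M f (w n)) (tscale (- \<alpha> n) (grad M f (w n))) = - \<alpha> n * (?g n)\<^sup>2"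
    unfolding riem_metric_scale_right[OF gT gT] tnorm_square[OF gT] ..
  also have "f (w n) + - \<alpha> n * (?g n)\<^sup>2 + L / 2 * (\<alpha> n * ?g n)\<^sup>2 = f (w n) - \<alpha> n * (1 - L * \<alpha> n / 2) * (?g n)\<^sup>2"
    by (simp add: power2_eq_square algebra_simps)
  finally show "f (x (Suc n)) \<le> f (x n) + L / 2 * ((\<mu>t n)\<^sup>2 * ?D\<^sup>2) - \<alpha> n * (1 - L * \<alpha> n / 2) * (?g n)\<^sup>2"
    using 1 by linarith
  show "rdist M (x (Suc n)) (x n) \<le> \<mu>t n * ?D + \<alpha> n * ?g n"
    using rdist_two_steps[OF uT vT[unfolded wn]] by (simp add: wn[symmetric] xs[symmetric] unorm vnorm)
qed

end

theorem lemma3p4: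
  fixes M :: "('a::{t2_space, second_countable_topology}, 'e::euclidean_space) riem"
    and lg :: "'a \<Rightarrow> 'a \<Rightarrow> ('a, 'e) tangent"
    and f :: "'a \<Rightarrow> real"
    and L L' fstar \<eta> \<epsilon> \<mu> :: real
    and x w :: "nat \<Rightarrow> 'a"
    and d :: "nat \<Rightarrow> ('a, 'e) tangent"
    and \<mu>b \<mu>t G \<alpha> :: "nat \<Rightarrow> real"
  assumes "riemannian_manifold M"
    and "connected (UNIV :: 'a set)"
    and "geodesically_complete M"
    and "log_map M lg"
    and "C1_function M f"
    and "L > 0"
    and "lipschitz_gradient M L f"
    and "\<And>y. f y \<ge> fstar"
    and "\<eta> > 0" and "\<epsilon> > 0" and "0 < \<mu>" and "\<mu> < 1"
    and "riag_r M lg f \<eta> \<epsilon> \<mu> x \<mu>b d \<mu>t w G \<alpha>"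
    and "L' = L / 2 + 2 * L * \<mu>\<^sup>2 * (1 + \<mu>\<^sup>2) / (1 - \<mu>\<^sup>2)\<^sup>2"
    and "\<eta> / \<epsilon> \<le> 1 / (2 * L')"
  shows "(\<forall>N\<ge>1. (\<Sum>n=1..N. \<alpha> n * (1 - L * \<alpha> n / 2) * (tnorm M (w n) (grad M f (w n)))\<^sup>2)
            \<le> f (x 1) - fstar
               + L / 2 * (\<Sum>n=1..N. (\<mu>t n)\<^sup>2 * (rdist M (x n) (x (n - 1)))\<^sup>2))
    \<and> summable (\<lambda>n. (rdist M (x (Suc n)) (x n))\<^sup>2)
    \<and> summable (\<lambda>n. \<alpha> (Suc n) * (tnorm M (w (Suc n)) (grad M f (w (Suc n))))\<^sup>2)
    \<and> (\<lambda>n. rdist M (x (Suc n)) (x n)) \<longlonglongrightarrow> 0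
    \<and> (filterlim (\<lambda>N. \<Sum>n=1..N. \<alpha> n) at_top sequentially
         \<longrightarrow> liminf (\<lambda>n. ereal (tnorm M (w n) (grad M f (w n)))) = 0)
    \<and> ((INF n\<in>{1..}. \<alpha> n) > 0
         \<longrightarrow> (\<lambda>n. tnorm M (w n) (grad M f (w n))) \<longlonglongrightarrow> 0)"
proof -
  interpret complete_riemannian M
    using assms(1,3) by unfold_locales
  define \<delta> where "\<delta> = (\<lambda>n. rdist M (x n) (x (n - 1)))"
  define g where "g = (\<lambda>n. tnorm M (w n) (grad M f (w n)))"
  note it = riag_r_iterates[OF assms(4,5,7,6,9,10,11,13)]
  have g: "g n \<ge> 0" for n unfolding g_def by (intro tnorm_nonneg grad_in_tangent_space assms(5))
  have \<delta>: "\<delta> n \<ge> 0" for n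
    using assms(4) tnorm_nonneg unfolding \<delta>_def log_map_def by metis
  note series = perturbed_descent_summable[where F="\<lambda>n. f (x n)" and Fmin=fstar and \<delta>=\<delta> and g=g and m=\<mu>t and a=\<alpha>,
      OF assms(6,11,12,14,15) it(1-4) g \<delta> assms(8)]
  have descent: "f (x (Suc n)) \<le> f (x n) + L / 2 * ((\<mu>t n)\<^sup>2 * (\<delta> n)\<^sup>2) - \<alpha> n * (1 - L * \<alpha> n / 2) * (g n)\<^sup>2"
    and step: "\<delta> (Suc n) \<le> \<mu>t n * \<delta> n + \<alpha> n * g n" if "n \<ge> 1" for n
    using it(5,6)[OF that] by (simp_all add: \<delta>_def g_def)
  note S = series[OF _ _ _ _ descent step]
  have S1: "(\<Sum>n=1..N. \<alpha> n * (1 - L * \<alpha> n / 2) * (g n)\<^sup>2) \<le> f (x 1) - fstar + L / 2 * (\<Sum>n=1..N. (\<mu>t n)\<^sup>2 * (\<delta> n)\<^sup>2)" for N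
    by (rule S(1))
  have S2: "summable (\<lambda>n. (\<delta> (Suc n))\<^sup>2)" by (rule S(2))
  have S3: "summable (\<lambda>n. \<alpha> (Suc n) * (g (Suc n))\<^sup>2)" by (rule S(3))
  have "(\<lambda>n. sqrt ((\<delta> (Suc n))\<^sup>2)) \<longlonglongrightarrow> sqrt 0"
    by (rule tendsto_real_sqrt[OF summable_LIMSEQ_zero[OF S2]])
  then have "(\<lambda>n. \<delta> (Suc n)) \<longlonglongrightarrow> 0" using \<delta> by simp
  then show ?thesis
    using S1 S2 S3 liminf_zero_of_weighted_summable[OF it(1) g S3] tendsto_zero_of_weighted_summable[OF it(1) g S3]
    by (simp add: \<delta>_def g_def)
qed

end
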